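(* Let $f:\mathbb{C}\to\mathbb{C}$ be a transcendental entire function and suppose that \[ \limsup_{r\to\infty}\frac{\log L(r,f)}{\log M(r,f)}<1 . \] Then $\dim_{\mathrm P}\bigl(I(f)\cap J(f)\bigr)=2$.
   Context: For an entire function $f$: $M(r,f):=\max_{|z|=r}|f(z)|$ is the maximum modulus and $L(r,f):=\min_{|z|=r}|f(z)|$ is the minimum modulus, with the convention $\log 0=-\infty$. $f^n$ denotes the $n$-th iterate. The Fatou set $F(f)$ is the set of all $z\in\mathbb{C}$ having a neighborhood on which the iterates $f^n$ form a normal family (with respect to the spherical metric, so locally uniform convergence to $\infty$ is allowed). The Julia set is $J(f)=\mathbb{C}\setminus F(f)$. The escaping set is $I(f)=\{z\in\mathbb{C}: f^n(z)\to\infty \text{ as } n\to\infty\}$. $\dim_{\mathrm P}A$ denotes the packing dimension of $A\subset\mathbb{C}$, which equals $\inf\{\sup_i \overline{\dim}_{\mathrm B}A_i\}$, the infimum being over all countable covers $A\subset\bigcup_i A_i$ by bounded sets, where $\overline{\dim}_{\mathrm B}$ is the upper box dimension. *)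

theory Defs
  imports "HOL-Complex_Analysis.Complex_Analysis"
begin

definition transcendental_entire :: "(complex \<Rightarrow> complex) \<Rightarrow> bool" where
  "transcendental_entire f \<longleftrightarrow>
     f holomorphic_on UNIV \<and> \<not> (\<exists>p :: complex poly. \<forall>z. f z = poly p z)"

(* For continuous f and r \<ge> 0 the supremum and the infimum are attained, by compactness
   of the circle, so they are the maximum and the minimum. *)

definition max_modulus :: "real \<Rightarrow> (complex \<Rightarrow> complex) \<Rightarrow> real" where
  "max_modulus r f = (SUP z\<in>sphere 0 r. cmod (f z))"

definition min_modulus :: "real \<Rightarrow> (complex \<Rightarrow> complex) \<Rightarrow> real" where
  "min_modulus r f = (INF z\<in>sphere 0 r. cmod (f z))"

(* Logarithm of a nonnegative real with log 0 = -\<infinity>; the library has ln 0 = 0. *)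

definition log_ereal :: "real \<Rightarrow> ereal" where
  "log_ereal x = (if x = 0 then -\<infinity> else ereal (ln x))"

(* Inverse stereographic projection onto the unit sphere of \<complex> \<times> \<real>, which serves as the Riemann
   sphere, with (0, 1) as the point \<infinity>. The distance of the images of two points is their
   chordal distance 2|z - w| / sqrt ((1 + |z|^2) (1 + |w|^2)). *)

definition to_sphere :: "complex \<Rightarrow> complex \<times> real" where
  "to_sphere z =
     ((2 / (1 + (cmod z)\<^sup>2)) *\<^sub>R z, ((cmod z)\<^sup>2 - 1) / ((cmod z)\<^sup>2 + 1))"

(* The limit g is not required to take values in the sphere: it does so on U because the
   sphere is closed. In particular g may be (0, 1), i.e. \<infinity>, on U. *)

definition normal_family_on :: "complex set \<Rightarrow> (complex \<Rightarrow> complex) set \<Rightarrow> bool" where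
  "normal_family_on U \<F> \<longleftrightarrow>
     (\<forall>F :: nat \<Rightarrow> complex \<Rightarrow> complex. range F \<subseteq> \<F> \<longrightarrow>
        (\<exists>k :: nat \<Rightarrow> nat. \<exists>g :: complex \<Rightarrow> complex \<times> real. strict_mono k \<and>
           (\<forall>K. compact K \<and> K \<subseteq> U \<longrightarrow>
              uniform_limit K (\<lambda>n z. to_sphere (F (k n) z)) g sequentially)))"

definition fatou_set :: "(complex \<Rightarrow> complex) \<Rightarrow> complex set" where
  "fatou_set f = {z. \<exists>U. open U \<and> z \<in> U \<and> normal_family_on U (range (\<lambda>n. f ^^ n))}"

definition julia_set :: "(complex \<Rightarrow> complex) \<Rightarrow> complex set" where
  "julia_set f = - fatou_set f"

definition escaping_set :: "(complex \<Rightarrow> complex) \<Rightarrow> complex set" where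
  "escaping_set f = {z. filterlim (\<lambda>n. (f ^^ n) z) at_infinity sequentially}"

(* Least number of closed balls of radius d that cover A; used for bounded A and d > 0, where
   a finite cover exists. *)

definition covering_number :: "real \<Rightarrow> 'a::euclidean_space set \<Rightarrow> nat" where
  "covering_number d A =
     (LEAST n. \<exists>C. finite C \<and> card C = n \<and> A \<subseteq> (\<Union>c\<in>C. cball c d))"

(* The empty set gets dimension 0, since ln 0 = 0; as box dimensions of bounded sets are
   nonnegative, empty members do not affect the suprema over covers below. *)

definition upper_box_dim :: "'a::euclidean_space set \<Rightarrow> ereal" where
  "upper_box_dim A =
     Limsup (at_right 0) (\<lambda>d. ereal (ln (real (covering_number d A)) / ln (1 / d)))"

definition packing_dim :: "'a::euclidean_space set \<Rightarrow> ereal" where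
  "packing_dim A =
     (INF B \<in> {B :: nat \<Rightarrow> 'a set. (\<forall>i. bounded (B i)) \<and> A \<subseteq> (\<Union>i. B i)}.
        SUP i. upper_box_dim (B i))"

end

theory Submission
  imports Defs
begin

text \<open>
  Let \<open>M r\<close> be the maximum modulus, \<open>logM r\<close> its logarithm and \<open>c < 1\<close> a number such that the
  minimum modulus is at most \<open>M r ^ c\<close> for all large \<open>r\<close>. The proof exhibits, inside the
  escaping points of the Julia set, a tree of compact cells which has so many branches at
  arbitrarily small scales that every countable cover has a member of box dimension close to 2.

  Expansion. On every large circle \<open>log |f|\<close> falls from \<open>logM r\<close> to at most \<open>c * logM r\<close>. Hence the
  logarithmic speed \<open>|z f'(z) / f(z)|\<close> has a circle integral comparable to \<open>logM r\<close>. This speed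
  cannot be concentrated on a small set: up to factors \<open>(logM r)^e\<close> with small \<open>e\<close> it is at most
  \<open>logM r\<close> plus a sum of \<open>logM r\<close> kernels \<open>|z| / |z - a|\<close> (lemma \<open>log_derivative_bound\<close>, from
  Blaschke factors and Harnack's inequality), and these kernels are uniformly bounded in \<open>L^p\<close>
  for each \<open>p < 2\<close>, as functions of \<open>log z\<close> (\<open>proximity_integral_bound\<close>). So the speed exceeds
  \<open>(logM r)^(1/2)\<close> on a set of nearly full area (\<open>fast_region_large\<close>). The same integral
  estimate shows that \<open>logM r\<close> grows at least like a power of \<open>r\<close> (\<open>growth_exponent\<close>).

  Branching. Where the speed exceeds \<open>(logM r)^(1/2)\<close>, Schottky's theorem shows that \<open>f\<close> maps a
  disc of relative radius about \<open>(logM r)^(-1/2)\<close> onto a full annulus of large radius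
  (\<open>schottky_covering\<close>). The fast region contains about \<open>(logM r)^(1 - e)\<close> such discs that are
  separated by their own size, nearly as many as its area admits, and on each of them \<open>|f'|\<close> is
  at most a power close to 1 of the radius of the image annulus (\<open>children\<close>).

  The tree. A cell of level \<open>k\<close> is a compact set that \<open>f^k\<close> maps onto an annulus; pulling back the
  discs above gives its children. An upper Lipschitz bound for \<open>f^k\<close>, which multiplies up along
  branches, keeps the children of a cell apart. Since \<open>logM r\<close> exceeds a power of \<open>r\<close>, the
  accumulated Lipschitz constant is a negligible power of \<open>logM r\<close>, so the scale at which
  \<open>n\<close> children of a cell of high level are separated is not much smaller than \<open>n^(-1/2)\<close>. A point that lies in
  cells of all levels escapes.

  The Julia set. Quasi-normality is a weakening of normality that passes to images under \<open>f\<close>;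
  its complement \<open>quasi_julia_set\<close> is closed, contained in the Julia set and backward invariant. It
  meets every large annulus: otherwise a subsequence of the iterates tends to infinity near the
  annulus, and by Harnack's inequality the numbers \<open>log |f^n|\<close> have ratios close to 1 there; but
  \<open>f^n\<close> maps a cell in the annulus onto a set containing the image of a full circle, on which
  \<open>log |f|\<close> ranges from \<open>logM r\<close> to \<open>c * logM r\<close> (\<open>quasi_julia_set_meets_annulus\<close>). Therefore every
  cell contains points of \<open>quasi_julia_set\<close>.

  Baire's argument is applied to the tree and not to the plane, because cells of high level need
  not be small. If for every member of a countable cover every cell had a descendant missed by
  that member, nested cells would yield an uncovered point. So one member meets all descendants
  of some cell (\<open>some_piece_meets_all_descendants\<close>), hence all children of cells of arbitrarily
  high level, and this forces its box dimension up. The upper bound 2 holds for every subset of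
  the plane.
\<close>

section \<open>Harnack inequalities and the logarithmic derivative\<close>

text \<open>Schwarz's lemma for the Cayley transform of \<open>h\<close>. The first estimate contains the
  Borel--Caratheodory inequality, the other two are Harnack's inequality for \<open>Re h\<close>.\<close>

lemma positive_real_part_oscillation:
  fixes h :: "complex \<Rightarrow> complex"
  assumes hol: "h holomorphic_on ball a \<rho>" and pos: "\<And>w. w \<in> ball a \<rho> \<Longrightarrow> Re (h w) > 0"
    and z: "z \<in> ball a \<rho>"
  shows "(\<rho> - dist a z) * norm (h z - h a) \<le> 2 * dist a z * Re (h a)"
    and "(\<rho> - dist a z) * Re (h a) \<le> (\<rho> + dist a z) * Re (h z)"
    and "(\<rho> - dist a z) * Re (h z) \<le> (\<rho> + dist a z) * Re (h a)"
proof -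
  have \<rho>: "\<rho> > 0" using z zero_le_dist[of a z] unfolding mem_ball by linarith
  define \<phi> where "\<phi> = (\<lambda>w::complex. (h (a + \<rho> * w) - h a) / (h (a + \<rho> * w) + cnj (h a)))"
  have inb: "a + \<rho> * w \<in> ball a \<rho>" if "norm w < 1" for w :: complex
    using that \<rho> by (simp add: dist_norm norm_mult)
  have ha: "Re (h a) > 0" using pos \<rho> by simp
  have posin: "Re (h (a + \<rho> * w)) > 0" if "norm w < 1" for w :: complex
    by (rule pos, rule inb, rule that)
  have ne: "h (a + \<rho> * w) + cnj (h a) \<noteq> 0" if "norm w < 1" for w :: complex
  proof -
    have "Re (h (a + \<rho> * w) + cnj (h a)) > 0" using posin[OF that] ha by simp
    thus ?thesis by (metis less_irrefl zero_complex.sel(1))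
  qed
  have holh: "(\<lambda>w::complex. h (a + \<rho> * w)) holomorphic_on ball 0 1"
    by (rule holomorphic_on_compose_gen[OF _ hol, unfolded o_def]) (use inb in \<open>auto intro!: holomorphic_intros\<close>)
  have hol\<phi>: "\<phi> holomorphic_on ball 0 1"
    unfolding \<phi>_def using ne by (intro holomorphic_intros holh) auto
  have lt1: "norm (\<phi> w) < 1" if w: "norm w < 1" for w :: complex
  proof -
    let ?u = "h (a + \<rho> * w)"
    have "(norm (?u + cnj (h a)))\<^sup>2 - (norm (?u - h a))\<^sup>2 = 4 * Re ?u * Re (h a)"
      unfolding cmod_power2 by (simp add: power2_eq_square algebra_simps)
    moreover have "4 * Re ?u * Re (h a) > 0" using posin[OF w] ha by simp
    ultimately have "(norm (?u - h a))\<^sup>2 < (norm (?u + cnj (h a)))\<^sup>2" by linarith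
    hence "norm (?u - h a) < norm (?u + cnj (h a))"
      by (rule power2_less_imp_less) auto
    thus ?thesis using ne[OF w] by (simp add: \<phi>_def norm_divide divide_less_eq)
  qed
  define w where "w = (z - a) / \<rho>"
  have zw: "a + \<rho> * w = z" using \<rho> by (simp add: w_def)
  have nw: "norm w = dist a z / \<rho>" using \<rho> by (simp add: w_def norm_divide dist_norm norm_minus_commute)
  have w1: "norm w < 1" using z \<rho> by (simp add: nw)
  have "norm (\<phi> w) \<le> norm w"
    by (rule Schwarz_Lemma(1)[OF hol\<phi>]) (use lt1 w1 in \<open>auto simp: \<phi>_def\<close>)
  hence main: "norm (h z - h a) \<le> norm w * norm (h z + cnj (h a))"
    using ne[OF w1] zw by (simp add: \<phi>_def norm_divide divide_le_eq)
  have "norm (h z + cnj (h a)) \<le> norm (h z - h a) + 2 * Re (h a)"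
  proof -
    have "h z + cnj (h a) = (h z - h a) + of_real (2 * Re (h a))"
      by (simp add: complex_eq_iff)
    also have "norm \<dots> \<le> norm (h z - h a) + norm (of_real (2 * Re (h a)) :: complex)"
      by (rule norm_triangle_ineq)
    finally show ?thesis using ha by (simp add: norm_of_real del: of_real_mult)
  qed
  with main have "norm (h z - h a) \<le> norm w * (norm (h z - h a) + 2 * Re (h a))"
    by (meson mult_left_mono norm_ge_zero order_trans)
  hence "\<rho> * norm (h z - h a) \<le> \<rho> * (norm w * (norm (h z - h a) + 2 * Re (h a)))"
    using \<rho> by simp
  also have "\<dots> = dist a z * (norm (h z - h a) + 2 * Re (h a))"
    using \<rho> by (simp add: nw)
  finally show "(\<rho> - dist a z) * norm (h z - h a) \<le> 2 * dist a z * Re (h a)" by (simp add: algebra_simps)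
  have hz: "Re (h z) > 0" using pos z by blast
  have "(norm (h z - h a))\<^sup>2 \<le> (norm w * norm (h z + cnj (h a)))\<^sup>2"
    using main by (intro power_mono) auto
  hence "(Re (h z) - Re (h a))\<^sup>2 + (Im (h z) - Im (h a))\<^sup>2 \<le>
      (norm w)\<^sup>2 * ((Re (h z) + Re (h a))\<^sup>2 + (Im (h z) - Im (h a))\<^sup>2)"
    by (simp add: power_mult_distrib) (simp add: cmod_power2)
  moreover have "(norm w)\<^sup>2 * (Im (h z) - Im (h a))\<^sup>2 \<le> 1 * (Im (h z) - Im (h a))\<^sup>2"
    using w1 by (intro mult_right_mono) (auto simp: power_le_one)
  ultimately have "(Re (h z) - Re (h a))\<^sup>2 \<le> (norm w * (Re (h z) + Re (h a)))\<^sup>2"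
    unfolding power_mult_distrib by (simp add: distrib_left)
  hence "\<bar>Re (h z) - Re (h a)\<bar> \<le> \<bar>norm w * (Re (h z) + Re (h a))\<bar>"
    by (simp only: abs_le_square_iff)
  moreover have "norm w * (Re (h z) + Re (h a)) \<ge> 0" using ha hz by simp
  ultimately have "\<bar>Re (h z) - Re (h a)\<bar> \<le> norm w * (Re (h z) + Re (h a))" by linarith
  hence "\<rho> * \<bar>Re (h z) - Re (h a)\<bar> \<le> \<rho> * (norm w * (Re (h z) + Re (h a)))"
    using \<rho> by simp
  also have "\<dots> = dist a z * (Re (h z) + Re (h a))" using \<rho> by (simp add: nw)
  finally have fin: "\<bar>\<rho> * (Re (h z) - Re (h a))\<bar> \<le> dist a z * (Re (h z) + Re (h a))"
    using \<rho> by (simp add: abs_mult)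
  show "(\<rho> - dist a z) * Re (h a) \<le> (\<rho> + dist a z) * Re (h z)"
    and "(\<rho> - dist a z) * Re (h z) \<le> (\<rho> + dist a z) * Re (h a)"
    using fin by (auto simp: algebra_simps abs_le_iff)
qed

text \<open>The identity behind all properties of the Blaschke factor
  \<open>(z - a) / (1 - cnj a * z)\<close>.\<close>

lemma blaschke_identity:
  fixes a z :: complex
  shows "(norm (1 - cnj a * z))\<^sup>2 - (norm (z - a))\<^sup>2 = (1 - (norm a)\<^sup>2) * (1 - (norm z)\<^sup>2)"
  unfolding cmod_power2 by (simp add: power2_eq_square algebra_simps)

lemma blaschke_norm_le:
  fixes a z :: complex
  assumes \<eta>: "0 < \<eta>" "\<eta> \<le> 1" and a: "norm a \<le> 1 - \<eta>" and z: "norm z \<le> 1/2"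
  shows "norm (z - a) * (1 + \<eta>/16) \<le> norm (1 - cnj a * z)"
proof (rule power2_le_imp_le)
  note id = blaschke_identity[of a z]
  have a2: "(norm a)\<^sup>2 \<le> 1 - \<eta>"
  proof -
    have "(norm a)\<^sup>2 \<le> norm a" using a \<eta> by (simp add: power2_eq_square mult_left_le)
    thus ?thesis using a by simp
  qed
  have z2: "(norm z)\<^sup>2 \<le> 1/4" using power_mono[OF z, of 2] by (simp add: power2_eq_square)
  have "\<eta> * (3/4) \<le> (1 - (norm a)\<^sup>2) * (1 - (norm z)\<^sup>2)"
    using a2 z2 \<eta> by (intro mult_mono) auto
  moreover have "norm (z - a) \<le> 3/2" using norm_triangle_ineq4[of z a] a z \<eta> by simp
  hence "(norm (z - a))\<^sup>2 \<le> 9/4" using power_mono[of "norm (z-a)" "3/2" 2] by (simp add: power2_eq_square)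
  hence "(norm (z - a))\<^sup>2 * (\<eta>/8 + \<eta>\<^sup>2/256) \<le> 9/4 * (\<eta>/8 + \<eta>/256)"
    using \<eta> by (intro mult_mono) (auto simp: power2_eq_square mult_left_le)
  ultimately show "(norm (z - a) * (1 + \<eta>/16))\<^sup>2 \<le> (norm (1 - cnj a * z))\<^sup>2"
    using id \<eta> by (simp add: power_mult_distrib power2_sum algebra_simps power_divide)
      (simp add: power2_eq_square algebra_simps)
qed auto

lemma blaschke_norm_eq:
  fixes a z :: complex
  assumes "norm z = 1"
  shows "norm (1 - cnj a * z) = norm (z - a)"
  using blaschke_identity[of a z] assms by (simp add: power2_eq_iff_nonneg)

lemma entire_bound_cball:
  assumes "f holomorphic_on UNIV" "\<And>z. norm z = R \<Longrightarrow> norm (f z) \<le> E" "norm z \<le> R"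
  shows "norm (f z :: complex) \<le> E"
proof (rule maximum_modulus_frontier[of f "cball 0 R"])
  show "f holomorphic_on interior (cball 0 R)" using assms(1) holomorphic_on_subset by blast
  show "continuous_on (closure (cball 0 R)) f"
    using assms(1) holomorphic_on_imp_continuous_on continuous_on_subset by blast
  show "\<And>w. w \<in> frontier (cball 0 R) \<Longrightarrow> norm (f w) \<le> E"
    using assms(2) by (auto simp: frontier_cball)
qed (use assms(3) in auto)

lemma entire_factor_zero:
  assumes "f holomorphic_on UNIV" "f a = (0::complex)"
  obtains q where "q holomorphic_on UNIV" "\<And>z. f z = (z - a) * q z"
proof -
  define q where "q = (\<lambda>z. if z = a then deriv f a else f z / (z - a))"
  have "q holomorphic_on UNIV"
    using pole_theorem[OF assms(1), of a] assms(2)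
    by (simp add: q_def cong: if_cong)
  moreover have "f z = (z - a) * q z" for z using assms(2) by (auto simp: q_def)
  ultimately show ?thesis using that by blast
qed

text \<open>Dividing \<open>f\<close> by the Blaschke factor of a zero keeps the bound on the unit circle and
  multiplies \<open>|f b|\<close> by at least \<open>1 + \<eta>/16\<close>. Since \<open>|f b|\<close> cannot exceed \<open>E\<close>, this stops after
  boundedly many steps; the induction variable \<open>m\<close> counts how many are still possible. Each factor
  costs one kernel \<open>1 / |z - a|\<close> in the logarithmic derivative, and \<open>1/\<eta>\<close> from its reflected pole.
  Multiplying by \<open>(1 - cnj a * z) / (z - a)\<close> keeps the function entire.\<close>

lemma remove_zeros:
  fixes f :: "complex \<Rightarrow> complex"
  assumes "0 < \<eta>" "\<eta> \<le> 1" "norm b \<le> 1/2"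
  shows "f holomorphic_on UNIV \<Longrightarrow> (\<And>z. norm z = 1 \<Longrightarrow> norm (f z) \<le> E) \<Longrightarrow> f b \<noteq> 0 \<Longrightarrow>
     E < norm (f b) * (1 + \<eta>/16) ^ m \<Longrightarrow>
    \<exists>as g. g holomorphic_on UNIV \<and> (\<forall>z. norm z \<le> 1 \<longrightarrow> norm (g z) \<le> E) \<and>
       norm (g b) \<ge> norm (f b) * (1 + \<eta>/16) ^ length as \<and>
       (\<forall>z. norm z \<le> 1 - \<eta> \<longrightarrow> g z \<noteq> 0) \<and>
       (\<forall>z. norm z < 1 \<longrightarrow> f z \<noteq> 0 \<longrightarrow>
          norm (deriv f z / f z) \<le> norm (deriv g z / g z) + (\<Sum>a\<leftarrow>as. 1 / norm (z - a) + 1/\<eta>))"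
proof (induction m arbitrary: f)
  case 0
  have "norm (f b) \<le> E" by (rule entire_bound_cball[where R=1]) (use 0 assms in auto)
  thus ?case using 0 by simp
next
  case (Suc m)
  have fE: "norm (f z) \<le> E" if "norm z \<le> 1" for z
    by (rule entire_bound_cball[where R=1]) (use Suc.prems that in auto)
  show ?case
  proof (cases "\<exists>a. norm a \<le> 1 - \<eta> \<and> f a = 0")
    case False
    show ?thesis
      by (rule exI[of _ "[]"], rule exI[of _ f]) (use False Suc.prems fE in auto)
  next
    case True
    then obtain a where a: "norm a \<le> 1 - \<eta>" "f a = 0" by blast
    obtain q where q: "q holomorphic_on UNIV" "\<And>z. f z = (z - a) * q z"
      using entire_factor_zero[OF Suc.prems(1) a(2)] by blast
    \<comment> \<open>The quotient of \<open>f\<close> by its Blaschke factor at \<open>a\<close>, written without a denominator.\<close>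
    define f1 where "f1 = (\<lambda>z. (1 - cnj a * z) * q z)"
    have hol1: "f1 holomorphic_on UNIV" unfolding f1_def by (intro holomorphic_intros q)
    have eq: "(1 - cnj a * z) * f z = (z - a) * f1 z" for z by (simp add: f1_def q(2))
    have bd1: "norm (f1 z) \<le> E" if "norm z = 1" for z
    proof -
      have "norm (f1 z) = norm (f z)"
        by (simp add: f1_def q(2) norm_mult blaschke_norm_eq[OF that])
      thus ?thesis using Suc.prems(2)[OF that] by simp
    qed
    have b1: "norm (f1 b) \<ge> norm (f b) * (1 + \<eta>/16)"
      using mult_right_mono[OF blaschke_norm_le[OF assms(1,2) a(1) assms(3)], of "norm (q b)"]
      unfolding f1_def q(2) norm_mult by (simp add: mult_ac)
    have "norm (f b) * (1 + \<eta>/16) > 0" using Suc.prems(3) assms(1) by (intro mult_pos_pos) auto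
    hence nz1: "f1 b \<noteq> 0" using b1 by auto
    have less1: "E < norm (f1 b) * (1 + \<eta>/16) ^ m"
    proof -
      have "E < norm (f b) * (1 + \<eta>/16) * (1 + \<eta>/16) ^ m" using Suc.prems(4) by simp
      also have "\<dots> \<le> norm (f1 b) * (1 + \<eta>/16) ^ m"
        using b1 assms(1) by (intro mult_right_mono) auto
      finally show ?thesis .
    qed
    obtain as g where g: "g holomorphic_on UNIV" "\<And>z. norm z \<le> 1 \<Longrightarrow> norm (g z) \<le> E"
       "norm (g b) \<ge> norm (f1 b) * (1 + \<eta>/16) ^ length as"
       "\<And>z. norm z \<le> 1 - \<eta> \<Longrightarrow> g z \<noteq> 0"
       "\<And>z. norm z < 1 \<Longrightarrow> f1 z \<noteq> 0 \<Longrightarrow>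
          norm (deriv f1 z / f1 z) \<le> norm (deriv g z / g z) + (\<Sum>a\<leftarrow>as. 1 / norm (z - a) + 1/\<eta>)"
      using Suc.IH[OF hol1 bd1 nz1 less1] by blast
    have ld: "norm (deriv f z / f z) \<le> norm (deriv g z / g z) + (\<Sum>a\<leftarrow>a # as. 1 / norm (z - a) + 1/\<eta>)"
      if z: "norm z < 1" "f z \<noteq> 0" for z
    proof -
      have za: "z \<noteq> a" and qz: "q z \<noteq> 0" using z q(2) by auto
      have small: "norm (cnj a * z) \<le> 1 - \<eta>"
      proof -
        have "norm a * norm z \<le> (1 - \<eta>) * 1" using a z assms(2) by (intro mult_mono) auto
        thus ?thesis by (simp add: norm_mult)
      qed
      have big: "norm (1 - cnj a * z) \<ge> \<eta>"
        using norm_triangle_ineq2[of 1 "cnj a * z"] small by simp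
      have nz: "1 - cnj a * z \<noteq> 0" using big assms(1) by auto
      have dq: "q field_differentiable at z"
        using q(1) holomorphic_on_imp_differentiable_at by blast
      have df: "deriv f z = q z + (z - a) * deriv q z"
      proof -
        have "f = (\<lambda>z. (z - a) * q z)" using q(2) by auto
        hence "(f has_field_derivative (1 * q z + (z - a) * deriv q z)) (at z)"
          using dq by (auto intro!: derivative_eq_intros simp: DERIV_deriv_iff_field_differentiable)
        thus ?thesis using DERIV_imp_deriv by fastforce
      qed
      have df1: "deriv f1 z = - cnj a * q z + (1 - cnj a * z) * deriv q z"
      proof -
        have "(f1 has_field_derivative (- cnj a * q z + (1 - cnj a * z) * deriv q z)) (at z)"
          unfolding f1_def
          using dq by (auto intro!: derivative_eq_intros simp: DERIV_deriv_iff_field_differentiable)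
        thus ?thesis using DERIV_imp_deriv by fastforce
      qed
      have f1z: "f1 z \<noteq> 0" using nz qz by (simp add: f1_def)
      have "deriv f z / f z = deriv f1 z / f1 z + (1 / (z - a) + cnj a / (1 - cnj a * z))"
        unfolding df df1 unfolding f1_def q(2) using za qz nz by (simp add: divide_simps) (simp add: algebra_simps)
      hence "norm (deriv f z / f z) \<le> norm (deriv f1 z / f1 z) + (norm (1 / (z - a)) + norm (cnj a / (1 - cnj a * z)))"
        by (simp only:) (rule order_trans[OF norm_triangle_ineq add_left_mono[OF norm_triangle_ineq]])
      also have "norm (1 / (z - a)) = 1 / norm (z - a)" by (simp add: norm_divide)
      also have "norm (cnj a / (1 - cnj a * z)) \<le> 1 / \<eta>"
      proof -
        have "norm (cnj a) \<le> 1" using a(1) assms(1) by simp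
        thus ?thesis unfolding norm_divide by (rule frac_le[OF zero_le_one _ assms(1) big])
      qed
      finally show ?thesis using g(5)[OF z(1) f1z] by simp
    qed
    have "norm (g b) \<ge> norm (f b) * (1 + \<eta>/16) ^ length (a # as)"
    proof -
      have "norm (f b) * (1 + \<eta>/16) * (1 + \<eta>/16) ^ length as \<le> norm (f1 b) * (1 + \<eta>/16) ^ length as"
        using b1 assms(1) by (intro mult_right_mono) auto
      thus ?thesis using g(3) by simp
    qed
    thus ?thesis using g ld by blast
  qed
qed

text \<open>The function \<open>1 + ln E - log g\<close> has positive real part, so Harnack's inequality
  carries its value at \<open>b\<close> first to the centre and then to \<open>z\<close>, and the oscillation bound on a disc of
  radius \<open>\<eta>/2\<close> about \<open>z\<close> controls the derivative. Each of the last two steps loses a factor \<open>1/\<eta>\<close>.\<close>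

lemma zero_free_log_derivative_bound:
  fixes g :: "complex \<Rightarrow> complex"
  assumes hol: "g holomorphic_on UNIV" and bd: "\<And>z. norm z \<le> 1 \<Longrightarrow> norm (g z) \<le> E"
    and \<eta>: "0 < \<eta>" "\<eta> \<le> 1/4" and b: "norm b \<le> 1/2"
    and nz: "\<And>z. norm z \<le> 1 - \<eta> \<Longrightarrow> g z \<noteq> 0" and z: "norm z \<le> 1 - 2 * \<eta>"
  shows "norm (deriv g z / g z) \<le> 48 * (1 + ln (E / norm (g b))) / \<eta>\<^sup>2"
proof -
  define \<rho> where "\<rho> = 1 - \<eta>"
  have \<rho>: "\<rho> \<ge> 3/4" "\<rho> < 1" using \<eta> by (auto simp: \<rho>_def)
  have "g b \<noteq> 0" by (rule nz) (use b \<eta> in linarith)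
  hence "norm (g b) > 0" by simp
  moreover have "norm (g b) \<le> E" by (rule bd) (use b in linarith)
  ultimately have E: "E > 0" by linarith
  obtain l where l: "l holomorphic_on ball 0 \<rho>" "\<And>w. w \<in> ball 0 \<rho> \<Longrightarrow> g w = exp (l w)"
    using contractible_imp_holomorphic_log[of g "ball 0 \<rho>"] holomorphic_on_subset[OF hol]
      nz convex_imp_contractible[of "ball (0::complex) \<rho>"] by (auto simp: \<rho>_def)
  \<comment> \<open>The summand 1 makes the real part positive also where \<open>|g| = E\<close>.\<close>
  define k where "k = (\<lambda>w. of_real (1 + ln E) - l w)"
  have holk: "k holomorphic_on ball 0 \<rho>" unfolding k_def by (intro holomorphic_intros l)
  have Rek: "Re (k w) = 1 + ln (E / norm (g w))" if "w \<in> ball 0 \<rho>" for w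
  proof -
    have "Re (l w) = ln (norm (g w))" using l(2)[OF that] by simp
    moreover have "norm (g w) > 0" using l(2)[OF that] by simp
    ultimately show ?thesis using E by (simp add: k_def ln_div)
  qed
  have pos: "Re (k w) \<ge> 1" if "w \<in> ball 0 \<rho>" for w
  proof -
    have "norm (g w) > 0" "norm (g w) \<le> E" using nz that bd \<rho> by (auto simp: \<rho>_def)
    hence "E / norm (g w) \<ge> 1" by simp
    thus ?thesis unfolding Rek[OF that] using ln_ge_zero by force
  qed
  have bin: "b \<in> ball 0 \<rho>" using b \<rho> by simp
  have zin: "z \<in> ball 0 \<rho>" using z \<rho> \<eta> by (simp add: \<rho>_def)
  have kb: "Re (k b) = 1 + ln (E / norm (g b))" by (rule Rek[OF bin])
  have Rek_pos: "Re (k w) > 0" if "w \<in> ball 0 \<rho>" for w using pos[OF that] by simp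
  have k0: "Re (k 0) \<le> 6 * Re (k b)"
  proof -
    have "(\<rho> - norm b) * Re (k 0) \<le> (\<rho> + norm b) * Re (k b)"
      using positive_real_part_oscillation(2)[OF holk Rek_pos bin] by simp
    moreover have "(1/4) * Re (k 0) \<le> (\<rho> - norm b) * Re (k 0)"
      using \<rho> b pos[of 0] by (intro mult_right_mono) auto
    moreover have "(\<rho> + norm b) * Re (k b) \<le> (3/2) * Re (k b)"
      using pos[OF bin] \<rho> b by (intro mult_right_mono) auto
    ultimately show ?thesis by simp
  qed
  have kz: "Re (k z) \<le> 12 * Re (k b) / \<eta>"
  proof -
    have "\<eta> * Re (k z) \<le> (\<rho> - norm z) * Re (k z)"
      using z pos[OF zin] by (intro mult_right_mono) (auto simp: \<rho>_def)
    also have "\<dots> \<le> (\<rho> + norm z) * Re (k 0)"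
      using positive_real_part_oscillation(3)[OF holk Rek_pos zin] by simp
    also have "\<dots> \<le> 2 * (6 * Re (k b))"
      using k0 z \<rho> \<eta> pos[of 0] by (intro mult_mono) auto
    finally show ?thesis using \<eta> by (simp add: field_simps)
  qed
  have sub: "ball z \<eta> \<subseteq> ball 0 \<rho>"
  proof
    fix w assume "w \<in> ball z \<eta>"
    thus "w \<in> ball 0 \<rho>" using norm_triangle_sub[of w z] z by (simp add: \<rho>_def dist_norm norm_minus_commute)
  qed
  have cb: "cball z (\<eta>/2) \<subseteq> ball 0 \<rho>" using sub \<eta> by (auto simp: subset_iff)
  have holk': "k holomorphic_on ball z \<eta>" by (rule holomorphic_on_subset[OF holk sub])
  have "norm ((deriv ^^ 1) (\<lambda>w. k w - k z) z) \<le> fact 1 * (2 * Re (k z)) / (\<eta>/2) ^ 1"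
  proof (rule Cauchy_inequality)
    show "continuous_on (cball z (\<eta>/2)) (\<lambda>w. k w - k z)"
      by (intro continuous_intros continuous_on_subset[OF holomorphic_on_imp_continuous_on[OF holk] cb])
    have "ball z (\<eta>/2) \<subseteq> ball 0 \<rho>" using cb ball_subset_cball by blast
    thus "(\<lambda>w. k w - k z) holomorphic_on ball z (\<eta>/2)"
      by (intro holomorphic_intros holomorphic_on_subset[OF holk])
    show "0 < \<eta>/2" using \<eta> by simp
    fix w assume w: "cmod (z - w) = \<eta>/2"
    have wi: "w \<in> ball z \<eta>" using w \<eta> by (simp add: dist_norm)
    have "(\<eta> - dist z w) * norm (k w - k z) \<le> 2 * dist z w * Re (k z)"
      by (rule positive_real_part_oscillation(1)[OF holk' _ wi]) (use sub Rek_pos in blast)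
    hence "(\<eta>/2) * norm (k w - k z) \<le> (\<eta>/2) * (2 * Re (k z))" using w by (simp add: dist_norm)
    thus "norm (k w - k z) \<le> 2 * Re (k z)" using \<eta> by (simp only: mult_le_cancel_left_pos half_gt_zero)
  qed
  moreover have "deriv (\<lambda>w. k w - k z) z = - (deriv g z / g z)"
  proof -
    have dg: "(g has_field_derivative deriv g z) (at z)"
      by (rule holomorphic_derivI[OF hol]) auto
    have dl: "(l has_field_derivative deriv l z) (at z)"
      by (rule holomorphic_derivI[OF l(1) _ zin]) auto
    hence "((\<lambda>w. exp (l w)) has_field_derivative (exp (l z) * deriv l z)) (at z)"
      by (rule DERIV_chain2[OF DERIV_exp])
    hence "(g has_field_derivative (exp (l z) * deriv l z)) (at z)"
      by (rule has_field_derivative_transform_within_open[OF _ open_ball zin]) (simp add: l(2))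
    hence eq: "deriv g z = g z * deriv l z" using l(2)[OF zin] DERIV_unique[OF dg] by simp
    have "((\<lambda>w. k w - k z) has_field_derivative (0 - deriv l z - 0)) (at z)"
      unfolding k_def by (intro DERIV_diff DERIV_const dl)
    hence "deriv (\<lambda>w. k w - k z) z = 0 - deriv l z - 0" by (rule DERIV_imp_deriv)
    moreover have "g z \<noteq> 0" using l(2)[OF zin] by simp
    ultimately show ?thesis using eq by simp
  qed
  moreover have "fact 1 * (2 * Re (k z)) / (\<eta>/2) ^ 1 = 4 * Re (k z) / \<eta>" by simp
  moreover have "(deriv ^^ 1) (\<lambda>w. k w - k z) z = deriv (\<lambda>w. k w - k z) z" by simp
  ultimately have "norm (deriv g z / g z) \<le> 4 * Re (k z) / \<eta>" by (simp only: norm_minus_cancel)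
  also have "\<dots> \<le> 4 * (12 * Re (k b) / \<eta>) / \<eta>" using kz \<eta>(1) by (intro divide_right_mono mult_left_mono) linarith+
  also have "\<dots> = 48 * (1 + ln (E / norm (g b))) / \<eta>\<^sup>2"
    unfolding kb power2_eq_square by simp
  finally show ?thesis .
qed

text \<open>A standard consequence of the Poisson--Jensen formula, obtained here by removing
  zeros one at a time. The quantity \<open>ln (E / |f b|)\<close> measures how far \<open>|f b|\<close> stays below the maximum.\<close>

lemma log_derivative_bound:
  fixes f :: "complex \<Rightarrow> complex"
  assumes hol: "f holomorphic_on UNIV" and bd: "\<And>z. norm z = 1 \<Longrightarrow> norm (f z) \<le> E"
    and \<eta>: "0 < \<eta>" "\<eta> \<le> 1/4" and b: "norm b \<le> 1/2" "f b \<noteq> 0"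
  obtains as :: "complex list"
  where "real (length as) \<le> 32 * ln (E / norm (f b)) / \<eta>"
    and "\<And>z. norm z \<le> 1 - 2 * \<eta> \<Longrightarrow> f z \<noteq> 0 \<Longrightarrow>
      norm (deriv f z / f z) \<le> 80 * (1 + ln (E / norm (f b))) / \<eta>\<^sup>2 + (\<Sum>a\<leftarrow>as. 1 / norm (z - a))"
proof -
  define D where "D = ln (E / norm (f b))"
  have fb: "norm (f b) \<le> E" by (rule entire_bound_cball[where R=1, OF hol]) (use bd b in auto)
  have "norm (f b) > 0" using b by simp
  with fb have E: "E > 0" by linarith
  have "\<exists>m. E / norm (f b) < (1 + \<eta>/16) ^ m"
    using \<eta> by (intro real_arch_pow) auto
  then obtain m where m: "E / norm (f b) < (1 + \<eta>/16) ^ m" by blast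
  hence m': "E < norm (f b) * (1 + \<eta>/16) ^ m" using b by (simp add: field_simps)
  have \<eta>1: "\<eta> \<le> 1" using \<eta> by simp
  obtain as g where g: "g holomorphic_on UNIV" "\<And>z. norm z \<le> 1 \<Longrightarrow> norm (g z) \<le> E"
     "norm (g b) \<ge> norm (f b) * (1 + \<eta>/16) ^ length as"
     "\<And>z. norm z \<le> 1 - \<eta> \<Longrightarrow> g z \<noteq> 0"
     "\<And>z. norm z < 1 \<Longrightarrow> f z \<noteq> 0 \<Longrightarrow>
        norm (deriv f z / f z) \<le> norm (deriv g z / g z) + (\<Sum>a\<leftarrow>as. 1 / norm (z - a) + 1/\<eta>)"
    using remove_zeros[OF \<eta>(1) \<eta>1 b(1) hol bd b(2) m'] by blast
  have gb: "norm (g b) \<le> E" using g(2) b by simp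
  have len: "real (length as) \<le> 32 * D / \<eta>"
  proof -
    have "(1 + \<eta>/16) ^ length as \<le> E / norm (f b)"
      using order_trans[OF g(3) gb] b by (simp add: field_simps)
    hence "ln ((1 + \<eta>/16) ^ length as) \<le> D"
      unfolding D_def using \<eta> by (intro ln_mono) auto
    hence "real (length as) * ln (1 + \<eta>/16) \<le> D"
      using ln_realpow[of "1 + \<eta>/16" "length as"] \<eta> by linarith
    moreover have "\<eta>/32 \<le> ln (1 + \<eta>/16)"
    proof -
      have "(\<eta>/16)\<^sup>2 \<le> (\<eta>/16) * (1/2)" unfolding power2_eq_square using \<eta> by (intro mult_left_mono) auto
      thus ?thesis using ln_one_plus_pos_lower_bound[of "\<eta>/16"] \<eta> by linarith
    qed
    hence "real (length as) * (\<eta>/32) \<le> real (length as) * ln (1 + \<eta>/16)" by (intro mult_left_mono) auto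
    ultimately show ?thesis using \<eta> by (simp add: field_simps)
  qed
  have D0: "D \<ge> 0" unfolding D_def using fb b by simp
  have gf: "ln (E / norm (g b)) \<le> D"
  proof -
    have "norm (f b) * 1 \<le> norm (f b) * (1 + \<eta>/16) ^ length as"
      using \<eta> by (intro mult_left_mono one_le_power) auto
    hence "norm (f b) \<le> norm (g b)" using g(3) by simp
    hence "E / norm (g b) \<le> E / norm (f b)" using \<open>norm (f b) > 0\<close> E by (intro frac_le) auto
    moreover have "norm (g b) > 0" using \<open>norm (f b) \<le> norm (g b)\<close> \<open>norm (f b) > 0\<close> by linarith
    ultimately show ?thesis unfolding D_def using E by (intro ln_mono) auto
  qed
  show ?thesis
  proof (rule that[of as])
    show "real (length as) \<le> 32 * ln (E / norm (f b)) / \<eta>" using len by (simp add: D_def)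
    fix z assume z: "norm z \<le> 1 - 2 * \<eta>" "f z \<noteq> 0"
    have "norm (deriv f z / f z) \<le> norm (deriv g z / g z) + (\<Sum>a\<leftarrow>as. 1 / norm (z - a) + 1/\<eta>)"
      using g(5) z \<eta> by simp
    also have "(\<Sum>a\<leftarrow>as. 1 / norm (z - a) + 1/\<eta>) = (\<Sum>a\<leftarrow>as. 1 / norm (z - a)) + real (length as) * (1/\<eta>)"
      by (simp add: sum_list_addf sum_list_triv)
    also have "real (length as) * (1/\<eta>) \<le> (32 * D / \<eta>) * (1/\<eta>)"
      using len \<eta> by (intro mult_right_mono) auto
    also have "norm (deriv g z / g z) \<le> 48 * (1 + ln (E / norm (g b))) / \<eta>\<^sup>2"
      by (rule zero_free_log_derivative_bound[OF g(1,2) \<eta> b(1) g(4) z(1)])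
    also have "\<dots> \<le> 48 * (1 + D) / \<eta>\<^sup>2" using gf \<eta> by (intro divide_right_mono) auto
    finally have "norm (deriv f z / f z) \<le> 48 * (1 + D) / \<eta>\<^sup>2 + ((\<Sum>a\<leftarrow>as. 1 / norm (z - a)) + 32 * D / \<eta>\<^sup>2)"
      by (simp add: power2_eq_square)
    moreover have "48 * (1 + D) / \<eta>\<^sup>2 + 32 * D / \<eta>\<^sup>2 \<le> 80 * (1 + D) / \<eta>\<^sup>2"
      using \<eta> by (simp add: field_simps)
    ultimately show "norm (deriv f z / f z) \<le> 80 * (1 + ln (E / norm (f b))) / \<eta>\<^sup>2 + (\<Sum>a\<leftarrow>as. 1 / norm (z - a))"
      by (simp add: D_def)
  qed
qed

section \<open>The kernels |z| / |z - a| in logarithmic polar coordinates\<close>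

text \<open>Points of the plane are parametrised by \<open>(log |z|, arg z)\<close>, where areas are
  measured by Lebesgue measure; this makes all estimates invariant under scaling.\<close>

definition polar :: "real \<times> real \<Rightarrow> complex" where
  "polar p = exp (Complex (fst p) (snd p))"

definition proximity :: "complex \<Rightarrow> real \<times> real \<Rightarrow> real" where
  "proximity a p = norm (polar p) / norm (polar p - a)"

lemma norm_polar [simp]: "norm (polar (x, \<theta>)) = exp x"
  by (simp add: polar_def)

lemma polar_nonzero [simp]: "polar p \<noteq> 0"
  by (simp add: polar_def)

lemma polar_measurable [measurable]: "polar \<in> borel_measurable (lborel \<Otimes>\<^sub>M lborel)"
proof -
  have "continuous_on UNIV polar" unfolding polar_def Complex_eq by (intro continuous_intros)
  hence "polar \<in> borel_measurable borel" by (rule borel_measurable_continuous_onI)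
  thus ?thesis by (simp add: lborel_prod)
qed

lemma proximity_measurable [measurable]: "proximity a \<in> borel_measurable (lborel \<Otimes>\<^sub>M lborel)"
  unfolding proximity_def by measurable

lemma proximity_nonneg [simp]: "proximity a p \<ge> 0" by (simp add: proximity_def)

lemma pi_less: "pi < 16/5"
  using pi_approx by simp

lemma abs_sin_ge: "\<bar>t\<bar> \<le> pi / 2 \<Longrightarrow> \<bar>t\<bar> / 2 \<le> \<bar>sin t\<bar>"
proof -
  assume t: "\<bar>t\<bar> \<le> pi / 2"
  have "\<bar>sin t - (\<Sum>m<3. sin_coeff m * t ^ m)\<bar> \<le> inverse (fact 3) * \<bar>t\<bar> ^ 3" by (rule Maclaurin_sin_bound)
  hence "\<bar>sin t - t\<bar> \<le> \<bar>t\<bar> ^ 3 / 6" by (simp add: numeral_3_eq_3 sin_coeff_def fact_numeral)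
  moreover have "\<bar>t\<bar> ^ 3 / 6 \<le> \<bar>t\<bar> / 2"
  proof -
    have "\<bar>t\<bar> \<le> 8/5" using t pi_less by linarith
    hence "\<bar>t\<bar>\<^sup>2 \<le> (8/5)\<^sup>2" by (intro power_mono) auto
    hence "\<bar>t\<bar>\<^sup>2 \<le> 3" by (simp add: power2_eq_square)
    hence "\<bar>t\<bar> * \<bar>t\<bar>\<^sup>2 \<le> \<bar>t\<bar> * 3" by (intro mult_left_mono) auto
    thus ?thesis by (simp add: power3_eq_cube power2_eq_square)
  qed
  ultimately show ?thesis by linarith
qed

text \<open>Near each zero \<open>k * pi\<close> the sine is comparable to the distance from it; the sum over
  \<open>k\<close> replaces the choice of the nearest zero.\<close>

lemma abs_sin_powr_le:
  assumes q: "0 < q" "q < (1::real)" and u: "- pi \<le> u" "u \<le> 3 * pi" and ne: "\<And>k. k \<in> {-1..3::int} \<Longrightarrow> u \<noteq> k * pi"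
  shows "sin u \<noteq> 0" "\<bar>sin u\<bar> powr - q \<le> 2 * (\<Sum>k\<in>{-1..3::int}. \<bar>u - k * pi\<bar> powr - q)"
proof -
  define k where "k = round (u / pi)"
  have "\<bar>u / pi - k\<bar> \<le> 1/2" unfolding k_def using of_int_round_abs_le[of "u/pi"] by (simp add: abs_minus_commute)
  hence kd: "\<bar>u - k * pi\<bar> \<le> pi / 2"
  proof -
    have "u - k * pi = (u / pi - k) * pi" by (simp add: field_simps)
    hence "\<bar>u - k * pi\<bar> = \<bar>u / pi - k\<bar> * pi" by (simp add: abs_mult)
    also have "\<dots> \<le> 1/2 * pi" using \<open>\<bar>u / pi - k\<bar> \<le> 1/2\<close> by (intro mult_right_mono) auto
    finally show ?thesis by simp
  qed
  have "k \<in> {-1..3}"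
  proof -
    have "real_of_int k * pi > (-2) * pi" "real_of_int k * pi < 4 * pi"
      using kd u pi_gt_zero unfolding abs_le_iff by linarith+
    hence "real_of_int k > - 2" "real_of_int k < 4"
      by (auto simp only: mult_less_cancel_right_pos[OF pi_gt_zero])
    thus ?thesis by simp
  qed
  have "\<bar>sin (u - k * pi)\<bar> = \<bar>sin u\<bar>"
    using sin_npi_int[of k] cos_npi_int[of k] by (simp add: sin_diff abs_mult mult.commute)
  hence s: "\<bar>u - k * pi\<bar> / 2 \<le> \<bar>sin u\<bar>" using abs_sin_ge[OF kd] by simp
  have pos: "\<bar>u - k * pi\<bar> > 0" using ne[OF \<open>k \<in> _\<close>] by simp
  show "sin u \<noteq> 0" using s pos by auto
  have "\<bar>sin u\<bar> powr - q \<le> (\<bar>u - k * pi\<bar> / 2) powr - q"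
    using s pos q by (intro powr_mono2') auto
  also have "\<dots> = 2 powr q * \<bar>u - k * pi\<bar> powr - q"
    using pos by (simp add: powr_divide powr_minus field_simps)
  also have "\<dots> \<le> 2 powr 1 * \<bar>u - k * pi\<bar> powr - q"
    using q by (intro mult_right_mono powr_mono) auto
  also have "\<dots> \<le> 2 * (\<Sum>k\<in>{-1..3::int}. \<bar>u - k * pi\<bar> powr - q)"
    using member_le_sum[OF \<open>k \<in> _\<close>, of "\<lambda>k. \<bar>u - k * pi\<bar> powr - q"] by simp
  finally show "\<bar>sin u\<bar> powr - q \<le> 2 * (\<Sum>k\<in>{-1..3::int}. \<bar>u - k * pi\<bar> powr - q)" .
qed

lemma abs_one_minus_exp_powr_le:
  assumes q: "0 < q" "q < (1::real)" and t: "t \<noteq> 0"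
  shows "\<bar>1 - exp t\<bar> powr - q \<le> 2 * (1 + \<bar>t\<bar> powr - q)"
proof -
  have low: "min \<bar>t\<bar> 1 / 2 \<le> \<bar>1 - exp t\<bar>"
  proof (cases "t > 0")
    case True
    hence "min \<bar>t\<bar> 1 / 2 \<le> t" by (simp add: min_def)
    thus ?thesis using exp_ge_add_one_self[of t] True by linarith
  next
    case False
    hence t0: "t < 0" using t by simp
    have e: "exp (- t) * exp t = 1" by (simp add: exp_minus)
    have "(1 + (- t)) * exp t \<le> exp (- t) * exp t"
      using exp_ge_add_one_self[of "- t"] by (intro mult_right_mono) auto
    hence "exp t \<le> 1 / (1 - t)" using t0 e by (simp add: field_simps)
    hence "1 - exp t \<ge> - t / (1 - t)" using t0 by (simp add: field_simps)
    moreover have "- t / (1 - t) \<ge> min \<bar>t\<bar> 1 / 2"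
    proof (cases "- t \<le> 1")
      case True
      hence "- t / (1 - t) \<ge> - t / 2" using t0 by (intro divide_left_mono) auto
      thus ?thesis using True t0 by simp
    next
      case False
      thus ?thesis using t0 by (simp add: field_simps)
    qed
    ultimately show ?thesis by linarith
  qed
  have "\<bar>1 - exp t\<bar> powr - q \<le> (min \<bar>t\<bar> 1 / 2) powr - q"
    using low t q by (intro powr_mono2') (auto simp: min_def)
  also have "\<dots> = 2 powr q * (min \<bar>t\<bar> 1) powr - q"
    using t by (simp add: powr_divide powr_minus field_simps min_def)
  also have "\<dots> \<le> 2 powr 1 * (1 + \<bar>t\<bar> powr - q)"
    using q by (intro mult_mono powr_mono) (auto simp: min_def)
  finally show ?thesis by simp
qed

text \<open>The distance \<open>|z - a|\<close> dominates both its radial part \<open>||z| - |a||\<close> and its angular part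
  \<open>|z| |sin (arg z - arg a)|\<close>. Using each bound for one half of the exponent \<open>2 * q\<close> separates the
  variables.\<close>

lemma proximity_powr_le:
  assumes q: "0 < q" "q < (1::real)" and a: "a \<noteq> 0" and x: "x \<noteq> ln (norm a)"
    and \<theta>: "0 \<le> \<theta>" "\<theta> \<le> 2 * pi" "\<And>k. k \<in> {-1..3::int} \<Longrightarrow> \<theta> \<noteq> Arg a + k * pi"
  shows "proximity a (x, \<theta>) powr (2 * q) \<le>
    (2 * (1 + \<bar>x - ln (norm a)\<bar> powr - q)) * (2 * (\<Sum>k\<in>{-1..3::int}. \<bar>\<theta> - (Arg a + k * pi)\<bar> powr - q))"
proof -
  let ?z = "polar (x, \<theta>)"
  define b where "b = ln (norm a)"
  have na: "norm a = exp b" using a by (simp add: b_def)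
  define u where "u = \<theta> - Arg a"
  have u: "- pi \<le> u" "u \<le> 3 * pi" using \<theta>(1,2) Arg_bounded[of a] by (simp_all add: u_def)
  have u': "u \<noteq> k * pi" if "k \<in> {-1..3::int}" for k using \<theta>(3)[OF that] by (simp add: u_def)
  note u = u u'
  have z: "?z = exp x * cis \<theta>" by (simp add: polar_def exp_eq_polar)
  have aa: "a = exp b * cis (Arg a)"
    using na by (metis Arg_eq a cis_conv_exp mult.commute)
  have d1: "norm (?z - a) \<ge> exp x * \<bar>1 - exp (b - x)\<bar>"
  proof -
    have "norm (?z - a) \<ge> \<bar>norm ?z - norm a\<bar>" by (rule norm_triangle_ineq3)
    also have "norm ?z - norm a = exp x * (1 - exp (b - x))" by (simp add: na exp_diff algebra_simps)
    finally show ?thesis by (simp add: abs_mult)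
  qed
  have d2: "norm (?z - a) \<ge> exp x * \<bar>sin u\<bar>"
  proof -
    have "norm (?z - a) = norm ((?z - a) * cis (- Arg a))" by (simp add: norm_mult)
    also have "(?z - a) * cis (- Arg a) = exp x * cis u - exp b"
    proof -
      have "?z * cis (- Arg a) = exp x * cis u" by (simp add: z u_def cis_mult mult.assoc)
      moreover have "a * cis (- Arg a) = exp b" by (subst aa) (simp add: cis_mult mult.assoc)
      ultimately show ?thesis by (simp add: algebra_simps)
    qed
    also have "norm \<dots> \<ge> \<bar>Im (exp x * cis u - exp b)\<bar>" by (rule abs_Im_le_cmod)
    finally show ?thesis by (simp add: abs_mult Re_exp Im_exp)
  qed
  have p1: "\<bar>1 - exp (b - x)\<bar> > 0" using x by (simp add: b_def)
  have p2: "\<bar>sin u\<bar> > 0" using abs_sin_powr_le(1)[OF q u] by simp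
  have zp: "norm (?z - a) > 0" using d1 p1 by (meson exp_gt_zero less_le_trans mult_pos_pos)
  have r1: "proximity a (x, \<theta>) \<le> 1 / \<bar>1 - exp (b - x)\<bar>"
    using d1 p1 zp by (simp add: proximity_def field_simps)
  have r2: "proximity a (x, \<theta>) \<le> 1 / \<bar>sin u\<bar>"
    using d2 p2 zp by (simp add: proximity_def field_simps)
  have "proximity a (x, \<theta>) powr (2 * q) = proximity a (x, \<theta>) powr q * proximity a (x, \<theta>) powr q"
    by (simp flip: powr_add)
  also have "\<dots> \<le> (1 / \<bar>1 - exp (b - x)\<bar>) powr q * (1 / \<bar>sin u\<bar>) powr q"
    using r1 r2 q by (intro mult_mono powr_mono2) auto
  also have "\<dots> = \<bar>1 - exp (b - x)\<bar> powr - q * \<bar>sin u\<bar> powr - q"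
    using p1 p2 by (simp add: powr_divide powr_minus field_simps)
  also have "\<dots> \<le> (2 * (1 + \<bar>b - x\<bar> powr - q)) * (2 * (\<Sum>k\<in>{-1..3::int}. \<bar>u - k * pi\<bar> powr - q))"
    using abs_one_minus_exp_powr_le[OF q, of "b - x"] abs_sin_powr_le(2)[OF q u] x
    by (intro mult_mono) (auto simp: b_def)
  also have "\<bar>b - x\<bar> = \<bar>x - b\<bar>" by simp
  finally show ?thesis by (simp add: u_def b_def algebra_simps)
qed

lemma nn_integral_abs_powr_le:
  assumes q: "0 < q" "q < (1::real)"
  shows "(\<integral>\<^sup>+x\<in>{x0..x0 + 7}. ennreal (\<bar>x - b\<bar> powr - q) \<partial>lborel) \<le> ennreal (7 + 2 / (1 - q))"
proof -
  define u where "u = 1 / (1 - q)"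
  have u: "u \<ge> 0" using q by (simp add: u_def)
  define g where "g = (\<lambda>x::real. indicator {0..1} x * x powr - q)"
  have g0: "g x \<ge> 0" for x by (simp add: g_def)
  have [measurable]: "g \<in> borel_measurable borel" unfolding g_def by measurable
  have "((\<lambda>x. x powr - q) has_integral (1 / (1 - q))) {0..1}"
    using has_integral_powr_from_0[of "- q" 1] q by simp
  hence "(g has_integral (1 / (1 - q))) UNIV"
    unfolding g_def by (subst (asm) has_integral_restrict_UNIV[symmetric])
      (auto simp: indicator_def elim!: has_integral_eq[rotated])
  hence I: "(\<integral>\<^sup>+x. ennreal (g x) \<partial>lborel) = ennreal (1 / (1 - q))"
    by (intro nn_integral_has_integral_lborel) (auto simp: g0)
  have I1: "(\<integral>\<^sup>+x. ennreal (g (x - b)) \<partial>lborel) = ennreal (1 / (1 - q))"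
    using nn_integral_real_affine[of "\<lambda>x. ennreal (g x)" 1 "- b"] I by simp
  have I2: "(\<integral>\<^sup>+x. ennreal (g (b - x)) \<partial>lborel) = ennreal (1 / (1 - q))"
    using nn_integral_real_affine[of "\<lambda>x. ennreal (g x)" "-1" b] I by simp
  have "(\<integral>\<^sup>+x\<in>{x0..x0 + 7}. ennreal (\<bar>x - b\<bar> powr - q) \<partial>lborel)
     \<le> (\<integral>\<^sup>+x. (indicator {x0..x0+7} x + ennreal (g (x - b)) + ennreal (g (b - x))) \<partial>lborel)"
  proof (rule nn_integral_mono)
    fix x
    have "\<bar>x - b\<bar> powr - q * indicator {x0..x0+7} x \<le> indicator {x0..x0+7} x + g (x - b) + g (b - x)"
    proof (cases "\<bar>x - b\<bar> \<le> 1")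
      case True
      thus ?thesis by (cases "x \<ge> b") (auto simp: g_def indicator_def)
    next
      case False
      hence "\<bar>x - b\<bar> powr - q \<le> 1 powr - q" using q by (intro powr_mono2') auto
      thus ?thesis using g0[of "x - b"] g0[of "b - x"] by (auto simp: indicator_def)
    qed
    hence "ennreal (\<bar>x - b\<bar> powr - q * indicator {x0..x0+7} x) \<le> ennreal (indicator {x0..x0+7} x + g (x - b) + g (b - x))"
      by (rule ennreal_leI)
    thus "ennreal (\<bar>x - b\<bar> powr - q) * indicator {x0..x0+7} x \<le> indicator {x0..x0+7} x + ennreal (g (x - b)) + ennreal (g (b - x))"
      using g0 by (simp add: ennreal_mult ennreal_indicator ennreal_plus)
  qed
  also have "\<dots> = ennreal 7 + ennreal u + ennreal u"
    by (simp add: nn_integral_add I1 I2 u_def)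
  also have "\<dots> = ennreal (7 + u) + ennreal u" using u by (simp only: ennreal_plus zero_le_numeral)
  also have "\<dots> = ennreal (7 + u + u)" using u by (intro ennreal_plus[symmetric]) auto
  also have "7 + u + u = 7 + 2 / (1 - q)" by (simp add: u_def)
  finally show ?thesis .
qed

definition proximity_bounded :: "real \<Rightarrow> real \<Rightarrow> bool" where
  "proximity_bounded q C \<longleftrightarrow> (\<forall>a x.
     (\<integral>\<^sup>+p\<in>{x..x + 1} \<times> {0..2 * pi}. ennreal (proximity a p powr (2 * q)) \<partial>(lborel \<Otimes>\<^sub>M lborel)) \<le> ennreal C)"

text \<open>A bound independent of \<open>a\<close>, by Fubini's theorem from \<open>proximity_powr_le\<close>. The exponent \<open>2 * q\<close> may be any number below 2, which
  is the critical exponent for the singularity \<open>1 / |z - a|\<close> in the plane; its closeness to 2 decides how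
  close the final dimension is to 2.\<close>

lemma proximity_integral_bound:
  assumes q: "0 < q" "q < (1::real)"
  obtains C where "C > 0" "proximity_bounded q C"
proof -
  define C1 where "C1 = 7 + 2 / (1 - q)"
  have C1: "C1 > 0" using q by (simp add: C1_def add_pos_pos)
  have pi7: "2 * pi \<le> 7" using pi_approx by simp
  have "(\<integral>\<^sup>+p\<in>{x0..x0 + 1} \<times> {0..2 * pi}. ennreal (proximity a p powr (2 * q)) \<partial>(lborel \<Otimes>\<^sub>M lborel)) \<le> ennreal (7 + 2 * (1 + C1) * (10 * C1))" for a x0
  proof (cases "a = 0")
    case True
    have "proximity a p = 1" for p by (simp add: True proximity_def)
    hence "(\<integral>\<^sup>+p\<in>{x0..x0 + 1} \<times> {0..2 * pi}. ennreal (proximity a p powr (2 * q)) \<partial>(lborel \<Otimes>\<^sub>M lborel))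
       = emeasure (lborel \<Otimes>\<^sub>M lborel) ({x0..x0 + 1} \<times> {0..2 * pi})" by simp
    also have "\<dots> = ennreal (2 * pi)"
      by (subst lborel.emeasure_pair_measure_Times) auto
    also have "\<dots> \<le> ennreal (7 + 2 * (1 + C1) * (10 * C1))"
      using pi7 C1 by (intro ennreal_leI order_trans[OF pi7]) simp
    finally show ?thesis .
  next
    case False
    define b where "b = ln (norm a)"
    define S where "S = (\<lambda>\<theta>. 2 * (\<Sum>k\<in>{-1..3::int}. \<bar>\<theta> - (Arg a + k * pi)\<bar> powr - q))"
    define X where "X = (\<lambda>x. 2 * (1 + \<bar>x - b\<bar> powr - q))"
    have [measurable]: "S \<in> borel_measurable borel" "X \<in> borel_measurable borel"
      unfolding S_def X_def by measurable
    have S0: "S \<theta> \<ge> 0" and X0: "X x \<ge> 0" for \<theta> x by (auto simp: S_def X_def sum_nonneg)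
    have IS: "(\<integral>\<^sup>+\<theta>\<in>{0..2*pi}. ennreal (S \<theta>) \<partial>lborel) \<le> ennreal (10 * C1)"
    proof -
      have "(\<integral>\<^sup>+\<theta>\<in>{0..2*pi}. ennreal (S \<theta>) \<partial>lborel) \<le> (\<integral>\<^sup>+\<theta>\<in>{0..0+7}. ennreal (S \<theta>) \<partial>lborel)"
        using pi7 by (intro nn_integral_mono) (auto simp: indicator_def)
      also have "\<dots> = (\<integral>\<^sup>+\<theta>. (\<Sum>k\<in>{-1..3::int}. 2 * (ennreal (\<bar>\<theta> - (Arg a + k * pi)\<bar> powr - q) * indicator {0..0+7} \<theta>)) \<partial>lborel)"
        by (intro nn_integral_cong) (simp add: S_def ennreal_mult sum_nonneg flip: sum_distrib_left sum_distrib_right sum_ennreal, simp add: mult.assoc)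
      also have "\<dots> = (\<Sum>k\<in>{-1..3::int}. 2 * (\<integral>\<^sup>+\<theta>. ennreal (\<bar>\<theta> - (Arg a + k * pi)\<bar> powr - q) * indicator {0..0+7} \<theta> \<partial>lborel))"
        by (simp add: nn_integral_sum nn_integral_cmult)
      also have "\<dots> \<le> (\<Sum>k\<in>{-1..3::int}. 2 * ennreal C1)"
        unfolding C1_def by (intro sum_mono mult_left_mono nn_integral_abs_powr_le[OF q]) auto
      also have "\<dots> = ennreal (10 * C1)" using C1 by (simp add: ennreal_mult flip: mult.assoc)
      finally show ?thesis .
    qed
    have IX: "(\<integral>\<^sup>+x\<in>{x0..x0+1}. ennreal (X x) \<partial>lborel) \<le> ennreal (2 * (1 + C1))"
    proof -
      have "(\<integral>\<^sup>+x\<in>{x0..x0+1}. ennreal (X x) \<partial>lborel) \<le>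
          (\<integral>\<^sup>+x. 2 * indicator {x0..x0+1} x + 2 * (ennreal (\<bar>x - b\<bar> powr - q) * indicator {x0..x0+7} x) \<partial>lborel)"
        by (intro nn_integral_mono) (auto simp: X_def indicator_def ennreal_mult ennreal_plus algebra_simps)
      also have "\<dots> = 2 * 1 + 2 * (\<integral>\<^sup>+x. ennreal (\<bar>x - b\<bar> powr - q) * indicator {x0..x0+7} x \<partial>lborel)"
        by (simp add: nn_integral_add nn_integral_cmult)
      also have "\<dots> \<le> 2 * 1 + 2 * ennreal C1"
        unfolding C1_def by (intro add_left_mono mult_left_mono nn_integral_abs_powr_le[OF q]) auto
      also have "\<dots> = ennreal (2 * (1 + C1))" using C1 by (simp add: ennreal_mult ennreal_plus algebra_simps)
      finally show ?thesis .
    qed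
    have "(\<integral>\<^sup>+p\<in>{x0..x0 + 1} \<times> {0..2 * pi}. ennreal (proximity a p powr (2 * q)) \<partial>(lborel \<Otimes>\<^sub>M lborel))
      = (\<integral>\<^sup>+x. \<integral>\<^sup>+\<theta>. ennreal (proximity a (x, \<theta>) powr (2 * q)) * indicator ({x0..x0 + 1} \<times> {0..2 * pi}) (x, \<theta>) \<partial>lborel \<partial>lborel)"
      by (subst lborel.nn_integral_fst[symmetric]) auto
    also have "\<dots> \<le> (\<integral>\<^sup>+x. (ennreal (X x) * indicator {x0..x0+1} x) * (\<integral>\<^sup>+\<theta>\<in>{0..2*pi}. ennreal (S \<theta>) \<partial>lborel) \<partial>lborel)"
    proof (rule nn_integral_mono_AE)
      have "AE x in lborel. x \<noteq> b" by (rule AE_lborel_singleton)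
      thus "AE x in lborel. (\<integral>\<^sup>+\<theta>. ennreal (proximity a (x, \<theta>) powr (2 * q)) * indicator ({x0..x0 + 1} \<times> {0..2 * pi}) (x, \<theta>) \<partial>lborel)
         \<le> (ennreal (X x) * indicator {x0..x0+1} x) * (\<integral>\<^sup>+\<theta>\<in>{0..2*pi}. ennreal (S \<theta>) \<partial>lborel)"
      proof eventually_elim
        case (elim x)
        have "AE \<theta> in lborel. \<forall>k\<in>{-1..3::int}. \<theta> \<noteq> Arg a + k * pi"
          by (intro AE_finite_allI AE_lborel_singleton) auto
        hence "(\<integral>\<^sup>+\<theta>. ennreal (proximity a (x, \<theta>) powr (2 * q)) * indicator ({x0..x0 + 1} \<times> {0..2 * pi}) (x, \<theta>) \<partial>lborel)
          \<le> (\<integral>\<^sup>+\<theta>. (ennreal (X x) * indicator {x0..x0+1} x) * (ennreal (S \<theta>) * indicator {0..2*pi} \<theta>) \<partial>lborel)"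
        proof (intro nn_integral_mono_AE, eventually_elim)
          case (elim \<theta>)
          show ?case
          proof (cases "x \<in> {x0..x0+1} \<and> \<theta> \<in> {0..2*pi}")
            case True
            have "proximity a (x, \<theta>) powr (2 * q) \<le> X x * S \<theta>"
              unfolding X_def S_def b_def
              by (rule proximity_powr_le[OF q False]) (use True elim \<open>x \<noteq> b\<close> in \<open>auto simp: b_def\<close>)
            thus ?thesis using True X0 S0 by (auto simp: indicator_def ennreal_leI simp flip: ennreal_mult)
          qed (auto simp: indicator_def)
        qed
        also have "\<dots> = (ennreal (X x) * indicator {x0..x0+1} x) * (\<integral>\<^sup>+\<theta>\<in>{0..2*pi}. ennreal (S \<theta>) \<partial>lborel)"
          by (rule nn_integral_cmult) auto
        finally show ?case .
      qed
    qed
    also have "\<dots> \<le> (\<integral>\<^sup>+x. (ennreal (X x) * indicator {x0..x0+1} x) * ennreal (10 * C1) \<partial>lborel)"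
      using IS by (intro nn_integral_mono mult_left_mono) auto
    also have "\<dots> = (\<integral>\<^sup>+x\<in>{x0..x0+1}. ennreal (X x) \<partial>lborel) * ennreal (10 * C1)"
      by (rule nn_integral_multc) auto
    also have "\<dots> \<le> ennreal (2 * (1 + C1)) * ennreal (10 * C1)"
      by (intro mult_right_mono IX) auto
    also have "\<dots> \<le> ennreal (7 + 2 * (1 + C1) * (10 * C1))"
      using C1 by (simp flip: ennreal_mult ennreal_plus)
    finally show ?thesis .
  qed
  moreover have "7 + 2 * (1 + C1) * (10 * C1) > 0" using C1 by (simp add: add_pos_pos)
  ultimately show ?thesis using that unfolding proximity_bounded_def by blast
qed

section \<open>Logarithmic speed of an entire function along circles\<close>

text \<open>Only the part of the path up to the first point where \<open>|\<phi>|\<close> reaches \<open>exp lo\<close> is used.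
  There \<open>\<phi>\<close> has no zeros and \<open>ln |\<phi>|\<close> is differentiable, with derivative at most \<open>|\<phi>'| / |\<phi>|\<close>.\<close>

lemma log_variation_le_integral:
  fixes \<phi> \<phi>' :: "real \<Rightarrow> complex"
  assumes der: "\<And>\<theta>. (\<phi> has_vector_derivative \<phi>' \<theta>) (at \<theta>)" and cont: "continuous_on UNIV \<phi>'"
    and st: "s \<le> t" and up: "exp up \<le> norm (\<phi> s)" and lo: "norm (\<phi> t) \<le> exp lo" and lu: "lo \<le> up"
  shows "ennreal (up - lo) \<le> (\<integral>\<^sup>+\<theta>\<in>{s..t}. ennreal (norm (\<phi>' \<theta>) / norm (\<phi> \<theta>)) * indicator {\<theta>. exp lo \<le> norm (\<phi> \<theta>)} \<theta> \<partial>lborel)"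
proof -
  have c\<phi>: "continuous_on UNIV \<phi>"
    using der has_vector_derivative_continuous by (blast intro: continuous_at_imp_continuous_on)
  have [measurable]: "\<phi> \<in> borel_measurable borel" "\<phi>' \<in> borel_measurable borel"
    using c\<phi> cont by (auto intro: borel_measurable_continuous_onI)
  \<comment> \<open>The minimum of \<open>S\<close> is the first parameter at which the value has dropped to \<open>exp lo\<close>.\<close>
  define S where "S = {s..t} \<inter> {\<theta>. norm (\<phi> \<theta>) \<le> exp lo}"
  have clS: "closed {\<theta>. norm (\<phi> \<theta>) \<le> exp lo}"
    by (intro closed_Collect_le continuous_intros continuous_on_norm c\<phi>)
  have cS: "compact S" unfolding S_def by (intro compact_Int_closed clS) auto
  have tS: "t \<in> S" using st lo by (auto simp: S_def)
  obtain m where m: "m \<in> S" "\<And>\<theta>. \<theta> \<in> S \<Longrightarrow> m \<le> \<theta>"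
    using compact_attains_inf[OF cS] tS by blast
  have sm: "s \<le> m" "m \<le> t" "norm (\<phi> m) \<le> exp lo" using m(1) by (auto simp: S_def)
  have gt: "exp lo < norm (\<phi> \<theta>)" if "\<theta> \<in> {s..<m}" for \<theta>
  proof (rule ccontr)
    assume "\<not> exp lo < norm (\<phi> \<theta>)"
    hence "\<theta> \<in> S" using that sm by (auto simp: S_def)
    from m(2)[OF this] that show False by auto
  qed
  have ge: "exp lo \<le> norm (\<phi> \<theta>)" if "\<theta> \<in> {s..m}" for \<theta>
  proof (cases "s < m")
    case True
    have "closed {\<theta>. exp lo \<le> norm (\<phi> \<theta>)}"
      by (intro closed_Collect_le continuous_intros continuous_on_norm c\<phi>)
    moreover have "{s..<m} \<subseteq> {\<theta>. exp lo \<le> norm (\<phi> \<theta>)}" using gt by (auto intro: less_imp_le)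
    ultimately have "closure {s..<m} \<subseteq> {\<theta>. exp lo \<le> norm (\<phi> \<theta>)}" by (simp add: closure_minimal)
    thus ?thesis using that True closure_atLeastLessThan[OF True] by auto
  next
    case False
    hence "\<theta> = s" using that by auto
    have "exp lo \<le> exp up" using lu by simp
    hence "exp lo \<le> norm (\<phi> s)" using up by linarith
    thus ?thesis using \<open>\<theta> = s\<close> by simp
  qed
  have nz: "\<phi> \<theta> \<noteq> 0" if "\<theta> \<in> {s..m}" for \<theta>
    using ge[OF that] by (metis exp_gt_zero linorder_not_le norm_zero)
  define g where "g = (\<lambda>\<theta>. ln ((Re (\<phi> \<theta>))\<^sup>2 + (Im (\<phi> \<theta>))\<^sup>2) / 2)"
  define g' where "g' = (\<lambda>\<theta>. (Re (\<phi> \<theta>) * Re (\<phi>' \<theta>) + Im (\<phi> \<theta>) * Im (\<phi>' \<theta>)) / (norm (\<phi> \<theta>))\<^sup>2)"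
  have g_eq: "g \<theta> = ln (norm (\<phi> \<theta>))" if "\<phi> \<theta> \<noteq> 0" for \<theta>
    using that unfolding g_def cmod_power2[symmetric] by (simp add: ln_realpow)
  define h where "h = (\<lambda>\<theta>. norm (\<phi>' \<theta>) / norm (\<phi> \<theta>))"
  have gder: "(g has_real_derivative g' \<theta>) (at \<theta> within {s..m})" if "\<theta> \<in> {s..m}" for \<theta>
  proof -
    have r: "((\<lambda>\<theta>. Re (\<phi> \<theta>)) has_real_derivative Re (\<phi>' \<theta>)) (at \<theta>)"
      using bounded_linear.has_vector_derivative[OF bounded_linear_Re der[of \<theta>]]
      by (simp add: has_real_derivative_iff_has_vector_derivative)
    have i: "((\<lambda>\<theta>. Im (\<phi> \<theta>)) has_real_derivative Im (\<phi>' \<theta>)) (at \<theta>)"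
      using bounded_linear.has_vector_derivative[OF bounded_linear_Im der[of \<theta>]]
      by (simp add: has_real_derivative_iff_has_vector_derivative)
    have p: "(Re (\<phi> \<theta>))\<^sup>2 + (Im (\<phi> \<theta>))\<^sup>2 > 0"
      using nz[OF that] unfolding cmod_power2[symmetric] by simp
    define D where "D = 2 * (Re (\<phi> \<theta>) * Re (\<phi>' \<theta>) + Im (\<phi> \<theta>) * Im (\<phi>' \<theta>))"
    define P where "P = (Re (\<phi> \<theta>))\<^sup>2 + (Im (\<phi> \<theta>))\<^sup>2"
    have d: "((\<lambda>\<theta>. (Re (\<phi> \<theta>))\<^sup>2 + (Im (\<phi> \<theta>))\<^sup>2) has_real_derivative D) (at \<theta>)"
      by (rule DERIV_cong[OF DERIV_add[OF DERIV_power[OF r, of 2] DERIV_power[OF i, of 2]]])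
        (simp add: D_def mult.commute)
    have "(g has_real_derivative inverse P * D / 2) (at \<theta>)"
      unfolding g_def P_def by (rule DERIV_cdivide[OF DERIV_chain2[OF DERIV_ln[OF p] d]])
    moreover have "inverse u * (2 * v) / 2 = v / u" for u v :: real by (cases "u = 0") (simp_all add: field_simps)
    hence "inverse P * D / 2 = g' \<theta>"
      unfolding g'_def cmod_power2 P_def[symmetric] D_def .
    ultimately show ?thesis by (metis has_field_derivative_at_within)
  qed
  have I0: "(g' has_integral (g m - g s)) {s..m}"
    using sm gder by (intro fundamental_theorem_of_calculus)
      (auto simp: has_real_derivative_iff_has_vector_derivative)
  have I1: "((\<lambda>\<theta>. - g' \<theta>) has_integral (g s - g m)) {s..m}"
    using has_integral_neg[OF I0] by simp
  have hc: "continuous_on {s..m} h"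
    unfolding h_def using nz by (intro continuous_intros continuous_on_subset[OF c\<phi>] continuous_on_subset[OF cont]) auto
  then obtain J where J: "(h has_integral J) {s..m}" using integrable_continuous_real by blast
  have le: "- g' \<theta> \<le> h \<theta>" if "\<theta> \<in> {s..m}" for \<theta>
  proof -
    have n: "norm (\<phi> \<theta>) > 0" using nz[OF that] by simp
    have "Re (cnj (\<phi> \<theta>) * \<phi>' \<theta>) \<ge> - norm (cnj (\<phi> \<theta>) * \<phi>' \<theta>)" by (metis abs_Re_le_cmod abs_le_D2 minus_le_iff)
    hence "- (Re (\<phi> \<theta>) * Re (\<phi>' \<theta>) + Im (\<phi> \<theta>) * Im (\<phi>' \<theta>)) \<le> norm (\<phi> \<theta>) * norm (\<phi>' \<theta>)"
      by (simp add: norm_mult)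
    hence "- (Re (\<phi> \<theta>) * Re (\<phi>' \<theta>) + Im (\<phi> \<theta>) * Im (\<phi>' \<theta>)) / (norm (\<phi> \<theta>))\<^sup>2 \<le> norm (\<phi> \<theta>) * norm (\<phi>' \<theta>) / (norm (\<phi> \<theta>))\<^sup>2"
      by (intro divide_right_mono) auto
    also have "\<dots> = h \<theta>" using n by (simp add: h_def power2_eq_square)
    finally show ?thesis unfolding g'_def minus_divide_left .
  qed
  have "g s - g m \<le> J" by (rule has_integral_le[OF I1 J le])
  moreover have "up \<le> g s"
  proof -
    have s: "\<phi> s \<noteq> 0" using nz sm by auto
    have "ln (exp up) \<le> ln (norm (\<phi> s))" using up s by (intro ln_mono) auto
    thus ?thesis by (simp add: g_eq[OF s])
  qed
  moreover have "g m \<le> lo"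
  proof -
    have s: "\<phi> m \<noteq> 0" using nz sm by auto
    have "ln (norm (\<phi> m)) \<le> ln (exp lo)" using sm s by (intro ln_mono) auto
    thus ?thesis by (simp add: g_eq[OF s])
  qed
  ultimately have "up - lo \<le> J" by linarith
  hence "ennreal (up - lo) \<le> ennreal J" by (rule ennreal_leI)
  also have "\<dots> = (\<integral>\<^sup>+\<theta>. ennreal (h \<theta> * indicator {s..m} \<theta>) \<partial>lborel)"
  proof (rule nn_integral_has_integral_lborel[symmetric])
    show "(\<lambda>\<theta>. h \<theta> * indicator {s..m} \<theta>) \<in> borel_measurable borel" unfolding h_def by measurable
    show "0 \<le> h \<theta> * indicator {s..m} \<theta>" for \<theta> by (simp add: h_def)
    have "((\<lambda>\<theta>. if \<theta> \<in> {s..m} then h \<theta> else 0) has_integral J) UNIV"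
      using J by (simp only: has_integral_restrict_UNIV)
    thus "((\<lambda>\<theta>. h \<theta> * indicator {s..m} \<theta>) has_integral J) UNIV"
      by (rule has_integral_eq[rotated]) (auto simp: indicator_def)
  qed
  also have "\<dots> \<le> (\<integral>\<^sup>+\<theta>\<in>{s..t}. ennreal (norm (\<phi>' \<theta>) / norm (\<phi> \<theta>)) * indicator {\<theta>. exp lo \<le> norm (\<phi> \<theta>)} \<theta> \<partial>lborel)"
    using ge sm by (intro nn_integral_mono) (auto simp: h_def indicator_def)
  finally show ?thesis .
qed

lemma log_variation_le_integral_either_direction:
  fixes \<phi> \<phi>' :: "real \<Rightarrow> complex"
  assumes der: "\<And>\<theta>. (\<phi> has_vector_derivative \<phi>' \<theta>) (at \<theta>)" and cont: "continuous_on UNIV \<phi>'"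
    and st: "s \<in> {a..b}" "t \<in> {a..b}"
    and up: "exp up \<le> norm (\<phi> s)" and lo: "norm (\<phi> t) \<le> exp lo" and lu: "lo \<le> up"
  shows "ennreal (up - lo) \<le> (\<integral>\<^sup>+\<theta>\<in>{a..b}. ennreal (norm (\<phi>' \<theta>) / norm (\<phi> \<theta>)) * indicator {\<theta>. exp lo \<le> norm (\<phi> \<theta>)} \<theta> \<partial>lborel)"
proof -
  have c\<phi>: "continuous_on UNIV \<phi>"
    using der has_vector_derivative_continuous by (blast intro: continuous_at_imp_continuous_on)
  have [measurable]: "\<phi> \<in> borel_measurable borel" "\<phi>' \<in> borel_measurable borel"
    using c\<phi> cont by (auto intro: borel_measurable_continuous_onI)
  let ?I = "\<lambda>\<theta>. ennreal (norm (\<phi>' \<theta>) / norm (\<phi> \<theta>)) * indicator {\<theta>. exp lo \<le> norm (\<phi> \<theta>)} \<theta>"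
  have [measurable]: "?I \<in> borel_measurable borel" by measurable
  show ?thesis
  proof (cases "s \<le> t")
    case True
    have "ennreal (up - lo) \<le> (\<integral>\<^sup>+\<theta>\<in>{s..t}. ?I \<theta> \<partial>lborel)"
      by (rule log_variation_le_integral[OF der cont True up lo lu])
    also have "\<dots> \<le> (\<integral>\<^sup>+\<theta>\<in>{a..b}. ?I \<theta> \<partial>lborel)"
      using st by (intro nn_integral_mono mult_left_mono) (auto simp: indicator_def)
    finally show ?thesis .
  next
    case False
    have d: "((\<lambda>\<theta>. \<phi> (- \<theta>)) has_vector_derivative - \<phi>' (- \<theta>)) (at \<theta>)" for \<theta>
    proof -
      have "((\<phi> \<circ> uminus) has_vector_derivative (- 1) *\<^sub>R \<phi>' (- \<theta>)) (at \<theta>)"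
        by (rule vector_diff_chain_at) (auto intro!: derivative_eq_intros der)
      thus ?thesis by (simp add: o_def)
    qed
    have c: "continuous_on UNIV (\<lambda>\<theta>. - \<phi>' (- \<theta>))"
      by (intro continuous_intros continuous_on_compose2[OF cont]) auto
    have "ennreal (up - lo) \<le> (\<integral>\<^sup>+\<theta>\<in>{- s..- t}. ennreal (norm (- \<phi>' (- \<theta>)) / norm (\<phi> (- \<theta>))) * indicator {\<theta>. exp lo \<le> norm (\<phi> (- \<theta>))} \<theta> \<partial>lborel)"
      by (rule log_variation_le_integral[OF d c]) (use False up lo lu in auto)
    also have "\<dots> \<le> (\<integral>\<^sup>+\<theta>. ?I (0 + (- 1) * \<theta>) * indicator {a..b} (0 + (- 1) * \<theta>) \<partial>lborel)"
      using st by (intro nn_integral_mono) (auto simp: indicator_def)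
    also have "\<dots> = (\<integral>\<^sup>+\<theta>\<in>{a..b}. ?I \<theta> \<partial>lborel)"
      using nn_integral_real_affine[of "\<lambda>\<theta>. ?I \<theta> * indicator {a..b} \<theta>" "- 1" 0] by simp
    finally show ?thesis .
  qed
qed

definition log_speed :: "(complex \<Rightarrow> complex) \<Rightarrow> real \<times> real \<Rightarrow> real" where
  "log_speed f p = norm (polar p) * norm (deriv f (polar p)) / norm (f (polar p))"

lemma entire_measurable [measurable]:
  assumes "f holomorphic_on UNIV"
  shows "(\<lambda>p. f (polar p)) \<in> borel_measurable (lborel \<Otimes>\<^sub>M lborel)"
proof -
  have "f \<in> borel_measurable borel"
    using assms by (intro borel_measurable_continuous_onI holomorphic_on_imp_continuous_on)
  thus ?thesis by measurable
qed

lemma log_speed_measurable [measurable]: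
  assumes "f holomorphic_on UNIV"
  shows "log_speed f \<in> borel_measurable (lborel \<Otimes>\<^sub>M lborel)"
proof -
  have d: "deriv f holomorphic_on UNIV" using assms holomorphic_deriv by blast
  note [measurable] = entire_measurable[OF assms] entire_measurable[OF d]
  show ?thesis unfolding log_speed_def by measurable
qed

lemma sphere_polar:
  assumes "norm z = exp x"
  obtains \<theta> where "\<theta> \<in> {0..2*pi}" "z = polar (x, \<theta>)"
proof -
  have "z \<noteq> 0" using assms by auto
  have "polar (x, Arg2pi z) = exp x * exp (\<i> * Arg2pi z)"
    unfolding polar_def exp_eq_polar[of "Complex _ _"] cis_conv_exp by simp
  hence "z = polar (x, Arg2pi z)"
    using Arg2pi_eq[of z] assms by simp
  thus ?thesis using that[of "Arg2pi z"] Arg2pi_ge_0[of z] Arg2pi_lt_2pi[of z] by (simp add: less_imp_le)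
qed

lemma circle_variation:
  assumes hol: "f holomorphic_on UNIV"
    and up: "norm z1 = exp x" "exp up \<le> norm (f z1)" and lo: "norm z2 = exp x" "norm (f z2) \<le> exp lo" and lu: "lo \<le> up"
  shows "ennreal (up - lo) \<le> (\<integral>\<^sup>+\<theta>\<in>{0..2*pi}. ennreal (log_speed f (x, \<theta>)) * indicator {\<theta>. exp lo \<le> norm (f (polar (x, \<theta>)))} \<theta> \<partial>lborel)"
proof -
  obtain s where s: "s \<in> {0..2*pi}" "z1 = polar (x, s)" using sphere_polar[OF up(1)] .
  obtain t where t: "t \<in> {0..2*pi}" "z2 = polar (x, t)" using sphere_polar[OF lo(1)] .
  define P where "P = (\<lambda>\<theta>. polar (x, \<theta>))"
  have dP: "(P has_vector_derivative (\<i> * P \<theta>)) (at \<theta>)" for \<theta>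
  proof -
    have "((\<lambda>\<theta>. exp (of_real x + \<i> * of_real \<theta>)) has_vector_derivative (\<i> * exp (of_real x + \<i> * of_real \<theta>))) (at \<theta>)"
    proof -
      have "((\<lambda>\<theta>. of_real x + \<i> * of_real \<theta>) has_vector_derivative \<i>) (at \<theta>)"
        by (auto intro!: derivative_eq_intros simp: has_vector_derivative_def scaleR_conv_of_real)
      from field_vector_diff_chain_at[OF this DERIV_exp] show ?thesis by (simp add: o_def)
    qed
    thus ?thesis by (simp add: P_def polar_def Complex_eq)
  qed
  have cP: "continuous_on UNIV P"
    using dP has_vector_derivative_continuous by (blast intro: continuous_at_imp_continuous_on)
  have df: "(f has_field_derivative deriv f z) (at z)" for z
    using hol holomorphic_derivI by blast
  have d: "((\<lambda>\<theta>. f (P \<theta>)) has_vector_derivative (\<i> * P \<theta> * deriv f (P \<theta>))) (at \<theta>)" for \<theta>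
    using field_vector_diff_chain_at[OF dP df] by (simp add: o_def)
  have dh: "deriv f holomorphic_on UNIV" using hol holomorphic_deriv by blast
  have c: "continuous_on UNIV (\<lambda>\<theta>. \<i> * P \<theta> * deriv f (P \<theta>))"
    by (intro continuous_intros cP continuous_on_compose2[OF holomorphic_on_imp_continuous_on[OF dh] cP]) auto
  have "ennreal (up - lo) \<le> (\<integral>\<^sup>+\<theta>\<in>{0..2*pi}. ennreal (norm (\<i> * P \<theta> * deriv f (P \<theta>)) / norm (f (P \<theta>))) * indicator {\<theta>. exp lo \<le> norm (f (P \<theta>))} \<theta> \<partial>lborel)"
    by (rule log_variation_le_integral_either_direction[OF d c s(1) t(1)])
      (use up lo lu s t in \<open>auto simp: P_def\<close>)
  thus ?thesis by (simp add: log_speed_def P_def norm_mult)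
qed

lemma log_speed_bound:
  assumes hol: "f holomorphic_on UNIV" and R: "R > 0" and bd: "\<And>z. norm z = R \<Longrightarrow> norm (f z) \<le> E"
    and \<eta>: "0 < \<eta>" "\<eta> \<le> 1/4" and b: "norm b \<le> R/2" "f b \<noteq> 0"
  obtains as :: "complex list"
  where "real (length as) \<le> 32 * ln (E / norm (f b)) / \<eta>"
    and "\<And>p. norm (polar p) \<le> (1 - 2 * \<eta>) * R \<Longrightarrow> f (polar p) \<noteq> 0 \<Longrightarrow>
      log_speed f p \<le> 80 * (1 + ln (E / norm (f b))) / \<eta>\<^sup>2 + (\<Sum>a\<leftarrow>as. proximity a p)"
proof -
  define F where "F = (\<lambda>z::complex. f (R * z))"
  have holF: "F holomorphic_on UNIV"
    unfolding F_def by (rule holomorphic_on_compose_gen[OF _ hol, unfolded o_def]) (auto intro!: holomorphic_intros)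
  have dF: "deriv F z = R * deriv f (R * z)" for z :: complex
  proof -
    have "(f has_field_derivative deriv f (R * z)) (at (R * z))" using hol holomorphic_derivI by blast
    hence "(F has_field_derivative (deriv f (R * z) * R)) (at z)"
      unfolding F_def by (rule DERIV_chain2) (auto intro!: derivative_eq_intros)
    thus ?thesis using DERIV_imp_deriv by (fastforce simp: mult.commute)
  qed
  have bdF: "norm (F z) \<le> E" if "norm z = 1" for z
    unfolding F_def using that R by (intro bd) (simp add: norm_mult)
  have Fb: "F (b / R) = f b" using R by (simp add: F_def)
  have bR: "norm (b / R) \<le> 1/2" "F (b / R) \<noteq> 0" using b R Fb by (auto simp: norm_divide field_simps)
  obtain as where as: "real (length as) \<le> 32 * ln (E / norm (f b)) / \<eta>"
    "\<And>z. norm z \<le> 1 - 2 * \<eta> \<Longrightarrow> F z \<noteq> 0 \<Longrightarrow>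
      norm (deriv F z / F z) \<le> 80 * (1 + ln (E / norm (f b))) / \<eta>\<^sup>2 + (\<Sum>a\<leftarrow>as. 1 / norm (z - a))"
    using log_derivative_bound[OF holF bdF \<eta> bR] unfolding Fb by blast
  define K where "K = 80 * (1 + ln (E / norm (f b))) / \<eta>\<^sup>2"
  have fbE: "norm (f b) \<le> E" by (rule entire_bound_cball[OF hol bd]) (use b R in auto)
  have K0: "K \<ge> 0" unfolding K_def using fbE b by (intro divide_nonneg_nonneg mult_nonneg_nonneg add_nonneg_nonneg ln_ge_zero) auto
  show ?thesis
  proof (rule that[of "map (\<lambda>a. R * a) as"])
    show "real (length (map (\<lambda>a. R * a) as)) \<le> 32 * ln (E / norm (f b)) / \<eta>" using as(1) by simp
    fix p assume p: "norm (polar p) \<le> (1 - 2 * \<eta>) * R" "f (polar p) \<noteq> 0"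
    define z where "z = polar p / R"
    have zp: "polar p = R * z" using R by (simp add: z_def)
    have nz: "norm z \<le> 1 - 2 * \<eta>" using p(1) R by (simp add: z_def norm_divide field_simps)
    have "norm (deriv F z / F z) \<le> K + (\<Sum>a\<leftarrow>as. 1 / norm (z - a))"
      unfolding K_def by (rule as(2)[OF nz]) (use p zp in \<open>simp add: F_def\<close>)
    hence "norm z * norm (deriv F z / F z) \<le> norm z * (K + (\<Sum>a\<leftarrow>as. 1 / norm (z - a)))"
      by (intro mult_left_mono) auto
    also have "\<dots> \<le> K + (\<Sum>a\<leftarrow>as. norm z * (1 / norm (z - a)))"
    proof -
      have "norm z * K \<le> 1 * K" using nz \<eta> K0 by (intro mult_right_mono) auto
      moreover have "(\<Sum>a\<leftarrow>as. norm z * (1 / norm (z - a))) = norm z * (\<Sum>a\<leftarrow>as. 1 / norm (z - a))"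
        by (rule sum_list_const_mult)
      ultimately show ?thesis unfolding distrib_left by linarith
    qed
    also have "(\<Sum>a\<leftarrow>as. norm z * (1 / norm (z - a))) = (\<Sum>a\<leftarrow>as. proximity (R * a) p)"
    proof -
      have "norm z * (1 / norm (z - a)) = proximity (R * a) p" for a :: complex
      proof -
        have "polar p - R * a = R * (z - a)" by (simp add: zp algebra_simps)
        thus ?thesis using R by (simp add: proximity_def zp norm_mult)
      qed
      thus ?thesis by (simp only:)
    qed
    also have "norm z * norm (deriv F z / F z) = log_speed f p"
      using R unfolding log_speed_def norm_divide dF zp by (simp add: F_def norm_mult)
    finally show "log_speed f p \<le> 80 * (1 + ln (E / norm (f b))) / \<eta>\<^sup>2 + (\<Sum>a\<leftarrow>map (\<lambda>a. R * a) as. proximity a p)"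
      by (simp add: K_def o_def)
  qed
qed

section \<open>The region of large logarithmic speed and separated points\<close>

abbreviation plane :: "(real \<times> real) measure" where
  "plane \<equiv> lborel \<Otimes>\<^sub>M lborel"

lemma proximity_boundedD:
  "proximity_bounded q C \<Longrightarrow> (\<integral>\<^sup>+p\<in>{x..x + 1} \<times> {0..2 * pi}. ennreal (proximity a p powr (2 * q)) \<partial>plane) \<le> ennreal C"
  unfolding proximity_bounded_def by blast

lemma emeasure_box:
  assumes "w \<ge> 0"
  shows "emeasure plane ({xl..xl + w} \<times> {0..2 * pi}) = ennreal (w * (2 * pi))"
  using assms by (subst lborel.emeasure_pair_measure_Times) (auto simp: ennreal_mult)

lemma le_threshold_plus_powr:
  assumes "\<tau> > 0" "y \<ge> 0" "q > (1/2::real)"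
  shows "y \<le> \<tau> + \<tau> powr (1 - 2 * q) * y powr (2 * q)"
proof (cases "y \<le> \<tau>")
  case True
  thus ?thesis by (simp add: add_increasing2)
next
  case False
  hence y: "y > \<tau>" "y > 0" using assms by auto
  have "y = y powr (1 - 2 * q) * y powr (2 * q)" using y by (simp flip: powr_add)
  also have "\<dots> \<le> \<tau> powr (1 - 2 * q) * y powr (2 * q)"
    using y assms by (intro mult_right_mono powr_mono2') auto
  finally show ?thesis using assms by linarith
qed

text \<open>Integrating \<open>circle_variation\<close> over the radii in a window of logarithmic width \<open>w\<close> bounds
  \<open>(up - lo) * w\<close> by the integral of the speed. Where \<open>|f|\<close> is at least \<open>exp lo\<close> outside \<open>G\<close>, the speed is
  at most \<open>\<Lambda>\<close>. On \<open>G\<close> it is at most a constant plus \<open>32 * D / \<eta>\<close> kernels, and each kernel is split at the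
  level \<open>\<tau>\<close>: below \<open>\<tau>\<close> it is charged to the area of \<open>G\<close>, above \<open>\<tau>\<close> to its \<open>L^(2q)\<close> norm.\<close>

lemma area_of_fast_region:
  fixes f :: "complex \<Rightarrow> complex" and q C :: real
  assumes hol: "f holomorphic_on UNIV" and q: "1/2 < q" "q < 1"
    and C: "C > 0" "proximity_bounded q C"
    and R: "R > 0" and bd: "\<And>z. norm z = R \<Longrightarrow> norm (f z) \<le> E"
    and \<eta>: "0 < \<eta>" "\<eta> \<le> 1/4" and b: "norm b \<le> R/2" "f b \<noteq> 0"
    and w: "0 < w" "w \<le> 1" "exp (xl + w) \<le> (1 - 2 * \<eta>) * R"
    and lu: "lo \<le> up" and \<Lambda>: "\<Lambda> \<ge> 0" and \<tau>: "\<tau> > 0"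
    and up: "\<And>x. x \<in> {xl..xl+w} \<Longrightarrow> \<exists>z. norm z = exp x \<and> exp up \<le> norm (f z)"
    and lo: "\<And>x. x \<in> {xl..xl+w} \<Longrightarrow> \<exists>z. norm z = exp x \<and> norm (f z) \<le> exp lo"
  defines "G \<equiv> {p \<in> {xl..xl+w} \<times> {0..2*pi}. exp lo \<le> norm (f (polar p)) \<and> \<Lambda> < log_speed f p}"
    and "D \<equiv> ln (E / norm (f b))"
  shows "G \<in> sets plane" "G \<subseteq> {xl..xl+w} \<times> {0..2*pi}" "measure plane G \<le> 7 * w"
    and "(up - lo) * w \<le> 7 * w * \<Lambda> + (80 * (1 + D) / \<eta>\<^sup>2 + 32 * D / \<eta> * \<tau>) * measure plane G + 32 * D / \<eta> * \<tau> powr (1 - 2 * q) * C"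
proof -
  note [measurable] = entire_measurable[OF hol] log_speed_measurable[OF hol]
  define B where "B = {xl..xl+w} \<times> {0..2*pi}"
  have [measurable]: "B \<in> sets plane" unfolding B_def by measurable
  have Geq: "G = B \<inter> {p \<in> space plane. exp lo \<le> norm (f (polar p)) \<and> \<Lambda> < log_speed f p}"
    by (auto simp: G_def B_def space_pair_measure)
  show Gm [measurable]: "G \<in> sets plane" unfolding Geq by measurable
  show GB: "G \<subseteq> {xl..xl+w} \<times> {0..2*pi}" by (auto simp: G_def)
  have pi7: "2 * pi \<le> 7" using pi_less by simp
  have eB: "emeasure plane B = ennreal (w * (2 * pi))" unfolding B_def using w by (intro emeasure_box) simp
  have "emeasure plane G \<le> emeasure plane B" using GB by (intro emeasure_mono) (auto simp: B_def)
  also have "\<dots> \<le> ennreal (7 * w)" unfolding eB using w pi7 by (intro ennreal_leI) simp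
  finally have eG: "emeasure plane G \<le> ennreal (7 * w)" .
  have emG: "emeasure plane G = ennreal (measure plane G)"
    using eG by (intro emeasure_eq_ennreal_measure) (auto simp: top_unique)
  show "measure plane G \<le> 7 * w" using eG w unfolding emG by simp
  obtain as where as: "real (length as) \<le> 32 * D / \<eta>"
    "\<And>p. norm (polar p) \<le> (1 - 2 * \<eta>) * R \<Longrightarrow> f (polar p) \<noteq> 0 \<Longrightarrow>
      log_speed f p \<le> 80 * (1 + D) / \<eta>\<^sup>2 + (\<Sum>a\<leftarrow>as. proximity a p)"
    using log_speed_bound[OF hol R bd \<eta> b] unfolding D_def by blast
  have fbE: "norm (f b) \<le> E" by (rule entire_bound_cball[OF hol bd]) (use b R in auto)
  have D0: "D \<ge> 0" unfolding D_def using fbE b by (intro ln_ge_zero) auto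
  define H where "H = 80 * (1 + D) / \<eta>\<^sup>2"
  have H0: "H \<ge> 0" unfolding H_def using D0 by simp
  define n where "n = length as"
  define y where "y = (\<lambda>i p. proximity (as ! i) p powr (2 * q))"
  define \<mu> where "\<mu> = \<tau> powr (1 - 2 * q)"
  have [measurable]: "y i \<in> borel_measurable plane" for i unfolding y_def by measurable
  have bound: "log_speed f p \<le> (H + n * \<tau>) + (\<Sum>i<n. \<mu> * y i p)" if p: "p \<in> G" for p
  proof -
    have x: "fst p \<le> xl + w" using p GB by auto
    have "norm (polar p) = exp (fst p)" by (cases p) simp
    also have "\<dots> \<le> exp (xl + w)" using x by simp
    finally have n1: "norm (polar p) \<le> (1 - 2 * \<eta>) * R" using w(3) by linarith
    have "0 < exp lo" by simp
    hence n2: "f (polar p) \<noteq> 0" using p unfolding G_def by auto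
    have "(\<Sum>a\<leftarrow>as. proximity a p) = (\<Sum>i<n. proximity (as ! i) p)"
      by (simp add: sum_list_sum_nth n_def atLeast0LessThan)
    also have "\<dots> \<le> (\<Sum>i<n. \<tau> + \<mu> * y i p)"
      unfolding \<mu>_def y_def using \<tau> q by (intro sum_mono le_threshold_plus_powr) auto
    also have "\<dots> = n * \<tau> + (\<Sum>i<n. \<mu> * y i p)" by (simp add: sum.distrib)
    finally show ?thesis using as(2)[OF n1 n2] unfolding H_def by linarith
  qed
  have "ennreal ((up - lo) * w) = (\<integral>\<^sup>+x. ennreal (up - lo) * indicator {xl..xl+w} x \<partial>lborel)"
    using w lu by (simp add: nn_integral_cmult ennreal_mult)
  also have "\<dots> \<le> (\<integral>\<^sup>+x. \<integral>\<^sup>+\<theta>. ennreal (log_speed f (x, \<theta>)) * indicator {p. exp lo \<le> norm (f (polar p))} (x, \<theta>) * indicator B (x, \<theta>) \<partial>lborel \<partial>lborel)"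
  proof (rule nn_integral_mono)
    fix x
    show "ennreal (up - lo) * indicator {xl..xl+w} x \<le> (\<integral>\<^sup>+\<theta>. ennreal (log_speed f (x, \<theta>)) * indicator {p. exp lo \<le> norm (f (polar p))} (x, \<theta>) * indicator B (x, \<theta>) \<partial>lborel)"
    proof (cases "x \<in> {xl..xl+w}")
      case True
      obtain z1 z2 where z: "norm z1 = exp x" "exp up \<le> norm (f z1)" "norm z2 = exp x" "norm (f z2) \<le> exp lo"
        using up[OF True] lo[OF True] by blast
      have "ennreal (up - lo) \<le> (\<integral>\<^sup>+\<theta>\<in>{0..2*pi}. ennreal (log_speed f (x, \<theta>)) * indicator {\<theta>. exp lo \<le> norm (f (polar (x, \<theta>)))} \<theta> \<partial>lborel)"
        by (rule circle_variation[OF hol z lu])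
      also have "\<dots> = (\<integral>\<^sup>+\<theta>. ennreal (log_speed f (x, \<theta>)) * indicator {p. exp lo \<le> norm (f (polar p))} (x, \<theta>) * indicator B (x, \<theta>) \<partial>lborel)"
        using True by (intro nn_integral_cong) (auto simp: B_def indicator_def)
      finally show ?thesis using True by simp
    qed simp
  qed
  also have "\<dots> = (\<integral>\<^sup>+p. ennreal (log_speed f p) * indicator {p. exp lo \<le> norm (f (polar p))} p * indicator B p \<partial>plane)"
  proof (rule lborel.nn_integral_fst)
    have "{p. exp lo \<le> norm (f (polar p))} = {p \<in> space plane. exp lo \<le> norm (f (polar p))}"
      by (simp add: space_pair_measure)
    also have "\<dots> \<in> sets plane" by measurable
    finally have [measurable]: "{p. exp lo \<le> norm (f (polar p))} \<in> sets plane" .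
    show "(\<lambda>p. ennreal (log_speed f p) * indicator {p. exp lo \<le> norm (f (polar p))} p * indicator B p) \<in> borel_measurable plane"
      by measurable
  qed
  also have "\<dots> \<le> (\<integral>\<^sup>+p. ennreal \<Lambda> * indicator B p + (ennreal (H + n * \<tau>) * indicator G p + (\<Sum>i<n. ennreal \<mu> * (ennreal (y i p) * indicator ({xl..xl+1} \<times> {0..2*pi}) p))) \<partial>plane)"
  proof (rule nn_integral_mono)
    fix p
    show "ennreal (log_speed f p) * indicator {p. exp lo \<le> norm (f (polar p))} p * indicator B p
      \<le> ennreal \<Lambda> * indicator B p + (ennreal (H + n * \<tau>) * indicator G p + (\<Sum>i<n. ennreal \<mu> * (ennreal (y i p) * indicator ({xl..xl+1} \<times> {0..2*pi}) p)))"
    proof (cases "p \<in> B \<and> exp lo \<le> norm (f (polar p))")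
      case True
      show ?thesis
      proof (cases "p \<in> G")
        case True
        have p1: "p \<in> {xl..xl+1} \<times> {0..2*pi}" using True GB w by auto
        have nn: "H + n * \<tau> \<ge> 0" "\<mu> \<ge> 0" "\<And>i. y i p \<ge> 0" using H0 \<tau> by (auto simp: \<mu>_def y_def)
        have "ennreal (log_speed f p) \<le> ennreal ((H + n * \<tau>) + (\<Sum>i<n. \<mu> * y i p))"
          by (rule ennreal_leI[OF bound[OF True]])
        also have "\<dots> = ennreal (H + n * \<tau>) + ennreal (\<Sum>i<n. \<mu> * y i p)"
          using nn by (intro ennreal_plus sum_nonneg) auto
        also have "ennreal (\<Sum>i<n. \<mu> * y i p) = (\<Sum>i<n. ennreal (\<mu> * y i p))"
          using nn by (intro sum_ennreal[symmetric]) auto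
        also have "\<dots> = (\<Sum>i<n. ennreal \<mu> * ennreal (y i p))"
          using nn by (intro sum.cong ennreal_mult) auto
        finally show ?thesis using True p1 \<open>p \<in> B \<and> _\<close> by (simp add: add_increasing)
      next
        case False
        hence "log_speed f p \<le> \<Lambda>" using True by (auto simp: G_def B_def)
        hence "ennreal (log_speed f p) \<le> ennreal \<Lambda>" by (rule ennreal_leI)
        thus ?thesis using True by (simp add: add_increasing2)
      qed
    qed (auto simp: indicator_def)
  qed
  also have "\<dots> = ennreal \<Lambda> * emeasure plane B + (ennreal (H + n * \<tau>) * emeasure plane G + (\<Sum>i<n. ennreal \<mu> * (\<integral>\<^sup>+p\<in>{xl..xl+1} \<times> {0..2*pi}. ennreal (y i p) \<partial>plane)))"
  proof -
    have "integral\<^sup>N plane (indicator B) = emeasure plane B" "integral\<^sup>N plane (indicator G) = emeasure plane G"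
      by (rule nn_integral_indicator, measurable)+
    thus ?thesis by (simp add: nn_integral_add nn_integral_cmult nn_integral_sum)
  qed
  also have "\<dots> \<le> ennreal \<Lambda> * ennreal (7 * w) + (ennreal (H + n * \<tau>) * ennreal (measure plane G) + (\<Sum>i<n. ennreal \<mu> * ennreal C))"
    unfolding emG eB y_def using w pi7 by (intro add_mono mult_left_mono sum_mono proximity_boundedD[OF C(2)] ennreal_leI) auto
  also have "\<dots> = ennreal (\<Lambda> * (7 * w) + ((H + n * \<tau>) * measure plane G + n * (\<mu> * C)))"
  proof -
    have "(\<Sum>i<n. ennreal \<mu> * ennreal C) = ennreal (n * (\<mu> * C))"
      using C by (simp add: ennreal_mult \<mu>_def ennreal_of_nat_eq_real_of_nat)
    moreover have "ennreal \<Lambda> * ennreal (7 * w) = ennreal (\<Lambda> * (7 * w))" using \<Lambda> w by (intro ennreal_mult[symmetric]) auto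
    moreover have "ennreal (H + n * \<tau>) * ennreal (measure plane G) = ennreal ((H + n * \<tau>) * measure plane G)"
      using H0 \<tau> by (intro ennreal_mult[symmetric]) auto
    moreover have "(H + n * \<tau>) * measure plane G \<ge> 0" "n * (\<mu> * C) \<ge> 0" "\<Lambda> * (7 * w) \<ge> 0"
      using H0 \<tau> C \<Lambda> w by (auto simp: \<mu>_def)
    ultimately show ?thesis by (simp only: ennreal_plus add_nonneg_nonneg)
  qed
  finally have "(up - lo) * w \<le> \<Lambda> * (7 * w) + ((H + n * \<tau>) * measure plane G + n * (\<mu> * C))"
    using H0 \<tau> C \<Lambda> w by (subst (asm) ennreal_le_iff) (auto simp: \<mu>_def intro!: add_nonneg_nonneg mult_nonneg_nonneg)
  also have "\<dots> \<le> \<Lambda> * (7 * w) + ((H + 32 * D / \<eta> * \<tau>) * measure plane G + 32 * D / \<eta> * (\<mu> * C))"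
    using as(1) \<tau> C unfolding n_def[symmetric]
    by (intro add_mono mult_right_mono order_refl) (auto simp: \<mu>_def)
  finally show "(up - lo) * w \<le> 7 * w * \<Lambda> + (80 * (1 + D) / \<eta>\<^sup>2 + 32 * D / \<eta> * \<tau>) * measure plane G + 32 * D / \<eta> * \<tau> powr (1 - 2 * q) * C"
    by (simp add: H_def \<mu>_def mult_ac)
qed

text \<open>Chebyshev's inequality for the kernel centred at \<open>a\<close>. This measures discs of the plane in
  logarithmic coordinates without discussing the periodicity of the argument.\<close>

lemma emeasure_polar_disc_le:
  assumes q: "0 < (q::real)" and s: "s > 0"
    and C: "proximity_bounded q C"
  shows "{p \<in> {xl..xl+1} \<times> {0..2*pi}. norm (polar p - a) < s * norm (polar p)} \<in> sets plane" (is "?S \<in> _")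
    and "emeasure plane {p \<in> {xl..xl+1} \<times> {0..2*pi}. norm (polar p - a) < s * norm (polar p)} \<le> ennreal (s powr (2 * q) * C)"
proof -
  define B where "B = {xl..xl+1} \<times> {0..2*pi}"
  have [measurable]: "B \<in> sets plane" unfolding B_def by measurable
  have Seq: "?S = B \<inter> {p \<in> space plane. norm (polar p - a) < s * norm (polar p)}"
    by (auto simp: B_def space_pair_measure)
  show S[measurable]: "?S \<in> sets plane" unfolding Seq by measurable
  \<comment> \<open>At \<open>polar p = a\<close> the quotient defining the kernel is 0, not infinite; this null set is split off.\<close>
  define N where "N = {ln (norm a)} \<times> {0..2*pi}"
  have [measurable]: "N \<in> sets plane" unfolding N_def by measurable
  have "emeasure plane ?S = (\<integral>\<^sup>+p. indicator ?S p \<partial>plane)" by simp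
  also have "\<dots> \<le> (\<integral>\<^sup>+p. indicator N p + ennreal (s powr (2 * q)) * (ennreal (proximity a p powr (2 * q)) * indicator B p) \<partial>plane)"
  proof (rule nn_integral_mono)
    fix p
    show "indicator ?S p \<le> indicator N p + ennreal (s powr (2 * q)) * (ennreal (proximity a p powr (2 * q)) * indicator B p)"
    proof (cases "p \<in> ?S")
      case True
      hence pB: "p \<in> B" by (simp add: B_def)
      show ?thesis
      proof (cases "polar p = a")
        case eq: True
        have "norm a = exp (fst p)" unfolding eq[symmetric] by (cases p) simp
        hence "p \<in> N" using pB by (cases p) (auto simp: N_def B_def)
        thus ?thesis using True by (simp add: add_increasing2)
      next
        case False
        hence pos: "norm (polar p - a) > 0" by simp
        have "1 \<le> s * proximity a p" using True pos by (simp add: proximity_def field_simps)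
        hence "1 \<le> (s * proximity a p) powr (2 * q)" using q by (simp add: ge_one_powr_ge_zero)
        also have "\<dots> = s powr (2 * q) * proximity a p powr (2 * q)" using s by (simp add: powr_mult)
        finally have "ennreal 1 \<le> ennreal (s powr (2 * q) * proximity a p powr (2 * q))" by (rule ennreal_leI)
        thus ?thesis using True pB by (simp add: ennreal_mult add_increasing)
      qed
    qed simp
  qed
  also have "\<dots> = emeasure plane N + ennreal (s powr (2 * q)) * (\<integral>\<^sup>+p\<in>B. ennreal (proximity a p powr (2 * q)) \<partial>plane)"
  proof -
    have "integral\<^sup>N plane (indicator N) = emeasure plane N" by (rule nn_integral_indicator) measurable
    thus ?thesis by (simp add: nn_integral_add nn_integral_cmult)
  qed
  also have "emeasure plane N = 0" unfolding N_def by (subst lborel.emeasure_pair_measure_Times) auto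
  also have "0 + ennreal (s powr (2 * q)) * (\<integral>\<^sup>+p\<in>B. ennreal (proximity a p powr (2 * q)) \<partial>plane) \<le> ennreal (s powr (2 * q)) * ennreal C"
    unfolding B_def add_0 by (intro mult_left_mono proximity_boundedD[OF C]) auto
  also have "\<dots> = ennreal (s powr (2 * q) * C)" by (simp add: ennreal_mult')
  finally show "emeasure plane ?S \<le> ennreal (s powr (2 * q) * C)" .
qed

text \<open>Points are chosen greedily: the discs around fewer than \<open>n\<close> points cannot cover \<open>G\<close>.\<close>

lemma separated_points:
  assumes q: "0 < (q::real)" and s: "s > 0" and C: "C > 0" 
    "proximity_bounded q C"
    and G: "G \<in> sets plane" "G \<subseteq> {xl..xl+1} \<times> {0..2*pi}" "real n * (s powr (2 * q) * C) < measure plane G"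
  shows "\<exists>ps :: nat \<Rightarrow> real \<times> real. \<forall>i\<le>n. ps i \<in> G \<and> (\<forall>j<i. s * norm (polar (ps i)) \<le> norm (polar (ps i) - polar (ps j)))"
proof -
  have "\<exists>ps :: nat \<Rightarrow> real \<times> real. \<forall>i<k. ps i \<in> G \<and> (\<forall>j<i. s * norm (polar (ps i)) \<le> norm (polar (ps i) - polar (ps j)))"
    if "k \<le> Suc n" for k
    using that
  proof (induction k)
    case 0 thus ?case by simp
  next
    case (Suc k)
    then obtain ps where ps: "\<forall>i<k. ps i \<in> G \<and> (\<forall>j<i. s * norm (polar (ps i)) \<le> norm (polar (ps i) - polar (ps j)))"
      by auto
    define S where "S = (\<lambda>j. {p \<in> {xl..xl+1} \<times> {0..2*pi}. norm (polar p - polar (ps j)) < s * norm (polar p)})"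
    note S = emeasure_polar_disc_le[OF q s C(2), folded S_def]
    have "emeasure plane (\<Union>j<k. S j) \<le> (\<Sum>j<k. emeasure plane (S j))"
      by (intro emeasure_subadditive_finite) (auto simp: S_def intro!: emeasure_polar_disc_le(1)[OF q s C(2)])
    also have "\<dots> \<le> (\<Sum>j<k. ennreal (s powr (2 * q) * C))"
      unfolding S_def by (intro sum_mono emeasure_polar_disc_le(2)[OF q s C(2)])
    also have "\<dots> = ennreal (real k * (s powr (2 * q) * C))"
      using C by (simp add: ennreal_mult ennreal_of_nat_eq_real_of_nat)
    also have "\<dots> < ennreal (measure plane G)"
    proof (rule ennreal_lessI)
      have "real k * (s powr (2 * q) * C) \<le> real n * (s powr (2 * q) * C)"
        using Suc.prems C by (intro mult_right_mono) auto
      thus "real k * (s powr (2 * q) * C) < measure plane G" using G(3) by linarith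
      have "0 \<le> real n * (s powr (2 * q) * C)" using C by simp
      thus "0 < measure plane G" using G(3) by linarith
    qed
    also have "\<dots> \<le> emeasure plane G" by (simp add: measure_def ennreal_enn2real_if)
    finally have less: "emeasure plane (\<Union>j<k. S j) < emeasure plane G" .
    have "\<not> G \<subseteq> (\<Union>j<k. S j)"
    proof
      assume "G \<subseteq> (\<Union>j<k. S j)"
      hence "emeasure plane G \<le> emeasure plane (\<Union>j<k. S j)"
        by (intro emeasure_mono) (auto simp: S_def intro!: emeasure_polar_disc_le(1)[OF q s C(2)])
      thus False using less by simp
    qed
    then obtain p where p: "p \<in> G" "\<And>j. j < k \<Longrightarrow> p \<notin> S j" by blast
    have "s * norm (polar p) \<le> norm (polar p - polar (ps j))" if "j < k" for j
      using p(2)[OF that] p(1) G(2) by (auto simp: S_def)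
    hence "\<forall>i<Suc k. (ps(k := p)) i \<in> G \<and> (\<forall>j<i. s * norm (polar ((ps(k := p)) i)) \<le> norm (polar ((ps(k := p)) i) - polar ((ps(k := p)) j)))"
      using ps p(1) by (auto simp: less_Suc_eq)
    thus ?case by blast
  qed
  from this[of "Suc n"] show ?thesis by (simp add: less_Suc_eq_le)
qed

section \<open>Maximum modulus, minimum modulus and growth\<close>

lemma max_modulus_attained:
  assumes "f holomorphic_on UNIV" "r \<ge> 0"
  obtains z where "norm z = r" "norm (f z) = max_modulus r f" "\<And>w. norm w = r \<Longrightarrow> norm (f w) \<le> max_modulus r f"
proof -
  have ne: "sphere (0::complex) r \<noteq> {}" using assms(2) by (simp add: sphere_eq_empty)
  have c: "continuous_on (sphere 0 r) (\<lambda>z. norm (f z))"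
    by (intro continuous_intros holomorphic_on_imp_continuous_on holomorphic_on_subset[OF assms(1)]) auto
  obtain z where z: "z \<in> sphere 0 r" "\<And>w. w \<in> sphere 0 r \<Longrightarrow> norm (f w) \<le> norm (f z)"
    using continuous_attains_sup[OF compact_sphere ne c] by blast
  have "max_modulus r f = norm (f z)"
    unfolding max_modulus_def using z by (intro cSup_eq_maximum) auto
  thus ?thesis using that[of z] z by simp
qed

lemma min_modulus_attained:
  assumes "f holomorphic_on UNIV" "r \<ge> 0"
  obtains z where "norm z = r" "norm (f z) = min_modulus r f"
proof -
  have ne: "sphere (0::complex) r \<noteq> {}" using assms(2) by (simp add: sphere_eq_empty)
  have c: "continuous_on (sphere 0 r) (\<lambda>z. norm (f z))"
    by (intro continuous_intros holomorphic_on_imp_continuous_on holomorphic_on_subset[OF assms(1)]) auto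
  obtain z where z: "z \<in> sphere 0 r" "\<And>w. w \<in> sphere 0 r \<Longrightarrow> norm (f z) \<le> norm (f w)"
    using continuous_attains_inf[OF compact_sphere ne c] by blast
  have "min_modulus r f = norm (f z)"
    unfolding min_modulus_def using z by (intro cInf_eq_minimum) auto
  thus ?thesis using that[of z] z by simp
qed

lemma powr_at_top:
  assumes "0 < (p::real)"
  shows "filterlim (\<lambda>x. x powr p) at_top at_top"
proof -
  have "filterlim (\<lambda>x. exp (p * ln x)) at_top at_top"
    using assms by (intro filterlim_compose[OF exp_at_top] filterlim_tendsto_pos_mult_at_top[OF tendsto_const _ ln_at_top])
  moreover have "\<forall>\<^sub>F x in at_top. exp (p * ln x) = x powr p"
    using eventually_gt_at_top[of 0] by eventually_elim (simp add: powr_def)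
  ultimately show ?thesis using filterlim_cong[OF refl refl] by fast
qed

lemma max_modulus_unbounded:
  assumes hol: "f holomorphic_on UNIV" and nc: "\<not> f constant_on UNIV"
  shows "\<forall>\<^sub>F r in at_top. max_modulus r f > Z"
proof -
  have "\<not> bounded (range f)" using Liouville_theorem[OF hol] nc by blast
  then obtain z where z: "norm (f z) > Z" unfolding bounded_iff by (auto simp: not_le)
  show ?thesis
    using eventually_ge_at_top[of "norm z"]
  proof eventually_elim
    case (elim r)
    have "r \<ge> 0" using elim norm_ge_zero[of z] by linarith
    then obtain w where "\<And>w. norm w = r \<Longrightarrow> norm (f w) \<le> max_modulus r f"
      using max_modulus_attained[OF hol] by blast
    hence "norm (f z) \<le> max_modulus r f" using entire_bound_cball[OF hol _ elim] by blast
    thus ?case using z by linarith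
  qed
qed

text \<open>The hypothesis on the upper limit in multiplicative form, where a circle through a zero of \<open>f\<close>
  simply has \<open>min_modulus r f = 0\<close> instead of the logarithm \<open>-\<infinity>\<close>.\<close>

locale small_minimum_modulus =
  fixes f :: "complex \<Rightarrow> complex" and c :: real
  assumes hol: "f holomorphic_on UNIV" and nonconst: "\<not> f constant_on UNIV"
    and c: "0 < c" "c < 1"
    and min_le: "\<forall>\<^sub>F r in at_top. min_modulus r f \<le> exp (c * ln (max_modulus r f))"
begin

definition logM :: "real \<Rightarrow> real" where "logM r = ln (max_modulus r f)"

lemma norm_le_max_modulus: "norm z \<le> r \<Longrightarrow> norm (f z) \<le> max_modulus r f"
proof -
  assume z: "norm z \<le> r"
  hence "r \<ge> 0" using norm_ge_zero[of z] by linarith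
  then obtain w where "\<And>w. norm w = r \<Longrightarrow> norm (f w) \<le> max_modulus r f"
    using max_modulus_attained[OF hol] by blast
  thus ?thesis using entire_bound_cball[OF hol _ z] by blast
qed

lemma max_modulus_mono: "0 \<le> r \<Longrightarrow> r \<le> r' \<Longrightarrow> max_modulus r f \<le> max_modulus r' f"
  by (metis max_modulus_attained[OF hol] norm_le_max_modulus)

lemma max_modulus_at_top: "filterlim (\<lambda>r. max_modulus r f) at_top at_top"
  unfolding filterlim_at_top_dense using max_modulus_unbounded[OF hol nonconst] by blast

lemma logM_at_top: "filterlim logM at_top at_top"
  unfolding logM_def by (rule filterlim_compose[OF ln_at_top max_modulus_at_top])

text \<open>From this radius on, the maximum modulus is at least \<open>exp 1\<close>, so that \<open>logM\<close> is an honest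
  logarithm at least 1, and the hypothesis on the minimum modulus holds.\<close>

definition radius0 :: real where
  "radius0 = (SOME r0. r0 \<ge> 1 \<and> (\<forall>r\<ge>r0. max_modulus r f \<ge> exp 1 \<and> min_modulus r f \<le> exp (c * ln (max_modulus r f))))"

lemma radius0:
  shows "radius0 \<ge> 1" "\<And>r. r \<ge> radius0 \<Longrightarrow> max_modulus r f \<ge> exp 1"
    "\<And>r. r \<ge> radius0 \<Longrightarrow> min_modulus r f \<le> exp (c * logM r)"
proof -
  have "\<forall>\<^sub>F r in at_top. max_modulus r f \<ge> exp 1 \<and> min_modulus r f \<le> exp (c * ln (max_modulus r f))"
  proof (rule eventually_conj[OF _ min_le])
    show "\<forall>\<^sub>F r in at_top. exp 1 \<le> max_modulus r f"
      using max_modulus_at_top unfolding filterlim_at_top by blast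
  qed
  then obtain N where "\<forall>r\<ge>N. max_modulus r f \<ge> exp 1 \<and> min_modulus r f \<le> exp (c * ln (max_modulus r f))"
    unfolding eventually_at_top_linorder by blast
  hence "max N 1 \<ge> 1 \<and> (\<forall>r\<ge>max N 1. max_modulus r f \<ge> exp 1 \<and> min_modulus r f \<le> exp (c * ln (max_modulus r f)))"
    by simp
  hence *: "radius0 \<ge> 1 \<and> (\<forall>r\<ge>radius0. max_modulus r f \<ge> exp 1 \<and> min_modulus r f \<le> exp (c * ln (max_modulus r f)))"
    unfolding radius0_def by (rule someI)
  show "radius0 \<ge> 1" using * by blast
  fix r assume "r \<ge> radius0"
  thus "max_modulus r f \<ge> exp 1" "min_modulus r f \<le> exp (c * logM r)" using * unfolding logM_def by blast+
qed

lemma max_modulus_exp: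
  assumes "r \<ge> radius0"
  shows "max_modulus r f = exp (logM r)"
  using less_le_trans[OF exp_gt_zero radius0(2)[OF assms]] by (simp add: logM_def)

lemma logM_ge_1: "r \<ge> radius0 \<Longrightarrow> logM r \<ge> 1"
  using radius0(2)[of r] max_modulus_exp[of r] by simp

lemma logM_mono: "radius0 \<le> r \<Longrightarrow> r \<le> r' \<Longrightarrow> logM r \<le> logM r'"
  using max_modulus_mono[of r r'] radius0(1) max_modulus_exp[of r] max_modulus_exp[of r'] by simp

lemma norm_le_exp_logM: "r \<ge> radius0 \<Longrightarrow> norm z \<le> r \<Longrightarrow> norm (f z) \<le> exp (logM r)"
  using norm_le_max_modulus max_modulus_exp by metis

lemma max_point: "r \<ge> radius0 \<Longrightarrow> \<exists>z. norm z = r \<and> norm (f z) = exp (logM r)"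
  using max_modulus_attained[OF hol, of r] max_modulus_exp[of r] radius0(1) by (metis order_trans zero_le_one)

lemma min_point: "r \<ge> radius0 \<Longrightarrow> \<exists>z. norm z = r \<and> norm (f z) \<le> exp (c * logM r)"
  using min_modulus_attained[OF hol, of r] radius0(3)[of r] radius0(1) by (metis order_trans zero_le_one)

text \<open>If \<open>logM (4 * r)\<close> were at most \<open>(1 + \<kappa>) * logM r\<close>, then \<open>ln (E / |f b|)\<close> in
  \<open>log_derivative_bound\<close>, with \<open>b\<close> a point where \<open>|f|\<close> is maximal on the circle of radius \<open>r\<close>, would be at most
  \<open>\<kappa> * logM r\<close>. The speed would then have integral at most a multiple of \<open>1 + \<kappa> * logM r\<close>, too small for the fall of
  \<open>log |f|\<close> from \<open>logM r\<close> to \<open>c * logM (4 * r)\<close> on all circles of radius between \<open>r\<close> and \<open>e * r\<close>.\<close>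

lemma growth_by_factor:
  obtains \<kappa> where "\<kappa> > 0" "\<forall>\<^sub>F r in at_top. logM (4 * r) \<ge> (1 + \<kappa>) * logM r"
proof -
  obtain C where C: "C > 0" "proximity_bounded (3/4) C"
    using proximity_integral_bound[of "3/4"] by auto
  define K where "K = 7 * 5376 + 256 * C"
  have K: "K > 0" using C by (simp add: K_def)
  define \<kappa> where "\<kappa> = min ((1 - c) / 2) ((1 - c) / (4 * K))"
  have \<kappa>: "\<kappa> > 0" "\<kappa> \<le> (1 - c) / 2" "K * \<kappa> \<le> (1 - c) / 4"
    using c K by (auto simp: \<kappa>_def min_def field_simps)
  have "logM (4 * r) \<ge> (1 + \<kappa>) * logM r" if r: "r \<ge> radius0" and Tr: "logM r > 4 * K / (1 - c)" for r
  proof (rule ccontr)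
    assume "\<not> logM (4 * r) \<ge> (1 + \<kappa>) * logM r"
    hence small: "logM (4 * r) < (1 + \<kappa>) * logM r" by simp
    have r1: "r \<ge> 1" using r radius0(1) by simp
    have T0: "logM r \<ge> 1" by (rule logM_ge_1[OF r])
    obtain b where b: "norm b = r" "norm (f b) = exp (logM r)" using max_point[OF r] by blast
    define D where "D = logM (4 * r) - logM r"
    have lnD: "ln (exp (logM (4 * r)) / norm (f b)) = D" using b by (simp add: D_def flip: exp_diff)
    have D: "0 \<le> D" "D \<le> \<kappa> * logM r" using logM_mono[OF r, of "4 * r"] r1 small by (auto simp: D_def algebra_simps)
    have lu: "c * logM (4 * r) \<le> logM r - (1 - c) / 2 * logM r"
    proof -
      have "c * logM (4 * r) \<le> c * ((1 + (1 - c) / 2) * logM r)"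
        using small \<kappa>(2) c T0 by (intro mult_left_mono order_trans[OF less_imp_le[OF small]] mult_right_mono) auto
      also have "c * ((1 + (1 - c) / 2) * logM r) \<le> (c + (1 - c) / 2) * logM r"
      proof -
        have "c * (1 + (1 - c) / 2) \<le> c + (1 - c) / 2" using mult_right_mono[of c 1 "(1 - c) / 2"] c by (simp add: algebra_simps)
        from mult_right_mono[OF this, of "logM r"] T0 show ?thesis by (simp add: mult.assoc)
      qed
      finally show ?thesis by (simp add: algebra_simps add_divide_distrib diff_divide_distrib)
    qed
    have e: "exp (ln r + 1) \<le> (1 - 2 * (1/8)) * (4 * r)"
      using exp_le r1 by (simp add: exp_add)
    have bdE: "norm (f z) \<le> exp (logM (4 * r))" if "norm z = 4 * r" for z
      using r r1 that by (intro norm_le_exp_logM) auto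
    have lu0: "c * logM (4 * r) \<le> logM r"
    proof -
      have "(1 - c) / 2 * logM r \<ge> 0" using c T0 by simp
      thus ?thesis using lu by linarith
    qed
    have rx: "r \<le> exp x" "exp x \<le> 4 * r" if x: "x \<in> {ln r..ln r + 1}" for x
    proof -
      have x1: "exp (ln r) \<le> exp x" and x2: "exp x \<le> exp (ln r + 1)" using x by auto
      have "exp (ln r + 1) \<le> 4 * r" using e r1 by simp
      from order_trans[OF x2 this] x1 show "r \<le> exp x" "exp x \<le> 4 * r" using r1 by auto
    qed
    have upx: "\<exists>z. norm z = exp x \<and> exp (logM r) \<le> norm (f z)" if x: "x \<in> {ln r..ln r + 1}" for x
    proof -
      have rx0: "radius0 \<le> exp x" using r rx(1)[OF x] by linarith
      obtain z where z: "norm z = exp x" "norm (f z) = exp (logM (exp x))" using max_point[OF rx0] by blast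
      have "logM r \<le> logM (exp x)" by (rule logM_mono[OF r rx(1)[OF x]])
      thus ?thesis using z by auto
    qed
    have lox: "\<exists>z. norm z = exp x \<and> norm (f z) \<le> exp (c * logM (4 * r))" if x: "x \<in> {ln r..ln r + 1}" for x
    proof -
      have rx0: "radius0 \<le> exp x" using r rx(1)[OF x] by linarith
      obtain z where z: "norm z = exp x" "norm (f z) \<le> exp (c * logM (exp x))" using min_point[OF rx0] by blast
      have "logM (exp x) \<le> logM (4 * r)" by (rule logM_mono[OF rx0 rx(2)[OF x]])
      hence "exp (c * logM (exp x)) \<le> exp (c * logM (4 * r))" using c by simp
      thus ?thesis using z(1) order_trans[OF z(2)] by blast
    qed
    let ?G = "{p \<in> {ln r..ln r+1} \<times> {0..2*pi}. exp (c * logM (4 * r)) \<le> norm (f (polar p)) \<and> 0 < log_speed f p}"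
    have "b \<in> {z. f z \<noteq> 0}" using b by auto
    hence fb: "f b \<noteq> 0" by simp
    note A = area_of_fast_region[where q = "3/4" and R = "4 * r" and E = "exp (logM (4 * r))" and up = "logM r" and lo = "c * logM (4 * r)"
      and \<eta> = "1/8" and w = 1 and xl = "ln r" and \<Lambda> = 0 and \<tau> = 1, OF hol _ _ C _ bdE _ _ _ fb _ _ e lu0 _ _ upx lox]
    have mG: "measure plane ?G \<le> 7 * 1"
      by (rule A(3)) (use r1 b in auto)
    have main: "(logM r - c * logM (4 * r)) * 1 \<le> 7 * 1 * 0 + (80 * (1 + ln (exp (logM (4 * r)) / norm (f b))) / (1/8)\<^sup>2 + 32 * ln (exp (logM (4 * r)) / norm (f b)) / (1/8) * 1) * measure plane ?G + 32 * ln (exp (logM (4 * r)) / norm (f b)) / (1/8) * 1 powr (1 - 2 * (3/4)) * C"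
      by (rule A(4)) (use r1 b in auto)
    have "logM r - c * logM (4 * r) \<le> (5120 * (1 + D) + 256 * D) * measure plane ?G + 256 * D * C"
      using main unfolding lnD by (simp add: power2_eq_square)
    also have "\<dots> \<le> (5120 * (1 + D) + 256 * D) * 7 + 256 * D * C"
      using mG D by (intro add_right_mono mult_left_mono) auto
    also have "\<dots> \<le> K * (1 + D)" using C D by (simp add: K_def algebra_simps)
    also have "\<dots> \<le> K + K * (\<kappa> * logM r)" using D K by (simp add: algebra_simps)
    also have "K * (\<kappa> * logM r) \<le> (1 - c) / 4 * logM r"
      using mult_right_mono[OF \<kappa>(3), of "logM r"] T0 by (simp add: mult.assoc)
    finally have "(1 - c) / 2 * logM r \<le> K + (1 - c) / 4 * logM r" using lu by linarith
    hence "(1 - c) / 4 * logM r \<le> K" unfolding times_divide_eq_left by linarith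
    hence "logM r \<le> 4 * K / (1 - c)" using c by (simp add: field_simps)
    thus False using Tr by simp
  qed
  note step = this
  have "\<forall>\<^sub>F r in at_top. logM r > 4 * K / (1 - c)"
    using logM_at_top by (simp add: filterlim_at_top_dense)
  hence "\<forall>\<^sub>F r in at_top. logM (4 * r) \<ge> (1 + \<kappa>) * logM r"
    using eventually_ge_at_top[of radius0] by eventually_elim (rule step)
  thus ?thesis using that \<kappa>(1) by blast
qed

lemma growth_exponent:
  obtains a where "0 < a" "\<forall>\<^sub>F s in at_top. s powr a \<le> logM s"
proof -
  obtain \<kappa> where \<kappa>: "\<kappa> > 0" "\<forall>\<^sub>F r in at_top. logM (4 * r) \<ge> (1 + \<kappa>) * logM r" using growth_by_factor .
  then obtain N where N: "\<And>r. r \<ge> N \<Longrightarrow> logM (4 * r) \<ge> (1 + \<kappa>) * logM r" unfolding eventually_at_top_linorder by blast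
  define r1 where "r1 = max N radius0"
  have r1: "r1 \<ge> radius0" "r1 \<ge> N" "r1 \<ge> 1" using radius0(1) by (auto simp: r1_def)
  have pow: "logM (4 ^ n * r1) \<ge> (1 + \<kappa>) ^ n" for n
  proof (induction n)
    case 0 thus ?case using logM_ge_1[OF r1(1)] by simp
  next
    case (Suc n)
    have "1 * r1 \<le> 4 ^ n * r1" using r1 by (intro mult_right_mono) auto
    hence "N \<le> 4 ^ n * r1" using r1 by linarith
    hence "logM (4 * (4 ^ n * r1)) \<ge> (1 + \<kappa>) * logM (4 ^ n * r1)" by (rule N)
    moreover have "(1 + \<kappa>) * logM (4 ^ n * r1) \<ge> (1 + \<kappa>) * (1 + \<kappa>) ^ n" using Suc \<kappa> by (intro mult_left_mono) auto
    ultimately show ?case by (simp add: mult.assoc)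
  qed
  define \<alpha> where "\<alpha> = ln (1 + \<kappa>) / ln 4"
  have \<alpha>: "\<alpha> > 0" using \<kappa> by (simp add: \<alpha>_def)
  have low: "logM s \<ge> (s / r1) powr \<alpha> / (1 + \<kappa>)" if s: "s \<ge> r1" for s
  proof -
    define u where "u = ln (s / r1) / ln 4"
    have u0: "u \<ge> 0" using s r1 by (simp add: u_def)
    define n where "n = nat \<lfloor>u\<rfloor>"
    have n: "real n \<le> u" "u \<le> real n + 1" using u0 by (auto simp: n_def)
    have "(4::real) ^ n = exp (real n * ln 4)" by (simp add: exp_of_nat_mult)
    also have "\<dots> \<le> exp (u * ln 4)" using n by simp
    also have "\<dots> = s / r1" using s r1 by (simp add: u_def)
    finally have "4 ^ n * r1 \<le> s" using r1 by (simp add: field_simps)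
    moreover have "radius0 \<le> 4 ^ n * r1"
    proof -
      have "1 * r1 \<le> 4 ^ n * r1" using r1 by (intro mult_right_mono) auto
      thus ?thesis using r1 by linarith
    qed
    ultimately have "logM (4 ^ n * r1) \<le> logM s" by (intro logM_mono) auto
    hence "(1 + \<kappa>) ^ n \<le> logM s" using pow[of n] by linarith
    moreover have "(s / r1) powr \<alpha> \<le> (1 + \<kappa>) * (1 + \<kappa>) ^ n"
    proof -
      have "(s / r1) powr \<alpha> = exp (u * ln (1 + \<kappa>))"
        using s r1 by (simp add: powr_def \<alpha>_def u_def)
      also have "\<dots> \<le> exp ((real n + 1) * ln (1 + \<kappa>))" using n \<kappa> by (simp add: mult_right_mono)
      also have "(real n + 1) * ln (1 + \<kappa>) = real (Suc n) * ln (1 + \<kappa>)" by simp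
      also have "exp \<dots> = (1 + \<kappa>) ^ Suc n" using \<kappa> by (simp only: exp_of_nat_mult) (simp add: exp_ln)
      finally show ?thesis by simp
    qed
    ultimately have "(s / r1) powr \<alpha> \<le> (1 + \<kappa>) * logM s" using \<kappa> by (meson add_nonneg_nonneg less_imp_le mult_left_mono order_trans zero_le_one)
    thus ?thesis using \<kappa> by (simp add: field_simps)
  qed
  have "\<forall>\<^sub>F s in at_top. r1 powr \<alpha> * (1 + \<kappa>) \<le> s powr (\<alpha> / 2)"
  proof -
    have "filterlim (\<lambda>s::real. s powr (\<alpha> / 2)) at_top at_top"
      using \<alpha> by (intro powr_at_top) auto
    thus ?thesis by (simp add: filterlim_at_top)
  qed
  hence "\<forall>\<^sub>F s in at_top. s powr (\<alpha> / 2) \<le> logM s"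
    using eventually_ge_at_top[of r1]
  proof eventually_elim
    case (elim s)
    have "s powr (\<alpha> / 2) * (r1 powr \<alpha> * (1 + \<kappa>)) \<le> s powr (\<alpha> / 2) * s powr (\<alpha> / 2)"
      using elim by (intro mult_left_mono) auto
    also have "\<dots> = s powr \<alpha>" by (simp flip: powr_add)
    also have "\<dots> = (s / r1) powr \<alpha> * r1 powr \<alpha>" using elim r1 by (simp add: powr_divide)
    also have "\<dots> \<le> ((1 + \<kappa>) * logM s) * r1 powr \<alpha>"
      using low[OF elim(2)] \<kappa> by (intro mult_right_mono) (auto simp: field_simps)
    finally have "s powr (\<alpha> / 2) * (r1 powr \<alpha> * (1 + \<kappa>)) \<le> logM s * (r1 powr \<alpha> * (1 + \<kappa>))" by (simp add: mult_ac)
    thus ?case using r1 \<kappa> by (simp add: mult_le_cancel_right)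
  qed
  thus ?thesis using that[of "\<alpha> / 2"] \<alpha> by simp
qed

end

section \<open>Covering of annuli and radii of regular growth\<close>

definition annulus :: "real \<Rightarrow> real \<Rightarrow> complex set" where
  "annulus K s = {z. s \<le> norm z \<and> norm z \<le> K * s}"

lemma closed_annulus: "closed (annulus K s)"
proof -
  have "annulus K s = {z. s \<le> norm z} \<inter> {z. norm z \<le> K * s}" by (auto simp: annulus_def)
  thus ?thesis by (auto intro!: closed_Int closed_Collect_le continuous_intros)
qed

lemma compact_annulus: "compact (annulus K s)"
proof -
  have "annulus K s \<subseteq> cball 0 (K * s)" by (auto simp: annulus_def)
  hence "bounded (annulus K s)" using bounded_cball bounded_subset by blast
  thus ?thesis using closed_annulus by (simp add: compact_eq_bounded_closed)
qed

lemma annulus_nonempty: "K \<ge> 1 \<Longrightarrow> s \<ge> 0 \<Longrightarrow> of_real s \<in> annulus K s"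
  by (simp add: annulus_def mult_le_cancel_right1)

text \<open>The constant \<open>B\<close> depends on \<open>K\<close> only, not on the function.\<close>

definition expansion_covers :: "real \<Rightarrow> real \<Rightarrow> bool" where
  "expansion_covers K B \<longleftrightarrow>
    (\<forall>F \<zeta> d. F holomorphic_on UNIV \<longrightarrow> d > 0 \<longrightarrow> F \<zeta> \<noteq> 0 \<longrightarrow> B * norm (F \<zeta>) \<le> d * norm (deriv F \<zeta>) \<longrightarrow>
      (\<exists>\<rho>\<ge>norm (F \<zeta>). annulus K \<rho> \<subseteq> F ` cball \<zeta> d))"

text \<open>If the image missed a point \<open>a\<close> of \<open>annulus K \<rho>\<close> and a point \<open>b\<close> of \<open>annulus K (2 * K * \<rho>)\<close>, where
  \<open>\<rho> = |F \<zeta>|\<close>, then \<open>(F - a) / (b - a)\<close> would omit 0 and 1 and be at most 2 in absolute value at \<open>\<zeta>\<close>. Schottky's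
  theorem and Cauchy's estimate would bound the derivative. So one of the two annuli is covered.\<close>

lemma schottky_covering:
  fixes K :: real
  assumes K: "K \<ge> 1"
  obtains B where "B \<ge> 1" "expansion_covers K B"
proof -
  \<comment> \<open>Schottky's bound on the half disc for functions of absolute value at most 2 at the centre.\<close>
  define C1 where "C1 = exp (pi * exp (pi * (2 + 2 * 2 + 12 * (1/2) / (1 - 1/2))))"
  have C1: "C1 \<ge> 1" by (simp add: C1_def)
  define B where "B = 6 * K\<^sup>2 * C1 + 1"
  have B: "B \<ge> 1" using C1 by (simp add: B_def)
  have "\<exists>\<rho>\<ge>norm (F \<zeta>). annulus K \<rho> \<subseteq> F ` cball \<zeta> d"
    if hol: "F holomorphic_on UNIV" and d: "d > 0" and nz: "F \<zeta> \<noteq> 0" and big: "B * norm (F \<zeta>) \<le> d * norm (deriv F \<zeta>)" for F \<zeta> d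
  proof (rule ccontr)
    assume contra: "\<not> ?thesis"
    define \<rho> where "\<rho> = norm (F \<zeta>)"
    have \<rho>: "\<rho> > 0" using nz by (simp add: \<rho>_def)
    have "1 * \<rho> \<le> (2 * K) * \<rho>" using K \<rho> by (intro mult_right_mono) auto
    hence "\<not> annulus K \<rho> \<subseteq> F ` cball \<zeta> d" "\<not> annulus K (2 * K * \<rho>) \<subseteq> F ` cball \<zeta> d"
      using contra unfolding \<rho>_def by auto
    then obtain a b where a: "a \<in> annulus K \<rho>" "a \<notin> F ` cball \<zeta> d" and b: "b \<in> annulus K (2 * K * \<rho>)" "b \<notin> F ` cball \<zeta> d"
      by blast
    have na: "\<rho> \<le> norm a" "norm a \<le> K * \<rho>" and nb: "2 * (K * \<rho>) \<le> norm b" "norm b \<le> 2 * (K\<^sup>2 * \<rho>)"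
      using a(1) b(1) by (auto simp: annulus_def power2_eq_square mult_ac)
    have KK: "K * \<rho> \<le> K\<^sup>2 * \<rho>" using K \<rho> mult_right_mono[of 1 K "K * \<rho>"] by (simp add: power2_eq_square mult.assoc)
    have K\<rho>: "\<rho> \<le> K * \<rho>" using K \<rho> by simp
    have ba1: "K * \<rho> \<le> norm (b - a)" using norm_triangle_ineq2[of b a] na nb by linarith
    have ba2: "norm (b - a) \<le> 3 * (K\<^sup>2 * \<rho>)" using norm_triangle_ineq4[of b a] na nb KK by linarith
    have "norm (b - a) > 0" using ba1 K\<rho> \<rho> by linarith
    hence ban: "b - a \<noteq> 0" by simp
    define \<phi> where "\<phi> = (\<lambda>w::complex. (F (\<zeta> + d * w) - a) / (b - a))"
    have hol\<phi>: "\<phi> holomorphic_on UNIV"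
      unfolding \<phi>_def using ban
      by (intro holomorphic_intros holomorphic_on_compose_gen[OF _ hol, unfolded o_def]) auto
    have \<phi>0: "norm (\<phi> 0) \<le> 2"
    proof -
      have "norm (F \<zeta> - a) \<le> 2 * (K * \<rho>)" using norm_triangle_ineq4[of "F \<zeta>" a] na K\<rho> by (simp add: \<rho>_def)
      also have "\<dots> \<le> 2 * norm (b - a)" using ba1 by simp
      finally show ?thesis using ban by (simp add: \<phi>_def norm_divide divide_le_eq)
    qed
    have omit: "\<not> (\<phi> w = 0 \<or> \<phi> w = 1)" if "w \<in> cball 0 1" for w
    proof -
      have "norm (d * w) \<le> d" using that d by (simp add: norm_mult mult_left_le)
      hence "F (\<zeta> + d * w) \<in> F ` cball \<zeta> d" by (intro imageI) (simp add: dist_norm)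
      hence "F (\<zeta> + d * w) \<noteq> a" "F (\<zeta> + d * w) \<noteq> b" using a(2) b(2) by metis+
      thus ?thesis using ban by (auto simp: \<phi>_def)
    qed
    have bd: "norm (\<phi> w) \<le> C1" if "norm w \<le> 1/2" for w
      unfolding C1_def
      by (rule Schottky[OF holomorphic_on_subset[OF hol\<phi>] \<phi>0 omit]) (use that in auto)
    have "norm ((deriv ^^ 1) \<phi> 0) \<le> fact 1 * C1 / (1/2) ^ 1"
    proof (rule Cauchy_inequality)
      show "\<phi> holomorphic_on ball 0 (1/2)" by (rule holomorphic_on_subset[OF hol\<phi>]) auto
      show "continuous_on (cball 0 (1/2)) \<phi>"
        by (intro holomorphic_on_imp_continuous_on holomorphic_on_subset[OF hol\<phi>]) auto
      fix x :: complex assume "norm (0 - x) = 1/2"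
      thus "norm (\<phi> x) \<le> C1" by (intro bd) simp
    qed auto
    hence d1: "norm (deriv \<phi> 0) \<le> 2 * C1" by simp
    have dF: "(F has_field_derivative deriv F (\<zeta> + of_real d * 0)) (at (\<zeta> + of_real d * 0))" using hol holomorphic_derivI by blast
    have lin: "((\<lambda>w::complex. \<zeta> + d * w) has_field_derivative (of_real d)) (at 0)"
      by (auto intro!: derivative_eq_intros)
    have "(\<phi> has_field_derivative (deriv F (\<zeta> + of_real d * 0) * d - 0) / (b - a)) (at 0)"
      unfolding \<phi>_def by (intro DERIV_cdivide DERIV_diff DERIV_const DERIV_chain2[OF dF lin])
    hence "deriv \<phi> 0 = deriv F \<zeta> * d / (b - a)" by (auto dest: DERIV_imp_deriv)
    hence "norm (deriv \<phi> 0) = d * norm (deriv F \<zeta>) / norm (b - a)" using d by (simp add: norm_mult norm_divide)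
    hence "d * norm (deriv F \<zeta>) \<le> 2 * C1 * norm (b - a)" using d1 ban by (simp add: divide_le_eq)
    also have "\<dots> \<le> 2 * C1 * (3 * (K\<^sup>2 * \<rho>))" using ba2 C1 by (intro mult_left_mono) auto
    also have "\<dots> = (B - 1) * \<rho>" by (simp add: B_def)
    finally have "B * \<rho> \<le> (B - 1) * \<rho>" using big by (simp add: \<rho>_def)
    thus False using \<rho> by (simp add: algebra_simps)
  qed
  hence "expansion_covers K B" unfolding expansion_covers_def by blast
  thus ?thesis using that B by blast
qed

context small_minimum_modulus
begin

text \<open>A growth lemma of Borel type. If all radii in \<open>{s..2 * s}\<close> failed, iterating
  \<open>r \<mapsto> r * (1 + 6 * logM r powr - e)\<close> from \<open>s\<close> would multiply \<open>logM\<close> by \<open>1 + \<kappa>\<close> at each step while the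
  radii stay below \<open>2 * s\<close>, because the increments decrease geometrically.\<close>

lemma regular_radius:
  assumes \<kappa>: "\<kappa> > 0" and e: "e > 0"
  shows "\<forall>\<^sub>F s in at_top. \<exists>r. s \<le> r \<and> r \<le> 2 * s \<and> logM (r * (1 + 6 * logM r powr - e)) \<le> (1 + \<kappa>) * logM r"
proof -
  \<comment> \<open>The ratio that bounds the relative increments of successive radii.\<close>
  define \<rho> where "\<rho> = (1 + \<kappa>) powr - e"
  have \<rho>: "0 < \<rho>" "\<rho> < 1" using \<kappa> e by (auto simp: \<rho>_def powr_less_one)
  have "filterlim (\<lambda>s. logM s powr e) at_top at_top"
    using filterlim_compose[OF powr_at_top[OF e] logM_at_top] .
  hence "\<forall>\<^sub>F s in at_top. logM s powr e \<ge> 6 / ((1 - \<rho>) * ln 2)" by (simp add: filterlim_at_top)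
  thus ?thesis using eventually_ge_at_top[of radius0]
  proof eventually_elim
    case (elim s)
    have s1: "s \<ge> 1" using elim radius0(1) by simp
    have Ts: "logM s \<ge> 1" using elim logM_ge_1 by simp
    define \<tau> where "\<tau> = logM s powr - e"
    have \<tau>: "\<tau> > 0" using Ts by (simp add: \<tau>_def)
    have \<tau>6: "6 * \<tau> / (1 - \<rho>) \<le> ln 2"
    proof -
      have "6 / ((1 - \<rho>) * ln 2) \<le> 1 / \<tau>" using elim(1) by (simp add: \<tau>_def powr_minus_divide)
      thus ?thesis using \<rho> \<tau> by (simp add: field_simps)
    qed
    show ?case
    proof (rule ccontr)
      assume "\<not> ?thesis"
      hence grow: "logM (r * (1 + 6 * logM r powr - e)) > (1 + \<kappa>) * logM r" if "s \<le> r" "r \<le> 2 * s" for r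
        using that by (metis not_le)
      define g where "g = (\<lambda>r. r * (1 + 6 * logM r powr - e))"
      have inv: "s \<le> (g ^^ j) s \<and> (g ^^ j) s \<le> s * exp (6 * \<tau> * (\<Sum>i<j. \<rho> ^ i)) \<and> (1 + \<kappa>) ^ j * logM s \<le> logM ((g ^^ j) s)
          \<and> (g ^^ j) s \<le> 2 * s" for j
      proof (induction j)
        case 0 thus ?case using s1 by simp
      next
        case (Suc j)
        define r where "r = (g ^^ j) s"
        have r: "s \<le> r" "r \<le> s * exp (6 * \<tau> * (\<Sum>i<j. \<rho> ^ i))" "(1 + \<kappa>) ^ j * logM s \<le> logM r" "r \<le> 2 * s"
          using Suc by (auto simp: r_def)
        have nxt: "(g ^^ Suc j) s = r * (1 + 6 * logM r powr - e)" by (simp add: r_def g_def)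
        have p0: "logM r powr - e \<ge> 0" by simp
        have "logM r powr - e \<le> ((1 + \<kappa>) ^ j * logM s) powr - e"
          using r(3) \<kappa> e Ts by (intro powr_mono2') auto
        also have "\<dots> = \<rho> ^ j * \<tau>"
          using \<kappa> Ts by (simp add: powr_mult \<rho>_def \<tau>_def powr_power powr_realpow[symmetric] powr_powr mult.commute)
        finally have Tr: "logM r powr - e \<le> \<rho> ^ j * \<tau>" .
        have "r * (1 + 6 * logM r powr - e) \<le> s * exp (6 * \<tau> * (\<Sum>i<j. \<rho> ^ i)) * exp (6 * (\<rho> ^ j * \<tau>))"
        proof (intro mult_mono r(2))
          have "1 + 6 * logM r powr - e \<le> 1 + 6 * (\<rho> ^ j * \<tau>)" using Tr by simp
          also have "\<dots> \<le> exp (6 * (\<rho> ^ j * \<tau>))" by (rule exp_ge_add_one_self)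
          finally show "1 + 6 * logM r powr - e \<le> exp (6 * (\<rho> ^ j * \<tau>))" .
        qed (use s1 p0 in auto)
        also have "\<dots> = s * exp (6 * \<tau> * (\<Sum>i<Suc j. \<rho> ^ i))"
          by (simp add: exp_add[symmetric] algebra_simps)
        finally have up: "(g ^^ Suc j) s \<le> s * exp (6 * \<tau> * (\<Sum>i<Suc j. \<rho> ^ i))" using nxt by simp
        have "(\<Sum>i<Suc j. \<rho> ^ i) \<le> 1 / (1 - \<rho>)"
          using \<rho> by (simp only: sum_gp_strict) (auto simp: divide_right_mono)
        hence "6 * \<tau> * (\<Sum>i<Suc j. \<rho> ^ i) \<le> 6 * \<tau> * (1 / (1 - \<rho>))" using \<tau> by (intro mult_left_mono) auto
        hence "6 * \<tau> * (\<Sum>i<Suc j. \<rho> ^ i) \<le> ln 2" using \<tau>6 by simp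
        hence "exp (6 * \<tau> * (\<Sum>i<Suc j. \<rho> ^ i)) \<le> exp (ln 2)" by (subst exp_le_cancel_iff)
        hence "s * exp (6 * \<tau> * (\<Sum>i<Suc j. \<rho> ^ i)) \<le> s * 2" using s1 by (intro mult_left_mono) auto
        hence up2: "(g ^^ Suc j) s \<le> 2 * s" using up by linarith
        have "r * 1 \<le> r * (1 + 6 * logM r powr - e)" using r(1) s1 p0 by (intro mult_left_mono) auto
        hence lowr: "s \<le> (g ^^ Suc j) s" using r(1) nxt by linarith
        have "(1 + \<kappa>) * ((1 + \<kappa>) ^ j * logM s) \<le> (1 + \<kappa>) * logM r" using r(3) \<kappa> by (intro mult_left_mono) auto
        also have "\<dots> \<le> logM ((g ^^ Suc j) s)" using grow[OF r(1,4)] nxt by simp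
        finally have "(1 + \<kappa>) ^ Suc j * logM s \<le> logM ((g ^^ Suc j) s)" by (simp add: mult.assoc)
        thus ?case using up up2 lowr by blast
      qed
      obtain j where j: "logM (2 * s) < (1 + \<kappa>) ^ j" using real_arch_pow[of "1 + \<kappa>"] \<kappa> by auto
      have "(1 + \<kappa>) ^ j * 1 \<le> (1 + \<kappa>) ^ j * logM s" using Ts \<kappa> by (intro mult_left_mono) auto
      also have "\<dots> \<le> logM ((g ^^ j) s)" using inv by blast
      also have "\<dots> \<le> logM (2 * s)" using inv[of j] elim(2) by (intro logM_mono) auto
      finally show False using j by simp
    qed
  qed
qed

end

section \<open>Many small discs mapped onto annuli\<close>

lemma norm_exp_diff_le:
  fixes \<zeta> \<xi> :: complex
  assumes "norm (\<zeta> - \<xi>) \<le> 1/2"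
  shows "norm (exp \<zeta> - exp \<xi>) \<le> 2 * norm (\<zeta> - \<xi>) * norm (exp \<xi>)"
proof -
  have "exp \<zeta> - exp \<xi> = exp \<xi> * (exp (\<zeta> - \<xi>) - 1)" by (simp add: exp_diff algebra_simps)
  hence "norm (exp \<zeta> - exp \<xi>) = norm (exp \<xi>) * norm (exp (\<zeta> - \<xi>) - 1)" by (simp add: norm_mult)
  also have "\<dots> \<le> norm (exp \<xi>) * (3/2 * norm (\<zeta> - \<xi>))"
    by (intro mult_left_mono norm_exp_bounds(2) assms) auto
  also have "\<dots> \<le> norm (exp \<xi>) * (2 * norm (\<zeta> - \<xi>))"
    by (intro mult_left_mono) auto
  finally show ?thesis by (simp add: mult_ac)
qed

context small_minimum_modulus
begin

lemma derivative_le: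
  assumes R: "R \<ge> radius0" and \<eta>: "0 < \<eta>" and z: "norm z \<le> (1 - \<eta>) * R"
  shows "norm (deriv f z) \<le> exp (logM R) / (\<eta> * R)"
proof -
  have R0: "R > 0" using R radius0(1) by linarith
  have "norm ((deriv ^^ 1) f z) \<le> fact 1 * exp (logM R) / (\<eta> * R) ^ 1"
  proof (rule Cauchy_inequality)
    show "f holomorphic_on ball z (\<eta> * R)" by (rule holomorphic_on_subset[OF hol]) auto
    show "continuous_on (cball z (\<eta> * R)) f"
      by (intro holomorphic_on_imp_continuous_on holomorphic_on_subset[OF hol]) auto
    show "0 < \<eta> * R" using \<eta> R0 by simp
    fix x assume x: "norm (z - x) = \<eta> * R"
    have "norm x \<le> norm z + norm (z - x)" using norm_triangle_ineq4[of z "z - x"] by simp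
    also have "\<dots> \<le> R" using x z by (simp add: algebra_simps)
    finally show "norm (f x) \<le> exp (logM R)" by (rule norm_le_exp_logM[OF R])
  qed
  thus ?thesis by simp
qed

text \<open>At a radius of regular growth the loss \<open>1/\<eta>\<close> is only \<open>t powr e\<close>, and
  \<open>ln (E / |f b|) \<le> 2 * t\<close> for a fixed base point \<open>b\<close>. With the speed level \<open>t powr (1/2)\<close> and the kernel level
  \<open>t powr (6 * e)\<close>, the first and the last term of \<open>area_of_fast_region\<close> absorb at most half of the variation
  \<open>\<kappa> * t * \<eta>\<close>; the rest must come from the area of \<open>G\<close>. Because \<open>lo\<close> is \<open>(1 - \<kappa>) * t\<close> and not \<open>c * t\<close>, the values of
  \<open>|f|\<close> on \<open>G\<close> lie in a narrow logarithmic range below \<open>M R\<close>.\<close>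

lemma fast_region_large:
  fixes e :: real
  assumes e: "0 < e" "e \<le> 1/26" and \<kappa>: "0 < \<kappa>" "\<kappa> \<le> (1 - c) / 2"
    and C: "C > 0" "proximity_bounded (1 - e) C"
    and r: "r \<ge> 2 * radius0" and t: "t = logM r" and \<eta>: "\<eta> = t powr - e" and R: "R = r * (1 + 6 * \<eta>)"
    and reg: "logM R \<le> (1 + \<kappa>) * t"
    and Z: "20 \<le> t powr e" "28 / \<kappa> \<le> t powr e" "256 * C / \<kappa> \<le> t powr e" "608 / \<kappa> \<le> t powr e"
  defines "G \<equiv> {p \<in> {ln r..ln r + \<eta>} \<times> {0..2*pi}. exp ((1 - \<kappa>) * t) \<le> norm (f (polar p)) \<and> t powr (1/2) < log_speed f p}"
  shows "G \<in> sets plane" "t powr (- 9 * e) \<le> measure plane G"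
proof -
  have rr: "r \<ge> radius0" and r2: "r \<ge> 2" and r0: "r > 0" using r radius0(1) by linarith+
  have t1: "t \<ge> 1" unfolding t by (rule logM_ge_1[OF rr])
  have \<eta>0: "\<eta> > 0" unfolding \<eta> using t1 by simp
  have \<eta>i: "\<eta> * t powr e = 1" unfolding \<eta> using t1 by (simp flip: powr_add)
  have \<eta>20: "\<eta> \<le> 1/20"
  proof -
    have "\<eta> * 20 \<le> \<eta> * t powr e" using Z(1) \<eta>0 by (intro mult_left_mono) auto
    thus ?thesis using \<eta>i by simp
  qed
  have Rr: "R \<ge> r" unfolding R using r0 \<eta>0 by (simp add: mult_le_cancel_left1)
  have R0: "R \<ge> radius0" "R > 0" using Rr rr r0 by auto
  obtain b where b: "norm b = radius0" "norm (f b) = exp (logM radius0)" using max_point[of radius0] by blast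
  have fb1: "norm (f b) \<ge> 1" unfolding b(2) using logM_ge_1[of radius0] by simp
  hence fb: "f b \<noteq> 0" by auto
  define E where "E = exp (logM R)"
  define D where "D = ln (E / norm (f b))"
  have bdE: "norm (f z) \<le> E" if "norm z = R" for z
    unfolding E_def using that R0 by (intro norm_le_exp_logM) auto
  have D2: "D \<le> 2 * t"
  proof -
    have "D = logM R - logM radius0" unfolding D_def E_def b(2) by (simp flip: exp_diff)
    moreover have "logM radius0 \<ge> 1" by (rule logM_ge_1) simp
    moreover have "\<kappa> * t \<le> 1 * t" using \<kappa> c t1 by (intro mult_right_mono) auto
    ultimately show ?thesis using reg by (simp add: algebra_simps)
  qed
  have \<eta>sq: "\<eta>\<^sup>2 * 20 \<le> \<eta>" unfolding power2_eq_square using mult_left_mono[OF \<eta>20, of "\<eta> * 20"] \<eta>0 by simp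
  have xw: "exp (ln r + \<eta>) \<le> (1 - 2 * \<eta>) * R"
  proof -
    have "exp \<eta> \<le> 1 + \<eta> + \<eta>\<^sup>2" using \<eta>0 \<eta>20 by (intro exp_bound) auto
    also have "\<dots> \<le> (1 - 2 * \<eta>) * (1 + 6 * \<eta>)" using \<eta>sq \<eta>0 by (simp add: algebra_simps power2_eq_square)
    finally have "r * exp \<eta> \<le> r * ((1 - 2 * \<eta>) * (1 + 6 * \<eta>))" using r0 by (intro mult_left_mono) auto
    thus ?thesis using r0 by (simp add: exp_add R mult_ac)
  qed
  have lu: "(1 - \<kappa>) * t \<le> t" using \<kappa> t1 by (simp add: mult_left_le_one_le)
  have rx: "r \<le> exp x" "exp x \<le> R" if x: "x \<in> {ln r..ln r + \<eta>}" for x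
  proof -
    have x1: "exp (ln r) \<le> exp x" and x2: "exp x \<le> exp (ln r + \<eta>)" using x by auto
    have "(1 - 2 * \<eta>) * R \<le> 1 * R" using \<eta>0 R0 by (intro mult_right_mono) auto
    thus "r \<le> exp x" "exp x \<le> R" using x1 order_trans[OF x2 xw] r0 by auto
  qed
  have upx: "\<exists>z. norm z = exp x \<and> exp t \<le> norm (f z)" if x: "x \<in> {ln r..ln r + \<eta>}" for x
  proof -
    have rx0: "radius0 \<le> exp x" using rr rx(1)[OF x] by linarith
    obtain z where z: "norm z = exp x" "norm (f z) = exp (logM (exp x))" using max_point[OF rx0] by blast
    have "logM r \<le> logM (exp x)" by (rule logM_mono[OF rr rx(1)[OF x]])
    thus ?thesis using z t by auto
  qed
  have lox: "\<exists>z. norm z = exp x \<and> norm (f z) \<le> exp ((1 - \<kappa>) * t)" if x: "x \<in> {ln r..ln r + \<eta>}" for x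
  proof -
    have rx0: "radius0 \<le> exp x" using rr rx(1)[OF x] by linarith
    obtain z where z: "norm z = exp x" "norm (f z) \<le> exp (c * logM (exp x))" using min_point[OF rx0] by blast
    have "logM (exp x) \<le> logM R" by (rule logM_mono[OF rx0 rx(2)[OF x]])
    hence "c * logM (exp x) \<le> c * ((1 + \<kappa>) * t)" using c reg by (intro mult_left_mono) auto
    also have "\<dots> \<le> (1 - \<kappa>) * t"
    proof -
      have "c * \<kappa> \<le> \<kappa>" using c \<kappa> by (intro mult_left_le_one_le) auto
      have "c * (1 + \<kappa>) = c + c * \<kappa>" by (simp add: algebra_simps)
      also have "\<dots> \<le> c + \<kappa>" using \<open>c * \<kappa> \<le> \<kappa>\<close> by (rule add_left_mono)
      also have "\<dots> \<le> 1 - \<kappa>" using \<kappa>(2) by (simp add: field_simps)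
      finally have "c * (1 + \<kappa>) \<le> 1 - \<kappa>" .
      from mult_right_mono[OF this, of t] t1 show ?thesis by (simp add: mult.assoc)
    qed
    finally have "exp (c * logM (exp x)) \<le> exp ((1 - \<kappa>) * t)" by simp
    thus ?thesis using z(1) order_trans[OF z(2)] by blast
  qed
  have bR: "norm b \<le> R / 2" using b r Rr by simp
  have q1: "1/2 < 1 - e" and q2: "1 - e < 1" and \<eta>4: "\<eta> \<le> 1/4" and \<eta>1: "\<eta> \<le> 1" and \<Lambda>0: "t powr (1/2) \<ge> 0"
    and \<tau>0: "t powr (6 * e) > 0" using e \<eta>20 t1 by auto
  note A = area_of_fast_region[where q = "1 - e", OF hol q1 q2 C R0(2) bdE \<eta>0 \<eta>4 bR fb \<eta>0 \<eta>1 xw lu \<Lambda>0 \<tau>0 upx lox, folded G_def, folded D_def]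
  show Gm: "G \<in> sets plane" by (rule A(1))
  define m where "m = measure plane G"
  have m0: "m \<ge> 0" by (simp add: m_def)
  have main: "(t - (1 - \<kappa>) * t) * \<eta> \<le> 7 * \<eta> * t powr (1/2) +
      (80 * (1 + D) / \<eta>\<^sup>2 + 32 * D / \<eta> * t powr (6 * e)) * m +
      32 * D / \<eta> * (t powr (6 * e)) powr (1 - 2 * (1 - e)) * C"
    using A(4) by (simp add: m_def)
  have p\<eta>: "1 / \<eta> = t powr e" using \<eta>i \<eta>0 by (simp add: field_simps)
  have "1 / \<eta>\<^sup>2 = 1 / \<eta> * (1 / \<eta>)" by (simp add: power2_eq_square)
  hence p\<eta>2: "1 / \<eta>\<^sup>2 = t powr (2 * e)" unfolding p\<eta> by (simp flip: powr_add)
  have term1: "7 * \<eta> * t powr (1/2) \<le> \<kappa> * t * \<eta> / 4"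
  proof -
    have "28 / \<kappa> \<le> t powr (1/2)" using Z(2) t1 e by (intro order_trans[OF Z(2)] powr_mono) auto
    hence "28 \<le> \<kappa> * t powr (1/2)" using \<kappa> by (simp add: field_simps)
    hence "28 * (\<eta> * t powr (1/2)) \<le> \<kappa> * t powr (1/2) * (\<eta> * t powr (1/2))"
      using \<eta>0 by (intro mult_right_mono) auto
    also have "\<dots> = \<kappa> * \<eta> * (t powr (1/2) * t powr (1/2))" by simp
    also have "t powr (1/2) * t powr (1/2) = t" using t1 by (simp flip: powr_add)
    finally show ?thesis by (simp add: mult_ac)
  qed
  have term3: "32 * D / \<eta> * (t powr (6 * e)) powr (1 - 2 * (1 - e)) * C \<le> \<kappa> * t * \<eta> / 4"
  proof -
    have "(t powr (6 * e)) powr (1 - 2 * (1 - e)) = t powr (6 * e * (1 - 2 * (1 - e)))" by (simp add: powr_powr)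
    also have "\<dots> \<le> t powr (- 3 * e)"
    proof (rule powr_mono)
      have "e * (1 - 2 * (1 - e)) \<le> e * (- 1/2)" using e by (intro mult_left_mono) auto
      thus "6 * e * (1 - 2 * (1 - e)) \<le> - 3 * e" by simp
    qed (rule t1)
    finally have a: "(t powr (6 * e)) powr (1 - 2 * (1 - e)) \<le> t powr (- 3 * e)" .
    have "32 * D / \<eta> * (t powr (6 * e)) powr (1 - 2 * (1 - e)) * C \<le> 64 * t / \<eta> * t powr (- 3 * e) * C"
    proof -
      have h: "32 * D / \<eta> \<le> 64 * t / \<eta>" using D2 \<eta>0 by (intro divide_right_mono) auto
      have "64 * t / \<eta> \<ge> 0" using t1 \<eta>0 by simp
      thus ?thesis using C(1) by (intro mult_right_mono mult_mono[OF h a]) auto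
    qed
    also have "64 * t / \<eta> * t powr (- 3 * e) * C = 64 * t * C * (t powr e * t powr (- 3 * e))"
      unfolding p\<eta>[symmetric] by (simp add: mult_ac)
    also have "t powr e * t powr (- 3 * e) = t powr - e * t powr - e" by (simp flip: powr_add)
    also have "64 * t * C * (t powr - e * t powr - e) = (64 * C) * t powr - e * (t * \<eta>)" by (simp add: \<eta>)
    also have "\<dots> \<le> (\<kappa> / 4) * (t * \<eta>)"
    proof (intro mult_right_mono)
      have "256 * C \<le> \<kappa> * t powr e" using Z(3) \<kappa> by (simp add: field_simps)
      hence "256 * C * t powr - e \<le> \<kappa> * t powr e * t powr - e" by (intro mult_right_mono) auto
      also have "\<dots> = \<kappa>" using t1 by (simp add: mult.assoc flip: powr_add)
      finally show "64 * C * t powr - e \<le> \<kappa> / 4" by simp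
    qed (use t1 \<eta>0 in auto)
    finally show ?thesis by (simp add: mult_ac)
  qed
  have term2: "(80 * (1 + D) / \<eta>\<^sup>2 + 32 * D / \<eta> * t powr (6 * e)) * m \<le> 304 * t powr (1 + 7 * e) * m"
  proof (rule mult_right_mono[OF _ m0])
    have "80 * (1 + D) / \<eta>\<^sup>2 \<le> 80 * (3 * t) / \<eta>\<^sup>2" using D2 t1 \<eta>0 by (intro divide_right_mono mult_left_mono) auto
    also have "\<dots> = 240 * t * (1 / \<eta>\<^sup>2)" by simp
    also have "\<dots> = 240 * (t powr 1 * t powr (2 * e))" using t1 by (simp add: p\<eta>2)
    also have "t powr 1 * t powr (2 * e) = t powr (1 + 2 * e)" by (rule powr_add[symmetric])
    also have "240 * t powr (1 + 2 * e) \<le> 240 * t powr (1 + 7 * e)" using t1 e by (intro mult_left_mono powr_mono) auto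
    finally have a: "80 * (1 + D) / \<eta>\<^sup>2 \<le> 240 * t powr (1 + 7 * e)" .
    have "32 * D / \<eta> * t powr (6 * e) \<le> 32 * (2 * t) / \<eta> * t powr (6 * e)" using D2 \<eta>0 by (intro mult_right_mono divide_right_mono mult_left_mono) auto
    also have "\<dots> = 64 * t * (1 / \<eta>) * t powr (6 * e)" by simp
    also have "\<dots> = 64 * (t powr 1 * t powr e * t powr (6 * e))" using t1 by (simp add: p\<eta>)
    also have "\<dots> = 64 * t powr (1 + 7 * e)" by (simp only: powr_add[symmetric]) (simp add: algebra_simps)
    finally show "80 * (1 + D) / \<eta>\<^sup>2 + 32 * D / \<eta> * t powr (6 * e) \<le> 304 * t powr (1 + 7 * e)" using a by linarith
  qed
  have "\<kappa> * t * \<eta> \<le> \<kappa> * t * \<eta> / 4 + 304 * t powr (1 + 7 * e) * m + \<kappa> * t * \<eta> / 4"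
  proof -
    have "\<kappa> * t * \<eta> = (t - (1 - \<kappa>) * t) * \<eta>" by (simp add: algebra_simps)
    also note main
    also note add_mono[OF add_mono[OF term1 term2] term3]
    finally show ?thesis .
  qed
  moreover have "\<kappa> * (t * \<eta>) = \<kappa> * t * \<eta>" "304 * t powr (1 + 7 * e) * m = 304 * (t powr (1 + 7 * e) * m)" by simp_all
  ultimately have "\<kappa> * (t * \<eta>) \<le> 608 * (t powr (1 + 7 * e) * m)" by linarith
  also have "608 \<le> \<kappa> * t powr e" using Z(4) \<kappa> by (simp add: field_simps)
  hence "608 * (t powr (1 + 7 * e) * m) \<le> \<kappa> * t powr e * (t powr (1 + 7 * e) * m)"
    using m0 by (intro mult_right_mono) auto
  finally have "t * \<eta> \<le> t powr e * t powr (1 + 7 * e) * m" using \<kappa> by (simp add: mult.assoc)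
  also have "t powr e * t powr (1 + 7 * e) = t powr (1 + 8 * e)" by (simp add: algebra_simps flip: powr_add)
  also have "t * \<eta> = t powr (1 - e)" using t1 by (simp add: \<eta> powr_diff powr_minus divide_inverse)
  finally have "t powr (1 - e) * t powr - (1 + 8 * e) \<le> t powr (1 + 8 * e) * m * t powr - (1 + 8 * e)"
    by (intro mult_right_mono) auto
  also have "\<dots> = m * (t powr (1 + 8 * e) * t powr - (1 + 8 * e))" by (simp only: mult_ac)
  also have "t powr (1 + 8 * e) * t powr - (1 + 8 * e) = 1" using t1 by (simp flip: powr_add)
  also have "t powr (1 - e) * t powr - (1 + 8 * e) = t powr (- 9 * e)" by (simp flip: powr_add)
  finally show "t powr (- 9 * e) \<le> measure plane G" by (simp add: m_def)
qed


text \<open>The sets \<open>Ds i\<close> are the exponentials of discs of radius \<open>\<delta>\<close> about points of the fast region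
  that are \<open>12 * \<delta>\<close>-separated, so they remain \<open>\<delta>\<close>-separated. The speed exceeds \<open>t powr (1/2)\<close>, and \<open>\<delta>\<close> times this is
  the constant \<open>B\<close> of \<open>schottky_covering\<close>. In the Lipschitz bound the derivative is at most
  \<open>exp ((1 + 2 * \<kappa>) * t)\<close> while \<open>s' i\<close> is at least \<open>exp ((1 - \<kappa>) * t)\<close>; the exponent \<open>1 + \<nu>\<close> with \<open>\<nu> \<ge> 8 * \<kappa>\<close>
  covers the difference, and \<open>\<kappa> * t \<ge> (1 + \<nu>) * ln s\<close> pays for the division by \<open>s\<close>.\<close>

lemma children_at_regular_radius:
  fixes e :: real
  assumes e: "0 < e" "e \<le> 1/26" and \<kappa>: "0 < \<kappa>" "\<kappa> \<le> (1 - c) / 2" "\<kappa> \<le> 1/4"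
    and \<nu>: "8 * \<kappa> \<le> \<nu>"
    and C: "C > 0" "proximity_bounded (1 - e) C"
    and B: "B \<ge> 1" "expansion_covers K B"
    and r: "r \<ge> 2 * radius0" and t: "t = logM r" and \<eta>: "\<eta> = t powr - e"
    and reg: "logM (r * (1 + 6 * \<eta>)) \<le> (1 + \<kappa>) * t"
    and Z: "20 \<le> t powr e" "28 / \<kappa> \<le> t powr e" "256 * C / \<kappa> \<le> t powr e" "608 / \<kappa> \<le> t powr e"
      "B \<le> t powr e" "2 * C * (12 * B) powr (2 * (1 - e)) \<le> t powr e" "t powr e \<le> exp (\<kappa> * t)"
    and s: "s \<ge> 1" "s \<le> r" "(1 + \<nu>) * ln s \<le> \<kappa> * t" "ln (2 * s) \<le> t / 2"
  defines "\<delta> \<equiv> B * t powr - (1/2)"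
  obtains n :: nat and Ds :: "nat \<Rightarrow> complex set" and s' :: "nat \<Rightarrow> real" where
    "t powr (1 - 11 * e) \<le> real n"
    "\<And>i. i < n \<Longrightarrow> compact (Ds i)"
    "\<And>i z. i < n \<Longrightarrow> z \<in> Ds i \<Longrightarrow> r / 2 \<le> norm z \<and> norm z \<le> 2 * r"
    "\<And>i. i < n \<Longrightarrow> annulus K (s' i) \<subseteq> f ` Ds i"
    "\<And>i. i < n \<Longrightarrow> 2 * s \<le> s' i"
    "\<And>i z w. i < n \<Longrightarrow> z \<in> Ds i \<Longrightarrow> w \<in> Ds i \<Longrightarrow> norm (f z - f w) \<le> (s' i / s) powr (1 + \<nu>) * norm (z - w)"
    "\<And>i j z w. i < n \<Longrightarrow> j < i \<Longrightarrow> z \<in> Ds i \<Longrightarrow> w \<in> Ds j \<Longrightarrow> s * \<delta> \<le> norm (z - w)"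
proof -
  define R where "R = r * (1 + 6 * \<eta>)"
  define G where "G = {p \<in> {ln r..ln r + \<eta>} \<times> {0..2*pi}. exp ((1 - \<kappa>) * t) \<le> norm (f (polar p)) \<and> t powr (1/2) < log_speed f p}"
  have rr: "r \<ge> radius0" and r2: "r \<ge> 2" and r0: "r > 0" using r radius0(1) by linarith+
  have t1: "t \<ge> 1" unfolding t by (rule logM_ge_1[OF rr])
  have \<eta>0: "\<eta> > 0" unfolding \<eta> using t1 by simp
  have \<eta>i: "\<eta> * t powr e = 1" unfolding \<eta> using t1 by (simp flip: powr_add)
  have \<eta>20: "\<eta> \<le> 1/20"
  proof -
    have "\<eta> * 20 \<le> \<eta> * t powr e" using Z(1) \<eta>0 by (intro mult_left_mono) auto
    thus ?thesis using \<eta>i by simp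
  qed
  have Rr: "R \<ge> r" unfolding R_def using r0 \<eta>0 by (simp add: mult_le_cancel_left1)
  have R0: "R \<ge> radius0" "R > 0" "R \<ge> 1" using Rr rr r0 r2 by auto
  have G: "G \<in> sets plane" "t powr (- 9 * e) \<le> measure plane G"
    using fast_region_large[OF e \<kappa>(1,2) C r t \<eta> R_def reg[folded R_def] Z(1-4)] unfolding G_def by blast+
  have GB: "G \<subseteq> {ln r..ln r + 1} \<times> {0..2*pi}" using \<eta>20 by (auto simp: G_def)
  define q where "q = 1 - e"
  have q: "0 < q" using e by (simp add: q_def)
  have \<delta>0: "\<delta> > 0" using B t1 by (simp add: \<delta>_def)
  have \<delta>\<eta>: "\<delta> \<le> \<eta>"
  proof -
    have "B * t powr - (1/2) \<le> t powr e * t powr - (1/2)" using Z(5) by (intro mult_right_mono) auto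
    also have "\<dots> = t powr (e - 1/2)" by (simp flip: powr_add)
    also have "\<dots> \<le> t powr - e" using t1 e by (intro powr_mono) auto
    finally show ?thesis by (simp add: \<delta>_def \<eta>)
  qed
  define W where "W = C * (12 * \<delta>) powr (2 * q)"
  have W0: "W > 0" using C \<delta>0 by (simp add: W_def)
  define X where "X = t powr (- 9 * e) / (2 * W)"
  have X0: "X \<ge> 0" using W0 by (simp add: X_def)
  \<comment> \<open>\<open>W\<close> is the area of a disc of relative radius \<open>12 * \<delta>\<close>, so \<open>X\<close> such discs fill at most half of \<open>G\<close>.\<close>
  define n0 where "n0 = nat \<lfloor>X\<rfloor>"
  have n0: "real n0 \<le> X" "X \<le> real (Suc n0)" using X0 by (auto simp: n0_def) linarith
  have "real n0 * W \<le> X * W" using n0 W0 by (intro mult_right_mono) auto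
  also have "\<dots> = t powr (- 9 * e) / 2" using W0 by (simp add: X_def)
  also have "\<dots> < t powr (- 9 * e)" using t1 by simp
  finally have nW: "real n0 * ((12 * \<delta>) powr (2 * q) * C) < measure plane G"
    using G(2) by (simp add: W_def mult_ac)
  have "12 * \<delta> > 0" using \<delta>0 by simp
  then obtain ps where ps: "\<And>i. i \<le> n0 \<Longrightarrow> ps i \<in> G"
     "\<And>i j. i \<le> n0 \<Longrightarrow> j < i \<Longrightarrow> 12 * \<delta> * norm (polar (ps i)) \<le> norm (polar (ps i) - polar (ps j))"
    using separated_points[OF q _ C(1) C(2)[folded q_def] G(1) GB nW] by blast
  define \<zeta> where "\<zeta> = (\<lambda>i. Complex (fst (ps i)) (snd (ps i)))"
  have e\<zeta>: "exp (\<zeta> i) = polar (ps i)" for i by (simp add: \<zeta>_def polar_def)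
  define F where "F = (\<lambda>z. f (exp z))"
  have holF: "F holomorphic_on UNIV"
    unfolding F_def by (rule holomorphic_on_compose_gen[OF _ hol, unfolded o_def]) (auto intro!: holomorphic_intros)
  have dF: "deriv F z = deriv f (exp z) * exp z" for z
  proof -
    have "(f has_field_derivative deriv f (exp z)) (at (exp z))" using hol holomorphic_derivI by blast
    hence "(F has_field_derivative (deriv f (exp z) * exp z)) (at z)"
      unfolding F_def by (rule DERIV_chain2[OF _ DERIV_exp])
    thus ?thesis by (rule DERIV_imp_deriv)
  qed
  have exF: "\<exists>\<rho>\<ge>exp ((1 - \<kappa>) * t). annulus K \<rho> \<subseteq> F ` cball (\<zeta> i) \<delta>" if i: "i \<le> n0" for i
  proof -
    have pG: "exp ((1 - \<kappa>) * t) \<le> norm (F (\<zeta> i))" "t powr (1/2) < log_speed f (ps i)"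
      using ps(1)[OF i] by (auto simp: G_def F_def e\<zeta>)
    have "norm (F (\<zeta> i)) > 0" using pG(1) exp_gt_zero by (rule less_le_trans[rotated])
    hence nz: "F (\<zeta> i) \<noteq> 0" by simp
    have ls: "log_speed f (ps i) * norm (F (\<zeta> i)) = norm (deriv F (\<zeta> i))"
      using nz unfolding log_speed_def dF by (simp add: e\<zeta> F_def norm_mult)
    have "B * norm (F (\<zeta> i)) = \<delta> * t powr (1/2) * norm (F (\<zeta> i))"
      using t1 by (simp add: \<delta>_def mult.assoc flip: powr_add)
    also have "\<dots> \<le> \<delta> * log_speed f (ps i) * norm (F (\<zeta> i))"
      using pG(2) \<delta>0 by (intro mult_right_mono mult_left_mono) auto
    also have "\<dots> = \<delta> * norm (deriv F (\<zeta> i))" using ls by (simp add: mult.assoc)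
    finally obtain \<rho> where "\<rho> \<ge> norm (F (\<zeta> i))" "annulus K \<rho> \<subseteq> F ` cball (\<zeta> i) \<delta>"
      using B(2) holF \<delta>0 nz unfolding expansion_covers_def by blast
    thus ?thesis using pG(1) by (intro exI[of _ \<rho>]) auto
  qed
  then obtain s' where s': "\<And>i. i \<le> n0 \<Longrightarrow> s' i \<ge> exp ((1 - \<kappa>) * t)" "\<And>i. i \<le> n0 \<Longrightarrow> annulus K (s' i) \<subseteq> F ` cball (\<zeta> i) \<delta>"
    by metis
  define Ds where "Ds = (\<lambda>i. exp ` cball (\<zeta> i) \<delta>)"
  have fst_p: "ln r \<le> fst (ps i) \<and> fst (ps i) \<le> ln r + \<eta>" if "i \<le> n0" for i
    using ps(1)[OF that] by (auto simp: G_def)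
  have exp2\<eta>: "r * exp (2 * \<eta>) \<le> (1 - 2 * \<eta>) * R" "exp (2 * \<eta>) \<le> 2"
  proof -
    have \<eta>sq: "\<eta>\<^sup>2 * 20 \<le> \<eta>" unfolding power2_eq_square using mult_left_mono[OF \<eta>20, of "\<eta> * 20"] \<eta>0 by simp
    have a: "exp (2 * \<eta>) \<le> 1 + 2 * \<eta> + (2 * \<eta>)\<^sup>2" using \<eta>0 \<eta>20 by (intro exp_bound) auto
    also have "\<dots> \<le> (1 - 2 * \<eta>) * (1 + 6 * \<eta>)" using \<eta>sq \<eta>0 by (simp add: algebra_simps power2_eq_square)
    finally have "r * exp (2 * \<eta>) \<le> r * ((1 - 2 * \<eta>) * (1 + 6 * \<eta>))" using r0 by (intro mult_left_mono) auto
    thus "r * exp (2 * \<eta>) \<le> (1 - 2 * \<eta>) * R" by (simp add: R_def mult_ac)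
    have "(2 * \<eta>)\<^sup>2 = 4 * \<eta>\<^sup>2" by (simp add: power2_eq_square)
    thus "exp (2 * \<eta>) \<le> 2" using a \<eta>sq \<eta>20 by linarith
  qed
  have Ds_norm: "r / 2 \<le> norm z \<and> norm z \<le> r * exp (2 * \<eta>)" if i: "i \<le> n0" and z: "z \<in> Ds i" for i z
  proof -
    obtain w where w: "w \<in> cball (\<zeta> i) \<delta>" "z = exp w" using z by (auto simp: Ds_def)
    have "\<bar>Re w - fst (ps i)\<bar> \<le> norm (w - \<zeta> i)" using abs_Re_le_cmod[of "w - \<zeta> i"] by (simp add: \<zeta>_def)
    also have "\<dots> \<le> \<eta>" using w(1) \<delta>\<eta> by (simp add: dist_norm norm_minus_commute)
    finally have "\<bar>Re w - fst (ps i)\<bar> \<le> \<eta>" .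
    hence Rw: "ln r - \<eta> \<le> Re w" "Re w \<le> ln r + 2 * \<eta>" using fst_p[OF i] by linarith+
    have nz: "norm z = exp (Re w)" using w(2) by simp
    have "exp (ln r - \<eta>) \<le> norm z" using Rw(1) unfolding nz by simp
    moreover have "exp (ln r - \<eta>) = r * exp (- \<eta>)" using r0 by (simp add: exp_add[symmetric] exp_diff exp_minus divide_inverse)
    moreover have "r * (1/2) \<le> r * exp (- \<eta>)" using exp_ge_add_one_self[of "- \<eta>"] \<eta>20 r0 by (intro mult_left_mono) auto
    moreover have "norm z \<le> exp (ln r + 2 * \<eta>)" using Rw(2) unfolding nz by simp
    moreover have "exp (ln r + 2 * \<eta>) = r * exp (2 * \<eta>)" using r0 by (simp add: exp_add)
    ultimately show ?thesis by linarith
  qed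
  show ?thesis
  proof (rule that[of "Suc n0" Ds s'])
    show "t powr (1 - 11 * e) \<le> real (Suc n0)"
    proof -
      have "(12 * \<delta>) powr (2 * q) = (12 * B) powr (2 * q) * t powr - q"
        using B t1 by (simp add: \<delta>_def powr_mult powr_powr mult.assoc flip: mult.assoc)
      hence "2 * W = 2 * C * (12 * B) powr (2 * q) * t powr - q" by (simp add: W_def)
      also have "\<dots> \<le> t powr e * t powr - q" using Z(6) by (intro mult_right_mono) (auto simp: q_def)
      finally have "2 * W \<le> t powr (e - q)" by (simp flip: powr_add)
      hence "t powr (- 9 * e) / t powr (e - q) \<le> X" unfolding X_def using W0 t1 by (intro divide_left_mono) auto
      moreover have "t powr (- 9 * e) / t powr (e - q) = t powr (1 - 11 * e)" by (simp add: q_def flip: powr_diff)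
      ultimately show ?thesis using n0(2) by linarith
    qed
    fix i assume i': "i < Suc n0"
    hence i: "i \<le> n0" by simp
    show "compact (Ds i)" unfolding Ds_def by (intro compact_continuous_image continuous_intros compact_cball)
    show "annulus K (s' i) \<subseteq> f ` Ds i" using s'(2)[OF i] by (auto simp: Ds_def F_def)
    show "2 * s \<le> s' i"
    proof -
      have "(1/2) * t \<le> (1 - \<kappa>) * t" using \<kappa> t1 by (intro mult_right_mono) auto
      hence "ln (2 * s) \<le> (1 - \<kappa>) * t" using s(4) by linarith
      hence "exp (ln (2 * s)) \<le> exp ((1 - \<kappa>) * t)" by simp
      thus ?thesis using s'(1)[OF i] s(1) by simp
    qed
    have s'0: "s' i > 0" using s'(1)[OF i] exp_gt_zero by (rule less_le_trans[rotated])
    show "r / 2 \<le> norm z \<and> norm z \<le> 2 * r" if z: "z \<in> Ds i" for z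
    proof -
      have "r * exp (2 * \<eta>) \<le> r * 2" using exp2\<eta>(2) r0 by (intro mult_left_mono) auto
      thus ?thesis using Ds_norm[OF i z] by linarith
    qed
    show "norm (f z - f w) \<le> (s' i / s) powr (1 + \<nu>) * norm (z - w)" if z: "z \<in> Ds i" and w: "w \<in> Ds i" for z w
    proof -
      have "norm (f z - f w) \<le> exp ((1 + 2 * \<kappa>) * t) * norm (z - w)"
      proof (rule field_differentiable_bound[of "cball 0 (r * exp (2 * \<eta>))" f "deriv f"])
        show "z \<in> cball 0 (r * exp (2 * \<eta>))" "w \<in> cball 0 (r * exp (2 * \<eta>))"
          using Ds_norm[OF i z] Ds_norm[OF i w] by auto
        fix x :: complex assume x: "x \<in> cball 0 (r * exp (2 * \<eta>))"
        show "(f has_field_derivative deriv f x) (at x within cball 0 (r * exp (2 * \<eta>)))"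
          using hol holomorphic_derivI has_field_derivative_at_within by blast
        have "norm x \<le> (1 - 2 * \<eta>) * R" using x exp2\<eta>(1) by simp
        hence "norm (deriv f x) \<le> exp (logM R) / (2 * \<eta> * R)" using \<eta>0 by (intro derivative_le[OF R0(1)]) auto
        also have "\<dots> \<le> exp ((1 + \<kappa>) * t) / (\<eta> * 1)"
          using reg R0 \<eta>0 unfolding R_def[symmetric] by (intro frac_le mult_mono) auto
        also have "\<dots> = exp ((1 + \<kappa>) * t) * t powr e" using \<eta>i \<eta>0 by (simp add: field_simps)
        also have "\<dots> \<le> exp ((1 + \<kappa>) * t) * exp (\<kappa> * t)" using Z(7) by (intro mult_left_mono) auto
        also have "\<dots> = exp ((1 + 2 * \<kappa>) * t)" by (simp add: algebra_simps flip: exp_add)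
        finally show "norm (deriv f x) \<le> exp ((1 + 2 * \<kappa>) * t)" .
      qed auto
      also have "\<dots> \<le> (s' i / s) powr (1 + \<nu>) * norm (z - w)"
      proof (intro mult_right_mono)
        have k8: "(1 + 3 * \<kappa>) \<le> (1 + \<nu>) * (1 - \<kappa>)"
        proof -
          have "(1 + 8 * \<kappa>) * (1 - \<kappa>) \<le> (1 + \<nu>) * (1 - \<kappa>)" using \<nu> \<kappa> by (intro mult_right_mono) auto
          moreover have "(1 + 8 * \<kappa>) * (1 - \<kappa>) = 1 + 7 * \<kappa> - 8 * (\<kappa> * \<kappa>)" by (simp add: algebra_simps)
          moreover have "\<kappa> * \<kappa> \<le> \<kappa> * (1/4)" using \<kappa> by (intro mult_left_mono) auto
          ultimately show ?thesis using \<kappa> by linarith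
        qed
        have "(1 + 3 * \<kappa>) * t \<le> ((1 + \<nu>) * (1 - \<kappa>)) * t" using k8 t1 by (intro mult_right_mono) auto
        hence "(1 + 2 * \<kappa>) * t \<le> (1 + \<nu>) * ((1 - \<kappa>) * t) - (1 + \<nu>) * ln s"
          using s(3) by (simp add: algebra_simps)
        also have "\<dots> = (1 + \<nu>) * ((1 - \<kappa>) * t - ln s)" by (simp add: algebra_simps)
        also have "\<dots> \<le> (1 + \<nu>) * ln (s' i / s)"
        proof (intro mult_left_mono)
          have "ln (exp ((1 - \<kappa>) * t)) \<le> ln (s' i)" using s'(1)[OF i] by (intro ln_mono) auto
          thus "(1 - \<kappa>) * t - ln s \<le> ln (s' i / s)" using s'0 s(1) by (simp add: ln_div)
        qed (use \<nu> \<kappa> in auto)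
        finally have "exp ((1 + 2 * \<kappa>) * t) \<le> exp ((1 + \<nu>) * ln (s' i / s))" by simp
        also have "\<dots> = (s' i / s) powr (1 + \<nu>)" using s'0 s(1) by (simp add: powr_def)
        finally show "exp ((1 + 2 * \<kappa>) * t) \<le> (s' i / s) powr (1 + \<nu>)" .
      qed auto
      finally show ?thesis .
    qed
    fix j z w assume ji: "j < i" and z: "z \<in> Ds i" and w: "w \<in> Ds j"
    have j: "j \<le> n0" using ji i by simp
    have near: "norm (v - polar (ps k)) \<le> 2 * \<delta> * norm (polar (ps k))" if k: "k \<le> n0" and v: "v \<in> Ds k" for k v
    proof -
      obtain u where u: "u \<in> cball (\<zeta> k) \<delta>" "v = exp u" using v by (auto simp: Ds_def)
      have nu: "norm (u - \<zeta> k) \<le> \<delta>" using u(1) by (simp add: dist_norm norm_minus_commute)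
      hence "norm (exp u - exp (\<zeta> k)) \<le> 2 * norm (u - \<zeta> k) * norm (exp (\<zeta> k))"
        using \<delta>\<eta> \<eta>20 by (intro norm_exp_diff_le) auto
      also have "\<dots> \<le> 2 * \<delta> * norm (exp (\<zeta> k))" using nu by (intro mult_right_mono) auto
      finally show ?thesis using u(2) e\<zeta> by simp
    qed
    have npol: "norm (polar (ps k)) = exp (fst (ps k))" for k by (cases "ps k") simp
    have pj: "norm (polar (ps j)) \<le> 2 * norm (polar (ps i))"
    proof -
      have "fst (ps j) \<le> fst (ps i) + 2 * \<eta>" using fst_p[OF i] fst_p[OF j] \<eta>0 by linarith
      hence "exp (fst (ps j)) \<le> exp (fst (ps i) + 2 * \<eta>)" by simp
      also have "\<dots> = exp (fst (ps i)) * exp (2 * \<eta>)" by (simp add: exp_add)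
      also have "\<dots> \<le> exp (fst (ps i)) * 2" using exp2\<eta>(2) by (intro mult_left_mono) auto
      finally show ?thesis by (simp add: npol)
    qed
    have pi: "s \<le> norm (polar (ps i))"
    proof -
      have "exp (ln r) \<le> exp (fst (ps i))" using fst_p[OF i] by simp
      thus ?thesis using s(2) r0 by (simp add: npol)
    qed
    have "norm (polar (ps i) - polar (ps j)) \<le> norm (z - w) + (norm (z - polar (ps i)) + norm (w - polar (ps j)))"
    proof -
      have "polar (ps i) - polar (ps j) = (z - w) + ((w - polar (ps j)) - (z - polar (ps i)))" by simp
      hence "norm (polar (ps i) - polar (ps j)) \<le> norm (z - w) + norm ((w - polar (ps j)) - (z - polar (ps i)))"
        by (metis norm_triangle_ineq)
      thus ?thesis using norm_triangle_ineq4[of "w - polar (ps j)" "z - polar (ps i)"] by linarith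
    qed
    moreover have "2 * \<delta> * norm (polar (ps j)) \<le> 2 * \<delta> * (2 * norm (polar (ps i)))"
      using pj \<delta>0 by (intro mult_left_mono) auto
    moreover have "\<delta> * s \<le> \<delta> * norm (polar (ps i))" using pi \<delta>0 by (intro mult_left_mono) auto
    moreover have "\<delta> * norm (polar (ps i)) \<ge> 0" using \<delta>0 by simp
    ultimately have "\<delta> * s \<le> norm (z - w)"
      using near[OF i z] near[OF j w] ps(2)[OF i ji] by (simp add: mult.assoc)
    thus "s * \<delta> \<le> norm (z - w)" by (simp add: mult.commute)
  qed
qed

text \<open>The Lipschitz constant \<open>(s' i / s) powr (1 + \<nu>)\<close> has a form that multiplies up along a branch
  of the tree. The discs stay in the middle of the annulus of radii \<open>s\<close> and \<open>K * s\<close>, which leaves room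
  for Harnack's inequality on both sides.\<close>

definition child_system :: "real \<Rightarrow> real \<Rightarrow> real \<Rightarrow> real \<Rightarrow> nat \<Rightarrow> (nat \<Rightarrow> complex set) \<Rightarrow> (nat \<Rightarrow> real) \<Rightarrow> bool" where
  "child_system \<nu> K s \<delta> n Ds s' \<longleftrightarrow>
    (\<forall>i<n. compact (Ds i) \<and> (\<forall>z\<in>Ds i. sqrt K * s / 2 \<le> norm z \<and> norm z \<le> 4 * (sqrt K * s)) \<and>
       annulus K (s' i) \<subseteq> f ` Ds i \<and> 2 * s \<le> s' i \<and>
       (\<forall>z\<in>Ds i. \<forall>w\<in>Ds i. norm (f z - f w) \<le> (s' i / s) powr (1 + \<nu>) * norm (z - w))) \<and>
    (\<forall>i<n. \<forall>j<i. \<forall>z\<in>Ds i. \<forall>w\<in>Ds j. s * \<delta> \<le> norm (z - w))"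

text \<open>The number of discs is compared with \<open>s powr \<nu> / \<delta>\<close> instead of \<open>1 / \<delta>\<close>, since \<open>s powr \<nu>\<close> is what
  the pullback to a cell contributes to the scale.\<close>

definition productive :: "real \<Rightarrow> real \<Rightarrow> real \<Rightarrow> real \<Rightarrow> bool" where
  "productive \<epsilon> \<nu> K s \<longleftrightarrow> (\<exists>\<delta> n Ds s'. 0 < \<delta> \<and> \<delta> \<le> s powr - \<nu> \<and>
     (s powr \<nu> / \<delta>) powr (2 - \<epsilon>) \<le> real n \<and> child_system \<nu> K s \<delta> n Ds s')"

text \<open>All error exponents are multiples of \<open>e = \<epsilon> / 26\<close>: since \<open>s powr a \<le> t\<close> and \<open>\<nu> = a * e\<close>, the factor
  \<open>s powr \<nu>\<close> is at most \<open>t powr e\<close>, so \<open>(s powr \<nu> / \<delta>) powr (2 - \<epsilon>)\<close> is at most \<open>t powr ((e + 1/2) * (2 - \<epsilon>))\<close>, and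
  \<open>2 * e - \<epsilon> / 2 = - 11 * e\<close>.\<close>

lemma children:
  assumes \<epsilon>: "0 < \<epsilon>" "\<epsilon> \<le> 1"
  obtains \<nu> where "\<nu> > 0" "\<And>K. K \<ge> 1 \<Longrightarrow> \<forall>\<^sub>F s in at_top. productive \<epsilon> \<nu> K s"
proof -
  obtain a where a: "0 < a" "\<forall>\<^sub>F s in at_top. s powr a \<le> logM s" using growth_exponent .
  define e where "e = \<epsilon> / 26"
  have e: "0 < e" "e \<le> 1/26" using \<epsilon> by (auto simp: e_def)
  define \<nu> where "\<nu> = a * e"
  have \<nu>: "\<nu> > 0" using a e by (simp add: \<nu>_def)
  \<comment> \<open>The bounds required by \<open>children_at_regular_radius\<close>.\<close>
  define \<kappa> where "\<kappa> = min (\<nu> / 8) (min ((1 - c) / 2) (1/4))"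
  have \<kappa>: "0 < \<kappa>" "\<kappa> \<le> (1 - c) / 2" "\<kappa> \<le> 1/4" "8 * \<kappa> \<le> \<nu>" using \<nu> c by (auto simp: \<kappa>_def min_def)
  obtain C where C: "C > 0" "proximity_bounded (1 - e) C"
    using proximity_integral_bound[of "1 - e"] e by auto
  show ?thesis
  proof (rule that[OF \<nu>])
    fix K :: real assume K: "K \<ge> 1"
    obtain B where B: "B \<ge> 1" "expansion_covers K B" using schottky_covering[OF K] .
    define Z where "Z = 20 + 28 / \<kappa> + 256 * C / \<kappa> + 608 / \<kappa> + B + 2 * C * (12 * B) powr (2 * (1 - e))"
    have ZZ: "20 \<le> Z" "28 / \<kappa> \<le> Z" "256 * C / \<kappa> \<le> Z" "608 / \<kappa> \<le> Z" "B \<le> Z" "2 * C * (12 * B) powr (2 * (1 - e)) \<le> Z"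
    proof -
      have "28 / \<kappa> \<ge> 0" "256 * C / \<kappa> \<ge> 0" "608 / \<kappa> \<ge> 0" "2 * C * (12 * B) powr (2 * (1 - e)) \<ge> 0"
        using \<kappa>(1) C(1) by auto
      thus "20 \<le> Z" "28 / \<kappa> \<le> Z" "256 * C / \<kappa> \<le> Z" "608 / \<kappa> \<le> Z" "B \<le> Z" "2 * C * (12 * B) powr (2 * (1 - e)) \<le> Z"
        unfolding Z_def using B(1) by linarith+
    qed
    have sK: "sqrt K \<ge> 1" using K by simp
    have "\<forall>\<^sub>F s in at_top. \<exists>r. s \<le> r \<and> r \<le> 2 * s \<and> logM (r * (1 + 6 * logM r powr - e)) \<le> (1 + \<kappa>) * logM r"
      by (rule regular_radius[OF \<kappa>(1) e(1)])
    moreover have "filterlim (\<lambda>s. sqrt K * s) at_top at_top"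
      using sK by (intro filterlim_tendsto_pos_mult_at_top[OF tendsto_const] filterlim_ident) auto
    ultimately have ev1: "\<forall>\<^sub>F s in at_top. \<exists>r. sqrt K * s \<le> r \<and> r \<le> 2 * (sqrt K * s) \<and> logM (r * (1 + 6 * logM r powr - e)) \<le> (1 + \<kappa>) * logM r"
      by (rule eventually_compose_filterlim)
    have "\<forall>\<^sub>F t::real in at_top. t powr e \<le> exp (\<kappa> * t) \<and> Z \<le> t powr e \<and> 1 \<le> t"
    proof (intro eventually_conj)
      have "((\<lambda>t::real. ln t / t) \<longlongrightarrow> 0) at_top" by (rule ln_x_over_x_tendsto_0)
      hence "\<forall>\<^sub>F t::real in at_top. ln t / t < \<kappa>" using \<kappa>(1) by (auto dest: order_tendstoD)
      thus "\<forall>\<^sub>F t::real in at_top. t powr e \<le> exp (\<kappa> * t)"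
        using eventually_ge_at_top[of 1]
      proof eventually_elim
        case (elim t)
        have "ln t \<le> \<kappa> * t" using elim by (simp add: divide_less_eq)
        moreover have "e * ln t \<le> 1 * ln t" using e elim by (intro mult_right_mono) auto
        ultimately show ?case using elim by (simp add: powr_def)
      qed
      show "\<forall>\<^sub>F t::real in at_top. Z \<le> t powr e" using powr_at_top[OF e(1)] unfolding filterlim_at_top by blast
    qed (rule eventually_ge_at_top)
    then obtain t0 where t0: "\<And>t. t \<ge> t0 \<Longrightarrow> t powr e \<le> exp (\<kappa> * t) \<and> Z \<le> t powr e \<and> 1 \<le> t"
      unfolding eventually_at_top_linorder by blast
    have ev2: "\<forall>\<^sub>F s in at_top. logM s \<ge> t0" using logM_at_top unfolding filterlim_at_top by blast
    have ev3: "\<forall>\<^sub>F s in at_top. (1 + \<nu>) * ln s \<le> \<kappa> * logM s \<and> ln (2 * s) \<le> logM s / 2"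
    proof -
      have l: "((\<lambda>s. ln (s powr a) / s powr a) \<longlongrightarrow> 0) at_top"
        by (rule filterlim_compose[OF ln_x_over_x_tendsto_0 powr_at_top[OF a(1)]])
      define m where "m = min (\<kappa> / (1 + \<nu>)) (1/4)"
      have m: "m > 0" "m \<le> 1/4" and m': "m \<le> \<kappa> / (1 + \<nu>)"
        unfolding m_def using \<kappa>(1) \<nu> by (simp, intro min.cobounded2, intro min.cobounded1)
      have m2: "(1 + \<nu>) * m \<le> \<kappa>" using m' \<nu> by (simp add: pos_le_divide_eq mult.commute)
      have "\<forall>\<^sub>F s in at_top. ln (s powr a) / s powr a < a * m" using l m(1) a(1) by (intro order_tendstoD) auto
      thus ?thesis using a(2) eventually_ge_at_top[of 2]
      proof eventually_elim
        case (elim s)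
        have sp: "s powr a > 0" using elim by simp
        have "a * ln s / s powr a < a * m" using elim(1,3) by (simp add: ln_powr)
        hence "a * ln s < a * m * s powr a" using sp by (simp add: divide_less_eq)
        hence "ln s \<le> m * s powr a" using a(1) by (simp add: mult.assoc)
        also have "\<dots> \<le> m * logM s" using elim m by (intro mult_left_mono) auto
        finally have l1: "ln s \<le> m * logM s" .
        have Tp: "logM s \<ge> 0" using elim(2) sp by linarith
        have "(1 + \<nu>) * ln s \<le> (1 + \<nu>) * (m * logM s)" using l1 \<nu> by (intro mult_left_mono) auto
        also have "\<dots> \<le> \<kappa> * logM s" using mult_right_mono[OF m2 Tp] by (simp add: mult.assoc)
        finally have A: "(1 + \<nu>) * ln s \<le> \<kappa> * logM s" .
        have "ln 2 \<le> ln s" using elim by simp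
        hence "ln (2 * s) \<le> 2 * ln s" using elim by (simp add: ln_mult)
        also have "\<dots> \<le> 2 * (m * logM s)" using l1 by simp
        also have "\<dots> \<le> 2 * (1/4 * logM s)" using m Tp by (intro mult_left_mono mult_right_mono) auto
        finally show ?case using A by simp
      qed
    qed
    show "\<forall>\<^sub>F s in at_top. productive \<epsilon> \<nu> K s"
      using ev1 ev2 ev3 a(2) eventually_ge_at_top[of "2 * radius0"]
    proof eventually_elim
      case (elim s)
      obtain r where r: "sqrt K * s \<le> r" "r \<le> 2 * (sqrt K * s)" "logM (r * (1 + 6 * logM r powr - e)) \<le> (1 + \<kappa>) * logM r"
        using elim(1) by blast
      have s1: "s \<ge> 1" "s \<ge> radius0" using elim(5) radius0(1) by auto
      have "1 * s \<le> sqrt K * s" using sK s1 by (intro mult_right_mono) auto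
      hence sr: "s \<le> r" using r(1) by linarith
      have Tsr: "logM s \<le> logM r" by (rule logM_mono[OF s1(2) sr])
      define t where "t = logM r"
      have t: "t powr e \<le> exp (\<kappa> * t)" "Z \<le> t powr e" "1 \<le> t" using t0[of t] elim(2) Tsr by (auto simp: t_def)
      have sa: "s powr a \<le> t" using elim(4) Tsr by (simp add: t_def)
      have r2: "r \<ge> 2 * radius0" using elim(5) sr by linarith
      have l1: "(1 + \<nu>) * ln s \<le> \<kappa> * t" "ln (2 * s) \<le> t / 2"
      proof -
        have "\<kappa> * logM s \<le> \<kappa> * t" using Tsr \<kappa>(1) by (simp add: t_def)
        thus "(1 + \<nu>) * ln s \<le> \<kappa> * t" using elim(3) by linarith
        show "ln (2 * s) \<le> t / 2" using elim(3) Tsr by (simp add: t_def)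
      qed
      define \<delta> where "\<delta> = B * t powr - (1/2)"
      obtain n Ds s' where ch: "t powr (1 - 11 * e) \<le> real n"
        "\<And>i. i < n \<Longrightarrow> compact (Ds i)"
        "\<And>i z. i < n \<Longrightarrow> z \<in> Ds i \<Longrightarrow> r / 2 \<le> norm z \<and> norm z \<le> 2 * r"
        "\<And>i. i < n \<Longrightarrow> annulus K (s' i) \<subseteq> f ` Ds i"
        "\<And>i. i < n \<Longrightarrow> 2 * s \<le> s' i"
        "\<And>i z w. i < n \<Longrightarrow> z \<in> Ds i \<Longrightarrow> w \<in> Ds i \<Longrightarrow> norm (f z - f w) \<le> (s' i / s) powr (1 + \<nu>) * norm (z - w)"
        "\<And>i j z w. i < n \<Longrightarrow> j < i \<Longrightarrow> z \<in> Ds i \<Longrightarrow> w \<in> Ds j \<Longrightarrow> s * \<delta> \<le> norm (z - w)"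
        using children_at_regular_radius[OF e \<kappa> C B r2 t_def refl, folded \<delta>_def, OF r(3)[folded t_def]
           order_trans[OF ZZ(1) t(2)] order_trans[OF ZZ(2) t(2)] order_trans[OF ZZ(3) t(2)] order_trans[OF ZZ(4) t(2)]
           order_trans[OF ZZ(5) t(2)] order_trans[OF ZZ(6) t(2)] t(1) s1(1) sr l1] by blast
      have \<delta>0: "\<delta> > 0" using B(1) t(3) by (simp add: \<delta>_def)
      have s\<nu>: "s powr \<nu> \<le> t powr e"
      proof -
        have "s powr \<nu> = (s powr a) powr e" by (simp add: \<nu>_def powr_powr)
        also have "\<dots> \<le> t powr e" using sa e by (intro powr_mono2) auto
        finally show ?thesis .
      qed
      have "\<delta> \<le> t powr e * t powr - (1/2)"
        unfolding \<delta>_def using ZZ(5) t(2) by (intro mult_right_mono) auto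
      also have "\<dots> = t powr (e - 1/2)" by (simp flip: powr_add)
      also have "\<dots> \<le> t powr - e" using t(3) e by (intro powr_mono) auto
      also have "\<dots> = inverse (t powr e)" by (simp add: powr_minus)
      also have "\<dots> \<le> inverse (s powr \<nu>)" using s\<nu> s1 by (intro le_imp_inverse_le) auto
      finally have \<delta>s: "\<delta> \<le> s powr - \<nu>" by (simp add: powr_minus)
      have cnt: "(s powr \<nu> / \<delta>) powr (2 - \<epsilon>) \<le> real n"
      proof -
        have "t powr - (1/2) \<le> \<delta>" using B(1) by (simp add: \<delta>_def mult_le_cancel_right1)
        hence "s powr \<nu> / \<delta> \<le> t powr e / t powr - (1/2)"
          using s\<nu> t(3) by (intro frac_le) auto
        also have "\<dots> = t powr (e + 1/2)" by (simp flip: powr_diff)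
        finally have "(s powr \<nu> / \<delta>) powr (2 - \<epsilon>) \<le> (t powr (e + 1/2)) powr (2 - \<epsilon>)"
          using \<epsilon> \<delta>0 by (intro powr_mono2) auto
        also have "\<dots> = t powr ((e + 1/2) * (2 - \<epsilon>))" by (simp add: powr_powr)
        also have "\<dots> \<le> t powr (1 - 11 * e)"
        proof (rule powr_mono)
          have "e * (2 - \<epsilon>) \<le> e * 2" using e \<epsilon> by (intro mult_left_mono) auto
          moreover have "(e + 1/2) * (2 - \<epsilon>) = e * (2 - \<epsilon>) + 1 - \<epsilon> / 2" by (simp add: field_simps)
          moreover have "\<epsilon> / 2 = 13 * e" by (simp add: e_def)
          ultimately show "(e + 1/2) * (2 - \<epsilon>) \<le> 1 - 11 * e" by linarith
        qed (rule t(3))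
        finally show ?thesis using ch(1) by linarith
      qed
      have "sqrt K * s / 2 \<le> norm z \<and> norm z \<le> 4 * (sqrt K * s)" if "i < n" "z \<in> Ds i" for i z
        using ch(3)[OF that] r(1,2) by linarith
      hence "child_system \<nu> K s \<delta> n Ds s'"
        unfolding child_system_def using ch by blast
      thus ?case unfolding productive_def using \<delta>0 \<delta>s cnt by blast
    qed
  qed
qed

end

section \<open>Quasi-normality of the iterates\<close>

text \<open>A weak form of the alternative that a locally uniform limit is infinite or finite at \<open>u\<close>.\<close>

definition locally_settled :: "(nat \<Rightarrow> complex \<Rightarrow> complex) \<Rightarrow> complex \<Rightarrow> bool" where
  "locally_settled g u \<longleftrightarrow> (\<exists>V. open V \<and> u \<in> V \<and>
     ((\<forall>\<^sub>F n in sequentially. \<forall>v\<in>V. norm (g n v) > 1) \<or>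
      (\<exists>B. \<forall>\<^sub>F n in sequentially. \<forall>v\<in>V. norm (g n v) \<le> B)))"

text \<open>Normality on \<open>U\<close> with the limit function forgotten. In this form the property passes to images
  under \<open>f\<close> and to finite unions by choosing subsequences, and it still suffices for Harnack's inequality.\<close>

definition quasi_normal :: "(complex \<Rightarrow> complex) \<Rightarrow> complex set \<Rightarrow> bool" where
  "quasi_normal f U \<longleftrightarrow> (\<forall>\<sigma> :: nat \<Rightarrow> nat. strict_mono \<sigma> \<longrightarrow> (\<exists>\<tau> :: nat \<Rightarrow> nat. strict_mono \<tau> \<and>
     (\<forall>u\<in>U. locally_settled (\<lambda>n. f ^^ \<sigma> (\<tau> n)) u)))"

lemma quasi_normalE:
  fixes \<sigma> :: "nat \<Rightarrow> nat"
  assumes "quasi_normal f U" "strict_mono \<sigma>"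
  obtains \<tau> :: "nat \<Rightarrow> nat" where "strict_mono \<tau>" "\<And>u. u \<in> U \<Longrightarrow> locally_settled (\<lambda>n. f ^^ \<sigma> (\<tau> n)) u"
proof -
  from assms(1)[unfolded quasi_normal_def, THEN spec, THEN mp, OF assms(2)]
  obtain \<tau> :: "nat \<Rightarrow> nat" where "strict_mono \<tau>" "\<forall>u\<in>U. locally_settled (\<lambda>n. f ^^ \<sigma> (\<tau> n)) u" by (elim exE conjE)
  thus ?thesis by (intro that) auto
qed

definition quasi_julia_set :: "(complex \<Rightarrow> complex) \<Rightarrow> complex set" where
  "quasi_julia_set f = - \<Union>{U. open U \<and> quasi_normal f U}"

lemma closed_quasi_julia_set: "closed (quasi_julia_set f)"
  unfolding quasi_julia_set_def by (intro closed_Compl open_Union) auto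

lemma snd_to_sphere: "snd (to_sphere z) = 1 - 2 / ((cmod z)\<^sup>2 + 1)"
proof -
  have "(cmod z)\<^sup>2 + 1 > 0" by (simp add: add_nonneg_pos)
  thus ?thesis by (simp add: to_sphere_def field_simps)
qed

lemma continuous_to_sphere: "continuous_on UNIV to_sphere"
proof -
  have "1 + (cmod z)\<^sup>2 \<noteq> 0" "(cmod z)\<^sup>2 + 1 \<noteq> 0" for z
    using zero_le_power2[of "cmod z"] by linarith+
  thus ?thesis unfolding to_sphere_def by (intro continuous_intros) auto
qed

lemma continuous_funpow:
  fixes f :: "'a::topological_space \<Rightarrow> 'a"
  assumes "continuous_on UNIV f"
  shows "continuous_on UNIV (f ^^ n)"
proof (induction n)
  case (Suc n)
  have "continuous_on UNIV (f \<circ> (f ^^ n))"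
    by (rule continuous_on_compose[OF Suc]) (rule continuous_on_subset[OF assms], simp)
  thus ?case by simp
qed simp

text \<open>The second coordinate of the limit function is continuous, and it is the height on the
  sphere: where it is at least 1/2 the iterates are near infinity, elsewhere they are bounded.\<close>

lemma normal_imp_quasi_normal:
  assumes f: "continuous_on UNIV f" and U: "open U" and norm: "normal_family_on U (range (\<lambda>n. f ^^ n))"
  shows "quasi_normal f U"
  unfolding quasi_normal_def
proof (intro allI impI)
  fix \<sigma> :: "nat \<Rightarrow> nat" assume "strict_mono \<sigma>"
  have "range (\<lambda>n. f ^^ \<sigma> n) \<subseteq> range (\<lambda>n. f ^^ n)" by auto
  from norm[unfolded normal_family_on_def, THEN spec, THEN mp, OF this]
  obtain k g where k: "strict_mono k"
    and g: "\<And>K. compact K \<Longrightarrow> K \<subseteq> U \<Longrightarrow> uniform_limit K (\<lambda>n z. to_sphere ((f ^^ \<sigma> (k n)) z)) g sequentially"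
    by blast
  show "\<exists>\<tau>. strict_mono \<tau> \<and> (\<forall>u\<in>U. locally_settled (\<lambda>n. f ^^ \<sigma> (\<tau> n)) u)"
  proof (rule exI[of _ k], intro conjI ballI)
    show "strict_mono k" by (rule k)
    fix u assume u: "u \<in> U"
    obtain e where e: "e > 0" "cball u e \<subseteq> U" using U u open_contains_cball by blast
    have lim: "uniform_limit (cball u e) (\<lambda>n z. to_sphere ((f ^^ \<sigma> (k n)) z)) g sequentially"
      by (rule g[OF compact_cball e(2)])
    have cont: "continuous_on (cball u e) g"
    proof (rule uniform_limit_theorem[OF _ lim])
      have "continuous_on (cball u e) (\<lambda>z. to_sphere ((f ^^ \<sigma> (k n)) z))" for n
        by (rule continuous_on_compose2[OF continuous_to_sphere continuous_on_subset[OF continuous_funpow[OF f]]]) auto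
      thus "\<forall>\<^sub>F n in sequentially. continuous_on (cball u e) (\<lambda>z. to_sphere ((f ^^ \<sigma> (k n)) z))" by simp
    qed simp
    have "continuous (at u) g"
      using continuous_on_interior[OF cont] e(1) by (simp add: interior_cball)
    then obtain d where d: "d > 0" "\<And>v. dist v u < d \<Longrightarrow> dist (g v) (g u) < 1/8"
      unfolding continuous_at_eps_delta by (metis zero_less_divide_1_iff zero_less_numeral)
    have ev: "\<forall>\<^sub>F n in sequentially. \<forall>v\<in>cball u e. dist (to_sphere ((f ^^ \<sigma> (k n)) v)) (g v) < 1/8"
      using uniform_limitD[OF lim, of "1/8"] by simp
    define V where "V = ball u (min d e)"
    have V: "open V" "u \<in> V" using d e by (auto simp: V_def)
    have close: "\<forall>\<^sub>F n in sequentially. \<forall>v\<in>V. \<bar>snd (to_sphere ((f ^^ \<sigma> (k n)) v)) - snd (g u)\<bar> < 1/4"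
      using ev
    proof eventually_elim
      case (elim n)
      show ?case
      proof
        fix v assume v: "v \<in> V"
        hence 1: "dist (to_sphere ((f ^^ \<sigma> (k n)) v)) (g v) < 1/8" using elim by (auto simp: V_def)
        have 2: "dist (g v) (g u) < 1/8" using v by (intro d(2)) (auto simp: V_def dist_commute)
        have "dist (snd (to_sphere ((f ^^ \<sigma> (k n)) v))) (snd (g u)) \<le> dist (to_sphere ((f ^^ \<sigma> (k n)) v)) (g u)"
          by (rule dist_snd_le)
        also have "\<dots> < 1/4" using dist_triangle[of "to_sphere ((f ^^ \<sigma> (k n)) v)" "g u" "g v"] 1 2 by linarith
        finally show "\<bar>snd (to_sphere ((f ^^ \<sigma> (k n)) v)) - snd (g u)\<bar> < 1/4" by (simp add: dist_real_def)
      qed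
    qed
    have "(\<forall>\<^sub>F n in sequentially. \<forall>v\<in>V. norm ((f ^^ \<sigma> (k n)) v) > 1) \<or>
         (\<exists>B. \<forall>\<^sub>F n in sequentially. \<forall>v\<in>V. norm ((f ^^ \<sigma> (k n)) v) \<le> B)"
    proof (cases "snd (g u) \<ge> 1/2")
      case True
      have "\<forall>\<^sub>F n in sequentially. \<forall>v\<in>V. norm ((f ^^ \<sigma> (k n)) v) > 1"
        using close
      proof eventually_elim
        case (elim n)
        show ?case
        proof
          fix v assume v: "v \<in> V"
          let ?w = "(f ^^ \<sigma> (k n)) v"
          have "snd (to_sphere ?w) > 0" using bspec[OF elim v] True by linarith
          hence "2 / ((cmod ?w)\<^sup>2 + 1) < 1" by (simp add: snd_to_sphere)
          hence "1\<^sup>2 < (cmod ?w)\<^sup>2" by (simp add: divide_less_eq add_nonneg_pos split: if_splits)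
          thus "norm ?w > 1" by (rule power2_less_imp_less) simp
        qed
      qed
      thus ?thesis by blast
    next
      case False
      have "\<forall>\<^sub>F n in sequentially. \<forall>v\<in>V. norm ((f ^^ \<sigma> (k n)) v) \<le> 4"
        using close
      proof eventually_elim
        case (elim n)
        show ?case
        proof
          fix v assume v: "v \<in> V"
          let ?w = "(f ^^ \<sigma> (k n)) v"
          have "snd (to_sphere ?w) < 3/4" using bspec[OF elim v] False by linarith
          hence "2 / ((cmod ?w)\<^sup>2 + 1) > 1/4" by (simp add: snd_to_sphere)
          hence "(cmod ?w)\<^sup>2 \<le> 4\<^sup>2" by (simp add: less_divide_eq add_nonneg_pos split: if_splits)
          thus "norm ?w \<le> 4" by (rule power2_le_imp_le) simp
        qed
      qed
      thus ?thesis by blast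
    qed
    thus "locally_settled (\<lambda>n. f ^^ \<sigma> (k n)) u"
      unfolding locally_settled_def using V by blast
  qed
qed

lemma quasi_julia_set_subset_julia_set:
  assumes "continuous_on UNIV f"
  shows "quasi_julia_set f \<subseteq> julia_set f"
  using normal_imp_quasi_normal[OF assms] unfolding quasi_julia_set_def julia_set_def fatou_set_def by blast

text \<open>Apply quasi-normality to the exponents \<open>Suc (\<sigma> n)\<close>; the image of a neighbourhood is open by the
  open mapping theorem.\<close>

lemma quasi_normal_image:
  assumes hol: "f holomorphic_on UNIV" and nc: "\<not> f constant_on UNIV" and U: "open U" "quasi_normal f U"
  shows "quasi_normal f (f ` U)"
  unfolding quasi_normal_def
proof (intro allI impI)
  fix \<sigma> :: "nat \<Rightarrow> nat" assume \<sigma>: "strict_mono \<sigma>"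
  hence "strict_mono (\<lambda>n. Suc (\<sigma> n))" by (auto simp: strict_mono_def)
  then obtain \<tau> where \<tau>: "strict_mono \<tau>" "\<And>u. u \<in> U \<Longrightarrow> locally_settled (\<lambda>n. f ^^ Suc (\<sigma> (\<tau> n))) u"
    using quasi_normalE[OF U(2)] by blast
  have "locally_settled (\<lambda>n. f ^^ \<sigma> (\<tau> n)) w" if w: "w \<in> f ` U" for w
  proof -
    obtain u where u: "u \<in> U" "w = f u" using w by blast
    obtain V where V: "open V" "u \<in> V"
        "(\<forall>\<^sub>F n in sequentially. \<forall>v\<in>V. norm ((f ^^ Suc (\<sigma> (\<tau> n))) v) > 1) \<or>
         (\<exists>B. \<forall>\<^sub>F n in sequentially. \<forall>v\<in>V. norm ((f ^^ Suc (\<sigma> (\<tau> n))) v) \<le> B)"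
      using \<tau>(2)[OF u(1)] unfolding locally_settled_def by blast
    have "open (f ` V)" by (rule open_mapping_thm[OF hol _ _ V(1) _ nc]) auto
    moreover have "w \<in> f ` V" using V u by blast
    moreover have "(\<forall>\<^sub>F n in sequentially. \<forall>v\<in>f ` V. norm ((f ^^ \<sigma> (\<tau> n)) v) > 1) \<or>
         (\<exists>B. \<forall>\<^sub>F n in sequentially. \<forall>v\<in>f ` V. norm ((f ^^ \<sigma> (\<tau> n)) v) \<le> B)"
      using V(3) by (simp add: funpow_Suc_right del: funpow.simps)
    ultimately show ?thesis unfolding locally_settled_def by blast
  qed
  thus "\<exists>\<tau>. strict_mono \<tau> \<and> (\<forall>u\<in>f ` U. locally_settled (\<lambda>n. f ^^ \<sigma> (\<tau> n)) u)"
    using \<tau>(1) by blast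
qed

lemma quasi_julia_set_backward_invariant:
  assumes hol: "f holomorphic_on UNIV" and nc: "\<not> f constant_on UNIV" and z: "(f ^^ k) z \<in> quasi_julia_set f"
  shows "z \<in> quasi_julia_set f"
  using z
proof (induction k)
  case (Suc k)
  have "w \<in> quasi_julia_set f" if "f w \<in> quasi_julia_set f" for w
  proof (rule ccontr)
    assume "w \<notin> quasi_julia_set f"
    then obtain U where U: "open U" "quasi_normal f U" "w \<in> U" unfolding quasi_julia_set_def by blast
    have "open (f ` U)" by (rule open_mapping_thm[OF hol _ _ U(1) _ nc]) auto
    moreover have "quasi_normal f (f ` U)" by (rule quasi_normal_image[OF hol nc U(1,2)])
    ultimately show False using that U(3) unfolding quasi_julia_set_def by blast
  qed
  thus ?case using Suc by simp
qed simp

lemma quasi_normal_Un: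
  assumes "quasi_normal f U" "quasi_normal f U'"
  shows "quasi_normal f (U \<union> U')"
  unfolding quasi_normal_def
proof (intro allI impI)
  fix \<sigma> :: "nat \<Rightarrow> nat" assume \<sigma>: "strict_mono \<sigma>"
  obtain \<tau>1 where \<tau>1: "strict_mono \<tau>1" "\<And>u. u \<in> U \<Longrightarrow> locally_settled (\<lambda>n. f ^^ \<sigma> (\<tau>1 n)) u"
    using quasi_normalE[OF assms(1) \<sigma>] by blast
  have "strict_mono (\<lambda>n. \<sigma> (\<tau>1 n))" using \<sigma> \<tau>1(1) by (auto simp: strict_mono_def)
  then obtain \<tau>2 where \<tau>2: "strict_mono \<tau>2" "\<And>u. u \<in> U' \<Longrightarrow> locally_settled (\<lambda>n. f ^^ \<sigma> (\<tau>1 (\<tau>2 n))) u"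
    using quasi_normalE[OF assms(2)] by blast
  have sub: "\<forall>\<^sub>F n in sequentially. P (\<tau>1 (\<tau>2 n))" if "\<forall>\<^sub>F n in sequentially. P (\<tau>1 n)" for P
    using eventually_subseq[OF \<tau>2(1) that] .
  have "locally_settled (\<lambda>n. f ^^ \<sigma> (\<tau>1 (\<tau>2 n))) u" if u: "u \<in> U" for u
  proof -
    obtain V where V: "open V" "u \<in> V"
        "(\<forall>\<^sub>F n in sequentially. \<forall>v\<in>V. norm ((f ^^ \<sigma> (\<tau>1 n)) v) > 1) \<or>
         (\<exists>B. \<forall>\<^sub>F n in sequentially. \<forall>v\<in>V. norm ((f ^^ \<sigma> (\<tau>1 n)) v) \<le> B)"
      using \<tau>1(2)[OF u] unfolding locally_settled_def by blast
    from V(3) have "(\<forall>\<^sub>F n in sequentially. \<forall>v\<in>V. norm ((f ^^ \<sigma> (\<tau>1 (\<tau>2 n))) v) > 1) \<or>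
         (\<exists>B. \<forall>\<^sub>F n in sequentially. \<forall>v\<in>V. norm ((f ^^ \<sigma> (\<tau>1 (\<tau>2 n))) v) \<le> B)"
    proof
      assume "\<forall>\<^sub>F n in sequentially. \<forall>v\<in>V. norm ((f ^^ \<sigma> (\<tau>1 n)) v) > 1"
      from sub[of "\<lambda>m. \<forall>v\<in>V. norm ((f ^^ \<sigma> m) v) > 1", OF this] show ?thesis by (rule disjI1)
    next
      assume "\<exists>B. \<forall>\<^sub>F n in sequentially. \<forall>v\<in>V. norm ((f ^^ \<sigma> (\<tau>1 n)) v) \<le> B"
      then obtain B where "\<forall>\<^sub>F n in sequentially. \<forall>v\<in>V. norm ((f ^^ \<sigma> (\<tau>1 n)) v) \<le> B" ..
      from sub[of "\<lambda>m. \<forall>v\<in>V. norm ((f ^^ \<sigma> m) v) \<le> B", OF this] show ?thesis by blast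
    qed
    thus ?thesis unfolding locally_settled_def using V(1,2) by blast
  qed
  moreover have "strict_mono (\<lambda>n. \<tau>1 (\<tau>2 n))" using \<tau>1(1) \<tau>2(1) by (auto simp: strict_mono_def)
  ultimately show "\<exists>\<tau>. strict_mono \<tau> \<and> (\<forall>u\<in>U \<union> U'. locally_settled (\<lambda>n. f ^^ \<sigma> (\<tau> n)) u)"
    using \<tau>2(2) by (intro exI[of _ "\<lambda>n. \<tau>1 (\<tau>2 n)"]) blast
qed

lemma quasi_normal_nbhd_of_compact:
  assumes K: "compact K" "K \<inter> quasi_julia_set f = {}"
  obtains U where "K \<subseteq> U" "quasi_normal f U"
proof -
  have "K \<subseteq> \<Union>{U. open U \<and> quasi_normal f U}" using K(2) unfolding quasi_julia_set_def by blast
  then obtain \<U> where \<U>: "\<U> \<subseteq> {U. open U \<and> quasi_normal f U}" "finite \<U>" "K \<subseteq> \<Union>\<U>"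
    using compactE[OF K(1)] by (metis (no_types, lifting) mem_Collect_eq)
  have "quasi_normal f (\<Union>\<U>)" using \<U>(2,1)
  proof (induction \<U> rule: finite_induct)
    case empty
    show ?case unfolding quasi_normal_def by (auto intro: strict_mono_id exI[of _ id])
  next
    case (insert x F)
    thus ?case by (auto intro: quasi_normal_Un)
  qed
  thus ?thesis using that \<U>(3) by blast
qed

text \<open>Harnack's inequality for the positive harmonic function \<open>ln |g|\<close>.\<close>

lemma log_modulus_harnack:
  assumes hol: "g holomorphic_on ball a \<rho>" and gt: "\<And>w. w \<in> ball a \<rho> \<Longrightarrow> norm (g w) > 1"
    and z: "z \<in> ball a \<rho>"
  shows "(\<rho> - dist a z) * ln (norm (g a)) \<le> (\<rho> + dist a z) * ln (norm (g z))"
    and "(\<rho> - dist a z) * ln (norm (g z)) \<le> (\<rho> + dist a z) * ln (norm (g a))"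
proof -
  have nz: "g w \<noteq> 0" if "w \<in> ball a \<rho>" for w using gt[OF that] by auto
  obtain h where h: "h holomorphic_on ball a \<rho>" "\<And>w. w \<in> ball a \<rho> \<Longrightarrow> g w = exp (h w)"
    using contractible_imp_holomorphic_log[OF hol _ nz] convex_imp_contractible[of "ball a \<rho>"] by auto
  have Re: "Re (h w) = ln (norm (g w))" if "w \<in> ball a \<rho>" for w using h(2)[OF that] by simp
  have pos: "Re (h w) > 0" if "w \<in> ball a \<rho>" for w unfolding Re[OF that] by (rule ln_gt_zero[OF gt[OF that]])
  have a: "a \<in> ball a \<rho>" using z by (metis centre_in_ball empty_iff ball_eq_empty not_le)
  show "(\<rho> - dist a z) * ln (norm (g a)) \<le> (\<rho> + dist a z) * ln (norm (g z))"
    "(\<rho> - dist a z) * ln (norm (g z)) \<le> (\<rho> + dist a z) * ln (norm (g a))"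
    using positive_real_part_oscillation(2,3)[OF h(1) pos z] by (simp_all add: Re[OF a] Re[OF z])
qed

lemma filterlim_infinity_of_log_le:
  fixes a b :: "nat \<Rightarrow> complex"
  assumes "filterlim a at_infinity sequentially" "\<forall>\<^sub>F n in sequentially. norm (b n) > 1 \<and> ln (norm (a n)) \<le> 3 * ln (norm (b n))"
  shows "filterlim b at_infinity sequentially"
proof -
  have "filterlim (\<lambda>n. ln (norm (a n))) at_top sequentially"
    using filterlim_compose[OF ln_at_top filterlim_at_infinity_imp_norm_at_top[OF assms(1)]] .
  hence "filterlim (\<lambda>n. (1/3) * ln (norm (a n))) at_top sequentially"
    by (intro filterlim_tendsto_pos_mult_at_top[OF tendsto_const]) auto
  hence "filterlim (\<lambda>n. exp ((1/3) * ln (norm (a n)))) at_top sequentially"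
    by (rule filterlim_compose[OF exp_at_top])
  hence "filterlim (\<lambda>n. norm (b n)) at_top sequentially"
  proof (rule filterlim_at_top_mono)
    show "\<forall>\<^sub>F n in sequentially. exp ((1/3) * ln (norm (a n))) \<le> norm (b n)"
      using assms(2)
    proof eventually_elim
      case (elim n)
      hence "exp ((1/3) * ln (norm (a n))) \<le> exp (ln (norm (b n)))" by (subst exp_le_cancel_iff) linarith
      moreover have "exp (ln (norm (b n))) = norm (b n)" using elim by (intro exp_ln) linarith
      ultimately show ?case by simp
    qed
  qed
  thus ?thesis by (rule filterlim_norm_at_top_imp_at_infinity)
qed

lemma holomorphic_funpow:
  assumes "f holomorphic_on UNIV"
  shows "(f ^^ n) holomorphic_on UNIV"
proof (induction n)
  case (Suc n)
  have "(f \<circ> (f ^^ n)) holomorphic_on UNIV"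
    by (rule holomorphic_on_compose[OF Suc holomorphic_on_subset[OF assms]]) simp
  thus ?case by (simp only: funpow.simps(2))
qed (simp add: id_def)

text \<open>By Harnack's inequality, escape along the subsequence is a locally constant property on \<open>W\<close>,
  so it spreads from \<open>y\<close> to the connected set \<open>W\<close>.\<close>

lemma escape_spreads:
  assumes hol: "f holomorphic_on UNIV" and U: "quasi_normal f U" and W: "open W" "connected W" "W \<subseteq> U"
    and y: "y \<in> W" "y \<in> escaping_set f"
  obtains \<tau> :: "nat \<Rightarrow> nat" where "strict_mono \<tau>"
    "\<And>u. u \<in> W \<Longrightarrow> \<exists>V. open V \<and> u \<in> V \<and> (\<forall>\<^sub>F n in sequentially. \<forall>v\<in>V. norm ((f ^^ \<tau> n) v) > 1)"
proof -
  have "strict_mono (\<lambda>n::nat. n)" by (simp add: strict_mono_def)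
  then obtain \<tau> where \<tau>: "strict_mono \<tau>" "\<And>u. u \<in> U \<Longrightarrow> locally_settled (\<lambda>n. f ^^ \<tau> n) u"
    using quasi_normalE[OF U] by blast
  define E where "E = {u. filterlim (\<lambda>n. (f ^^ \<tau> n) u) at_infinity sequentially}"
  have loc: "\<exists>V. open V \<and> u \<in> V \<and> (\<forall>v\<in>V. v \<in> E \<longleftrightarrow> u \<in> E)" if u: "u \<in> W" for u
  proof -
    obtain V where V: "open V" "u \<in> V" "(\<forall>\<^sub>F n in sequentially. \<forall>v\<in>V. norm ((f ^^ \<tau> n) v) > 1) \<or>
         (\<exists>B. \<forall>\<^sub>F n in sequentially. \<forall>v\<in>V. norm ((f ^^ \<tau> n) v) \<le> B)"
      using \<tau>(2) u W(3) unfolding locally_settled_def by blast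
    show ?thesis
    proof (cases "\<forall>\<^sub>F n in sequentially. \<forall>v\<in>V. norm ((f ^^ \<tau> n) v) > 1")
      case True
      obtain \<rho> where \<rho>: "\<rho> > 0" "ball u \<rho> \<subseteq> V" using V(1,2) openE by blast
      have cmp: "\<forall>\<^sub>F n in sequentially. norm ((f ^^ \<tau> n) v) > 1 \<and> norm ((f ^^ \<tau> n) u) > 1 \<and>
         ln (norm ((f ^^ \<tau> n) u)) \<le> 3 * ln (norm ((f ^^ \<tau> n) v)) \<and>
         ln (norm ((f ^^ \<tau> n) v)) \<le> 3 * ln (norm ((f ^^ \<tau> n) u))" if v: "v \<in> ball u (\<rho>/2)" for v
        using True
      proof eventually_elim
        case (elim n)
        have vb: "v \<in> ball u \<rho>" using v \<rho> by simp
        have g1: "norm ((f ^^ \<tau> n) w) > 1" if "w \<in> ball u \<rho>" for w using elim that \<rho>(2) by blast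
        have h: "(f ^^ \<tau> n) holomorphic_on ball u \<rho>" by (rule holomorphic_on_subset[OF holomorphic_funpow[OF hol]]) simp
        define d where "d = dist u v"
        have d: "0 \<le> d" "d \<le> \<rho> / 2" using v by (auto simp: d_def)
        define a b where "a = ln (norm ((f ^^ \<tau> n) u))" and "b = ln (norm ((f ^^ \<tau> n) v))"
        have ab: "a \<ge> 0" "b \<ge> 0" using g1[of u] g1[OF vb] \<rho>(1) by (auto simp: a_def b_def)
        have H: "(\<rho> - d) * a \<le> (\<rho> + d) * b" "(\<rho> - d) * b \<le> (\<rho> + d) * a"
          using log_modulus_harnack[OF h g1 vb] by (auto simp: a_def b_def d_def)
        have low: "\<rho> / 2 * x \<le> (\<rho> - d) * x" and upp: "(\<rho> + d) * x \<le> \<rho> / 2 * (3 * x)" if "x \<ge> 0" for x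
          using mult_right_mono[of "\<rho> / 2" "\<rho> - d" x] mult_right_mono[of "\<rho> + d" "3 * \<rho> / 2" x] d that by auto
        have "\<rho> / 2 * a \<le> \<rho> / 2 * (3 * b)" "\<rho> / 2 * b \<le> \<rho> / 2 * (3 * a)"
          using order_trans[OF low[OF ab(1)] order_trans[OF H(1) upp[OF ab(2)]]]
            order_trans[OF low[OF ab(2)] order_trans[OF H(2) upp[OF ab(1)]]] .
        hence "a \<le> 3 * b" "b \<le> 3 * a" using \<rho>(1) by (simp_all only: mult_le_cancel_left_pos half_gt_zero)
        thus ?case using g1[OF vb] g1[of u] \<rho>(1) by (simp add: a_def b_def)
      qed
      have "v \<in> E \<longleftrightarrow> u \<in> E" if v: "v \<in> ball u (\<rho>/2)" for v
      proof
        assume "v \<in> E"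
        hence l: "filterlim (\<lambda>n. (f ^^ \<tau> n) v) at_infinity sequentially" by (simp add: E_def)
        have "filterlim (\<lambda>n. (f ^^ \<tau> n) u) at_infinity sequentially"
          by (rule filterlim_infinity_of_log_le[OF l]) (use cmp[OF v] in \<open>auto elim: eventually_mono\<close>)
        thus "u \<in> E" by (simp add: E_def)
      next
        assume "u \<in> E"
        hence l: "filterlim (\<lambda>n. (f ^^ \<tau> n) u) at_infinity sequentially" by (simp add: E_def)
        have "filterlim (\<lambda>n. (f ^^ \<tau> n) v) at_infinity sequentially"
          by (rule filterlim_infinity_of_log_le[OF l]) (use cmp[OF v] in \<open>auto elim: eventually_mono\<close>)
        thus "v \<in> E" by (simp add: E_def)
      qed
      moreover have "open (ball u (\<rho>/2))" "u \<in> ball u (\<rho>/2)" using \<rho>(1) by auto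
      ultimately show ?thesis by blast
    next
      case False
      then obtain B where B: "\<forall>\<^sub>F n in sequentially. \<forall>v\<in>V. norm ((f ^^ \<tau> n) v) \<le> B" using V(3) by blast
      have "v \<notin> E" if v: "v \<in> V" for v
      proof
        assume "v \<in> E"
        hence "filterlim (\<lambda>n. norm ((f ^^ \<tau> n) v)) at_top sequentially"
          unfolding E_def using filterlim_at_infinity_imp_norm_at_top by blast
        hence "\<forall>\<^sub>F n in sequentially. norm ((f ^^ \<tau> n) v) \<ge> B + 1" by (simp add: filterlim_at_top)
        with B have "\<forall>\<^sub>F n in sequentially. False" by eventually_elim (use v in force)
        thus False by simp
      qed
      thus ?thesis using V(1,2) by blast
    qed
  qed
  have op1: "open (W \<inter> E)"
  proof (subst open_subopen, intro ballI)
    fix u assume u: "u \<in> W \<inter> E"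
    then obtain V where V: "open V" "u \<in> V" "\<forall>v\<in>V. v \<in> E \<longleftrightarrow> u \<in> E" using loc by blast
    have "open (V \<inter> W)" using V(1) W(1) by (rule open_Int)
    moreover have "u \<in> V \<inter> W" "V \<inter> W \<subseteq> W \<inter> E" using u V by blast+
    ultimately show "\<exists>T. open T \<and> u \<in> T \<and> T \<subseteq> W \<inter> E" by blast
  qed
  have op2: "open (W - E)"
  proof (subst open_subopen, intro ballI)
    fix u assume u: "u \<in> W - E"
    then obtain V where V: "open V" "u \<in> V" "\<forall>v\<in>V. v \<in> E \<longleftrightarrow> u \<in> E" using loc by blast
    have "open (V \<inter> W)" using V(1) W(1) by (rule open_Int)
    moreover have "u \<in> V \<inter> W" "V \<inter> W \<subseteq> W - E" using u V by blast+
    ultimately show "\<exists>T. open T \<and> u \<in> T \<and> T \<subseteq> W - E" by blast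
  qed
  have yE: "y \<in> E"
  proof -
    have "filterlim (\<lambda>n. (f ^^ n) y) at_infinity sequentially" using y(2) by (simp add: escaping_set_def)
    from filterlim_compose[OF this filterlim_subseq[OF \<tau>(1)]] show ?thesis by (simp add: E_def)
  qed
  have WE: "W \<subseteq> E"
  proof (rule ccontr)
    assume "\<not> W \<subseteq> E"
    hence "(W - E) \<inter> W \<noteq> {}" by blast
    moreover have "(W \<inter> E) \<inter> W \<noteq> {}" using y(1) yE by blast
    ultimately show False using connectedD[OF W(2) op1 op2] by blast
  qed
  have "\<exists>V. open V \<and> u \<in> V \<and> (\<forall>\<^sub>F n in sequentially. \<forall>v\<in>V. norm ((f ^^ \<tau> n) v) > 1)" if u: "u \<in> W" for u
  proof -
    obtain V where V: "open V" "u \<in> V" "(\<forall>\<^sub>F n in sequentially. \<forall>v\<in>V. norm ((f ^^ \<tau> n) v) > 1) \<or>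
         (\<exists>B. \<forall>\<^sub>F n in sequentially. \<forall>v\<in>V. norm ((f ^^ \<tau> n) v) \<le> B)"
      using \<tau>(2) u W(3) unfolding locally_settled_def by blast
    have "\<not> (\<exists>B. \<forall>\<^sub>F n in sequentially. \<forall>v\<in>V. norm ((f ^^ \<tau> n) v) \<le> B)"
    proof
      assume "\<exists>B. \<forall>\<^sub>F n in sequentially. \<forall>v\<in>V. norm ((f ^^ \<tau> n) v) \<le> B"
      then obtain B where B: "\<forall>\<^sub>F n in sequentially. \<forall>v\<in>V. norm ((f ^^ \<tau> n) v) \<le> B" ..
      have "filterlim (\<lambda>n. norm ((f ^^ \<tau> n) u)) at_top sequentially"
        using u WE filterlim_at_infinity_imp_norm_at_top unfolding E_def by blast
      hence "\<forall>\<^sub>F n in sequentially. norm ((f ^^ \<tau> n) u) \<ge> B + 1" by (simp add: filterlim_at_top)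
      with B have "\<forall>\<^sub>F n in sequentially. False" by eventually_elim (use V(2) in force)
      thus False by simp
    qed
    thus ?thesis using V by blast
  qed
  thus ?thesis using that \<tau>(1) by blast
qed

section \<open>The tree of cells\<close>

lemma nested_compact_point:
  fixes Q :: "nat \<Rightarrow> complex set"
  assumes "\<And>i. compact (Q i)" "\<And>i. Q i \<noteq> {}" "\<And>i. Q (Suc i) \<subseteq> Q i"
  obtains y where "\<And>i. y \<in> Q i"
proof -
  have "decseq Q" using assms(3) by (rule decseq_SucI)
  hence "(\<Inter>(range Q)) \<noteq> {}"
    by (intro compact_nest) (auto simp: assms decseq_def)
  thus ?thesis using that by blast
qed

context small_minimum_modulus
begin

lemma cont: "continuous_on UNIV f"
  by (rule holomorphic_on_imp_continuous_on[OF hol])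

text \<open>A substitute for a branch of the inverse of \<open>f ^^ k\<close>: surjectivity onto the annulus provides preimages
  of the discs of a \<open>child_system\<close>, and the Lipschitz bound, with the exponent form of \<open>child_system\<close>, keeps
  these preimages apart.\<close>

definition cell :: "real \<Rightarrow> real \<Rightarrow> complex set \<Rightarrow> nat \<Rightarrow> real \<Rightarrow> bool" where
  "cell \<nu> K Q k s \<longleftrightarrow> compact Q \<and> (f ^^ k) ` Q = annulus K s \<and>
     (\<forall>x\<in>Q. \<forall>y\<in>Q. norm ((f ^^ k) x - (f ^^ k) y) \<le> s powr (1 + \<nu>) * norm (x - y))"

text \<open>The orbit condition makes points in infinitely many successive descendants escape.\<close>

definition descends :: "complex set \<times> nat \<times> real \<Rightarrow> complex set \<times> nat \<times> real \<Rightarrow> bool" where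
  "descends = (\<lambda>(Q', k', s') (Q, k, s). Q' \<subseteq> Q \<and> k \<le> k' \<and> s \<le> s' \<and> (\<forall>x\<in>Q'. \<forall>j. k \<le> j \<and> j \<le> k' \<longrightarrow> s \<le> norm ((f ^^ j) x)))"

lemma descends_trans: "descends A B \<Longrightarrow> descends B C \<Longrightarrow> descends A C"
proof -
  obtain Q1 k1 s1 Q2 k2 s2 Q3 k3 s3 where [simp]: "A = (Q1, k1, s1)" "B = (Q2, k2, s2)" "C = (Q3, k3, s3)"
    by (metis prod_cases3)
  assume AB: "descends A B" and BC: "descends B C"
  have "s3 \<le> norm ((f ^^ j) x)" if "x \<in> Q1" "k3 \<le> j" "j \<le> k1" for x j
  proof (cases "j \<le> k2")
    case True
    thus ?thesis using AB BC that unfolding descends_def by auto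
  next
    case False
    hence "s2 \<le> norm ((f ^^ j) x)" "s3 \<le> s2" using AB BC that unfolding descends_def by auto
    thus ?thesis by linarith
  qed
  thus ?thesis using AB BC unfolding descends_def by auto
qed

lemma root_cell:
  assumes "s \<ge> 1" "\<nu> > 0"
  shows "cell \<nu> K (annulus K s) 0 s"
proof -
  have "1 \<le> s powr (1 + \<nu>)" using assms by (intro ge_one_powr_ge_zero) auto
  hence "1 * norm (x - y) \<le> s powr (1 + \<nu>) * norm (x - y)" for x y :: complex by (intro mult_right_mono) auto
  thus ?thesis by (simp add: cell_def compact_annulus)
qed

text \<open>Separation is pulled back through the Lipschitz bound: points in different children have images
  under \<open>f ^^ k\<close> at distance at least \<open>s * \<delta>\<close>, hence distance at least \<open>\<delta> * s powr - \<nu>\<close> themselves.\<close>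

lemma child_cell:
  assumes Q: "cell \<nu> K Q k s" and K: "K \<ge> 16" and s: "s \<ge> 1" and \<nu>: "\<nu> > 0"
    and ch: "child_system \<nu> K s \<delta> n Ds s'" and i: "i < n"
  defines "R \<equiv> \<lambda>i. Q \<inter> (f ^^ k) -` Ds i \<inter> (f ^^ Suc k) -` annulus K (s' i)"
  shows "cell \<nu> K (R i) (Suc k) (s' i)" "descends (R i, Suc k, s' i) (Q, k, s)" "2 * s \<le> s' i"
    and "(f ^^ k) ` R i \<subseteq> Ds i"
    and "\<And>j x y. j < i \<Longrightarrow> x \<in> R i \<Longrightarrow> y \<in> R j \<Longrightarrow> \<delta> * s powr - \<nu> \<le> norm (x - y)"
proof -
  have D: "compact (Ds i)" "\<And>z. z \<in> Ds i \<Longrightarrow> sqrt K * s / 2 \<le> norm z \<and> norm z \<le> 4 * (sqrt K * s)"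
     "annulus K (s' i) \<subseteq> f ` Ds i"
     "\<And>z w. z \<in> Ds i \<Longrightarrow> w \<in> Ds i \<Longrightarrow> norm (f z - f w) \<le> (s' i / s) powr (1 + \<nu>) * norm (z - w)"
    using ch i unfolding child_system_def by blast+
  show s2: "2 * s \<le> s' i" using ch i unfolding child_system_def by blast
  have s'0: "s' i > 0" using s2 s by linarith
  have Qc: "compact Q" "(f ^^ k) ` Q = annulus K s"
    "\<And>x y. x \<in> Q \<Longrightarrow> y \<in> Q \<Longrightarrow> norm ((f ^^ k) x - (f ^^ k) y) \<le> s powr (1 + \<nu>) * norm (x - y)"
    using Q unfolding cell_def by blast+
  have sK: "sqrt K \<ge> 4" using real_sqrt_le_mono[OF K] by simp
  have Dsub: "Ds i \<subseteq> annulus K s"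
  proof
    fix z assume "z \<in> Ds i"
    note z = D(2)[OF this]
    have "4 * s \<le> sqrt K * s" using sK s by (intro mult_right_mono) auto
    moreover have "sqrt K * (4 * s) \<le> sqrt K * (sqrt K * s)" using calculation sK by (intro mult_left_mono) linarith+
    moreover have "sqrt K * (sqrt K * s) = K * s" using K by (simp flip: mult.assoc)
    moreover have "sqrt K * (4 * s) = 4 * (sqrt K * s)" by simp
    ultimately have "s \<le> norm z" "norm z \<le> K * s" using z s by linarith+
    thus "z \<in> annulus K s" by (simp add: annulus_def)
  qed
  have clv: "closed ((f ^^ m) -` S)" if "closed S" for m S
    using continuous_closed_vimage[OF that] continuous_funpow[OF cont] by (metis continuous_on_eq_continuous_at iso_tuple_UNIV_I open_UNIV)
  have "compact (R i)"
    unfolding R_def by (intro compact_Int_closed Qc(1) clv closed_annulus compact_imp_closed D(1))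
  moreover have "(f ^^ Suc k) ` R i = annulus K (s' i)"
  proof
    show "(f ^^ Suc k) ` R i \<subseteq> annulus K (s' i)" by (auto simp: R_def)
    show "annulus K (s' i) \<subseteq> (f ^^ Suc k) ` R i"
    proof
      fix w assume w: "w \<in> annulus K (s' i)"
      then obtain u where u: "u \<in> Ds i" "w = f u" using D(3) by blast
      then obtain x where x: "x \<in> Q" "u = (f ^^ k) x" using Dsub Qc(2) by blast
      have "x \<in> R i" using x u w by (simp add: R_def)
      moreover have "w = (f ^^ Suc k) x" using u x by simp
      ultimately show "w \<in> (f ^^ Suc k) ` R i" by blast
    qed
  qed
  moreover have "norm ((f ^^ Suc k) x - (f ^^ Suc k) y) \<le> s' i powr (1 + \<nu>) * norm (x - y)" if xy: "x \<in> R i" "y \<in> R i" for x y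
  proof -
    have "norm ((f ^^ Suc k) x - (f ^^ Suc k) y) \<le> (s' i / s) powr (1 + \<nu>) * norm ((f ^^ k) x - (f ^^ k) y)"
      using D(4)[of "(f ^^ k) x" "(f ^^ k) y"] xy by (simp add: R_def)
    also have "\<dots> \<le> (s' i / s) powr (1 + \<nu>) * (s powr (1 + \<nu>) * norm (x - y))"
      using Qc(3)[of x y] xy by (intro mult_left_mono) (auto simp: R_def)
    also have "\<dots> = s' i powr (1 + \<nu>) * norm (x - y)"
      using s s'0 by (simp add: powr_divide)
    finally show ?thesis .
  qed
  ultimately show "cell \<nu> K (R i) (Suc k) (s' i)" unfolding cell_def by blast
  have "s \<le> norm ((f ^^ j) x)" if x: "x \<in> R i" and j: "k \<le> j" "j \<le> Suc k" for x j
  proof (cases "j = k")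
    case True
    have "(f ^^ k) x \<in> annulus K s" using x Qc(2) by (auto simp: R_def)
    thus ?thesis using True by (simp add: annulus_def)
  next
    case False
    hence "j = Suc k" using j by simp
    moreover have "(f ^^ Suc k) x \<in> annulus K (s' i)" using x by (simp add: R_def)
    ultimately have "s' i \<le> norm ((f ^^ j) x)" by (simp add: annulus_def)
    thus ?thesis using s2 s by linarith
  qed
  thus "descends (R i, Suc k, s' i) (Q, k, s)" unfolding descends_def using s2 s by (auto simp: R_def)
  show "(f ^^ k) ` R i \<subseteq> Ds i" by (auto simp: R_def)
  fix j x y assume j: "j < i" and x: "x \<in> R i" and y: "y \<in> R j"
  have "s * \<delta> \<le> norm ((f ^^ k) x - (f ^^ k) y)"
    using ch i j x y unfolding child_system_def R_def by blast
  also have "\<dots> \<le> s powr (1 + \<nu>) * norm (x - y)" using x y by (intro Qc(3)) (auto simp: R_def)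
  also have "\<dots> = s * (s powr \<nu> * norm (x - y))" using s by (simp add: powr_add)
  finally have "\<delta> \<le> s powr \<nu> * norm (x - y)" using s by simp
  hence "\<delta> * s powr - \<nu> \<le> s powr \<nu> * norm (x - y) * s powr - \<nu>" by (intro mult_right_mono) auto
  also have "\<dots> = norm (x - y) * (s powr \<nu> * s powr - \<nu>)" by simp
  also have "s powr \<nu> * s powr - \<nu> = 1" using s by (simp flip: powr_add)
  finally show "\<delta> * s powr - \<nu> \<le> norm (x - y)" by simp
qed

lemma escaping_of_descending_cells:
  assumes dsc: "\<And>i. descends (Q (Suc i), k (Suc i), s (Suc i)) (Q i, k i, s i)"
    and k: "\<And>i. k i < k (Suc i)" and s: "\<And>i. 2 * s i \<le> s (Suc i)" "s 0 \<ge> 1" and x: "\<And>i. x \<in> Q i"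
  shows "x \<in> escaping_set f"
proof -
  have dd: "descends (Q (Suc (i + m)), k (Suc (i + m)), s (Suc (i + m))) (Q i, k i, s i)" for i m
  proof (induction m)
    case 0 thus ?case using dsc[of i] by simp
  next
    case (Suc m)
    thus ?case using descends_trans[OF dsc[of "Suc (i + m)"]] by simp
  qed
  have km: "m \<le> k m" for m
  proof (induction m)
    case (Suc m) thus ?case using k[of m] by simp
  qed simp
  have s2: "s i \<ge> 2 ^ i" for i
  proof (induction i)
    case (Suc i) thus ?case using s(1)[of i] by simp
  qed (use s(2) in simp)
  have low: "s i \<le> norm ((f ^^ j) x)" if j: "k i \<le> j" for i j
  proof -
    have "j \<le> k (Suc (i + j))" using km[of "Suc (i + j)"] by linarith
    thus ?thesis using dd[of i j] x j unfolding descends_def by auto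
  qed
  have "filterlim (\<lambda>n. norm ((f ^^ n) x)) at_top sequentially"
  proof (subst filterlim_at_top, intro allI)
    fix Z :: real
    obtain i where i: "Z < 2 ^ i" using real_arch_pow[of 2 Z] by auto
    show "\<forall>\<^sub>F n in sequentially. Z \<le> norm ((f ^^ n) x)"
      using eventually_ge_at_top[of "k i"]
    proof eventually_elim
      case (elim n)
      show ?case using low[OF elim] s2[of i] i by linarith
    qed
  qed
  thus ?thesis by (simp add: escaping_set_def filterlim_norm_at_top_imp_at_infinity)
qed

lemma productive_child:
  assumes P: "productive \<epsilon> \<nu> K s" and Q: "cell \<nu> K Q k s" and K: "K \<ge> 16" and s: "s \<ge> 1" and \<nu>: "\<nu> > 0"
  obtains Q' s' where "cell \<nu> K Q' (Suc k) s'" "descends (Q', Suc k, s') (Q, k, s)" "2 * s \<le> s'"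
    "\<And>x. x \<in> Q' \<Longrightarrow> sqrt K * s / 2 \<le> norm ((f ^^ k) x) \<and> norm ((f ^^ k) x) \<le> 4 * (sqrt K * s)"
proof -
  obtain \<delta> n Ds s' where ch: "0 < \<delta>" "(s powr \<nu> / \<delta>) powr (2 - \<epsilon>) \<le> real n" "child_system \<nu> K s \<delta> n Ds s'"
    using P unfolding productive_def by blast
  have "0 < (s powr \<nu> / \<delta>) powr (2 - \<epsilon>)" using s ch(1) by simp
  hence n: "0 < n" using ch(2) by (cases n) auto
  note c = child_cell[OF Q K s \<nu> ch(3) n]
  have "sqrt K * s / 2 \<le> norm ((f ^^ k) x) \<and> norm ((f ^^ k) x) \<le> 4 * (sqrt K * s)"
    if "x \<in> Q \<inter> (f ^^ k) -` Ds 0 \<inter> (f ^^ Suc k) -` annulus K (s' 0)" for x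
    using ch(3) n that unfolding child_system_def by blast
  thus ?thesis using that[OF c(1-3)] by blast
qed

text \<open>If the annulus missed the set, the iterates would be quasi-normal near it. A nested sequence of
  cells contains an escaping point \<open>y\<close>, so a subsequence of the iterates exceeds 1 in absolute value on a slightly
  smaller annulus \<open>A\<close>. The first child \<open>Q 1\<close> lies in the middle of the annulus, so in logarithmic coordinates any two of
  its points have distance at most 10, while discs of radius \<open>\<rho> = ln K / 2 - 4\<close> about them stay in \<open>A\<close>. For \<open>\<rho> \<ge> 21 / (1 - c)\<close>
  Harnack's inequality makes the ratios of \<open>ln |f^n|\<close> on \<open>Q 1\<close> larger than \<open>c\<close>. But \<open>f^m\<close> maps \<open>Q m\<close> onto an annulus
  containing a full circle, where \<open>ln |f|\<close> takes the value \<open>logM r\<close> and a value at most \<open>c * logM r\<close>.\<close>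

lemma quasi_julia_set_meets_annulus:
  assumes K: "ln K \<ge> 2 * (21 / (1 - c) + 4)" "K \<ge> 16" and \<nu>: "\<nu> > 0"
    and P: "\<And>s. s \<ge> S \<Longrightarrow> productive \<epsilon> \<nu> K s" and S: "S \<ge> radius0" and s: "s \<ge> S"
  shows "quasi_julia_set f \<inter> annulus K s \<noteq> {}"
proof
  assume empty: "quasi_julia_set f \<inter> annulus K s = {}"
  have s1: "s \<ge> 1" and S1: "S \<ge> 1" using s S radius0(1) by linarith+
  obtain U where U: "annulus K s \<subseteq> U" "quasi_normal f U"
    using quasi_normal_nbhd_of_compact[OF compact_annulus] empty by (metis inf_commute)
  define good where "good = (\<lambda>(i::nat) (N :: complex set \<times> real). cell \<nu> K (fst N) i (snd N) \<and> s \<le> snd N \<and> fst N \<subseteq> annulus K s \<and>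
     (i \<ge> 1 \<longrightarrow> fst N \<subseteq> {z. sqrt K * s / 2 \<le> norm z \<and> norm z \<le> 4 * (sqrt K * s)}))"
  define step where "step = (\<lambda>(i::nat) (N :: complex set \<times> real) N'. descends (fst N', Suc i, snd N') (fst N, i, snd N) \<and> 2 * snd N \<le> snd N')"
  have "\<exists>N. \<forall>i. good i (N i) \<and> step i (N i) (N (Suc i)) \<and> (i = 0 \<longrightarrow> N i = (annulus K s, s))"
  proof -
    have "\<exists>N. \<forall>i. (good i (N i) \<and> (i = 0 \<longrightarrow> N i = (annulus K s, s))) \<and> step i (N i) (N (Suc i))"
    proof (rule dependent_nat_choice)
      show "\<exists>x. good 0 x \<and> (0 = 0 \<longrightarrow> x = (annulus K s, s))"
        using root_cell[OF s1 \<nu>] by (intro exI[of _ "(annulus K s, s)"]) (auto simp: good_def)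
      fix N :: "complex set \<times> real" and i assume N: "good i N \<and> (i = 0 \<longrightarrow> N = (annulus K s, s))"
      have sN: "snd N \<ge> S" "snd N \<ge> 1" using N s s1 by (auto simp: good_def)
      have cN: "cell \<nu> K (fst N) i (snd N)" using N by (simp add: good_def)
      obtain Q' s' where c: "cell \<nu> K Q' (Suc i) s'" "descends (Q', Suc i, s') (fst N, i, snd N)" "2 * snd N \<le> s'"
        "\<And>x. x \<in> Q' \<Longrightarrow> sqrt K * snd N / 2 \<le> norm ((f ^^ i) x) \<and> norm ((f ^^ i) x) \<le> 4 * (sqrt K * snd N)"
        using productive_child[OF P[OF sN(1)] cN K(2) sN(2) \<nu>] by blast
      have sub: "Q' \<subseteq> fst N" using c(2) by (simp add: descends_def)
      have "Q' \<subseteq> {z. sqrt K * s / 2 \<le> norm z \<and> norm z \<le> 4 * (sqrt K * s)}"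
      proof (cases "i = 0")
        case True
        thus ?thesis using N c(4) by auto
      next
        case False
        thus ?thesis using N sub by (auto simp: good_def)
      qed
      hence "good (Suc i) (Q', s')" using c N sub sN s1 by (auto simp: good_def)
      moreover have "step i N (Q', s')" using c by (simp add: step_def)
      ultimately show "\<exists>y. (good (Suc i) y \<and> (Suc i = 0 \<longrightarrow> y = (annulus K s, s))) \<and> step i N y" by blast
    qed
    thus ?thesis by blast
  qed
  then obtain N where N: "\<And>i. good i (N i)" "\<And>i. step i (N i) (N (Suc i))" "N 0 = (annulus K s, s)" by blast
  define Q where "Q = (\<lambda>i. fst (N i))"
  define t where "t = (\<lambda>i. snd (N i))"
  have cellQ: "cell \<nu> K (Q i) i (t i)" and ti: "s \<le> t i" for i using N(1)[of i] by (auto simp: good_def Q_def t_def)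
  have dsc: "descends (Q (Suc i), Suc i, t (Suc i)) (Q i, i, t i)" "2 * t i \<le> t (Suc i)" for i
    using N(2)[of i] by (auto simp: step_def Q_def t_def)
  have Qdec: "Q (Suc i) \<subseteq> Q i" for i using dsc(1)[of i] by (simp add: descends_def)
  have Qmid: "sqrt K * s / 2 \<le> norm z" "norm z \<le> 4 * (sqrt K * s)" if "z \<in> Q i" "i \<ge> 1" for z i
    using N(1)[of i] that by (auto simp: good_def Q_def)
  have Qne: "Q i \<noteq> {}" for i
  proof -
    have "annulus K (t i) \<noteq> {}" using annulus_nonempty[of K "t i"] K(2) ti[of i] s1 by auto
    thus ?thesis using cellQ[of i] by (auto simp: cell_def)
  qed
  obtain y where y: "\<And>i. y \<in> Q i"
    using nested_compact_point[of Q] cellQ Qne Qdec unfolding cell_def by metis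
  have "y \<in> escaping_set f"
    by (rule escaping_of_descending_cells[of Q "\<lambda>i. i" t]) (use dsc y ti[of 0] s1 in auto)
  \<comment> \<open>In logarithmic coordinates the middle circle of the annulus has distance \<open>ln K / 2\<close> from its boundary.\<close>
  define \<rho> where "\<rho> = ln K / 2 - 4"
  have \<rho>: "\<rho> \<ge> 21 / (1 - c)" using K(1) by (simp add: \<rho>_def)
  have \<rho>19: "\<rho> \<ge> 21"
  proof -
    have "21 / 1 \<le> 21 / (1 - c)" using c by (intro divide_left_mono) auto
    thus ?thesis using \<rho> by linarith
  qed
  have lnsK: "ln (sqrt K) = ln K / 2" using K(2) by (simp add: ln_sqrt)
  have sK: "sqrt K > 0" using K(2) by simp
  define W where "W = {z::complex. s < norm (z - 0) \<and> norm (z - 0) < K * s}"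
  have W: "open W" "connected W" "W \<subseteq> U"
  proof -
    have "W = {z. s < norm z} \<inter> {z. norm z < K * s}" by (auto simp: W_def)
    thus "open W" by (auto intro!: open_Int open_Collect_less continuous_intros)
    show "connected W" unfolding W_def by (rule connected_annulus) simp
    have "W \<subseteq> annulus K s" by (auto simp: W_def annulus_def)
    thus "W \<subseteq> U" using U(1) by blast
  qed
  have exp_bounds: "s < exp x \<and> exp x < K * s" if "ln s + 1 \<le> x" "x \<le> ln K + ln s - 1" for x
  proof -
    have "exp (ln s) < exp x" "exp x < exp (ln K + ln s)" using that by auto
    moreover have "exp (ln s) = s" "exp (ln K + ln s) = K * s" using s1 K(2) by (simp_all add: exp_add)
    ultimately show ?thesis by simp
  qed
  define A where "A = {z::complex. exp (ln s + 1) \<le> norm z \<and> norm z \<le> exp (ln K + ln s - 1)}"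
  have AW: "A \<subseteq> W"
  proof
    fix z assume z: "z \<in> A"
    hence "norm z > 0" unfolding A_def using less_le_trans[OF exp_gt_zero] by blast
    define x where "x = ln (norm z)"
    have ex: "norm z = exp x" using \<open>norm z > 0\<close> by (simp add: x_def)
    show "z \<in> W" using z exp_bounds[of x] unfolding A_def W_def ex by (simp add: ex)
  qed
  have Ac: "compact A"
  proof -
    have "A = {z. exp (ln s + 1) \<le> norm z} \<inter> {z. norm z \<le> exp (ln K + ln s - 1)}" by (auto simp: A_def)
    hence "closed A" by (auto intro!: closed_Int closed_Collect_le continuous_intros)
    moreover have "A \<subseteq> cball 0 (exp (ln K + ln s - 1))" by (auto simp: A_def)
    hence "bounded A" using bounded_cball bounded_subset by blast
    ultimately show ?thesis by (simp add: compact_eq_bounded_closed)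
  qed
  have ln2: "ln (2::real) \<le> 1" "ln (4::real) \<le> 2"
  proof -
    show l: "ln (2::real) \<le> 1" using ln_le_minus_one[of "2::real"] by simp
    have "ln (4::real) = 2 * ln 2" using ln_realpow[of "2::real" 2] by simp
    thus "ln (4::real) \<le> 2" using l by simp
  qed
  have lnQ: "ln s + ln K / 2 - 1 \<le> ln (norm z)" "ln (norm z) \<le> ln s + ln K / 2 + 2" "norm z > 0" if z: "z \<in> Q 1" for z
  proof -
    have p: "sqrt K * s / 2 > 0" using sK s1 by simp
    have b: "sqrt K * s / 2 \<le> norm z" "norm z \<le> 4 * (sqrt K * s)" using Qmid[OF z] by auto
    show nz: "norm z > 0" using p b by linarith
    have "ln (sqrt K * s / 2) \<le> ln (norm z)" using p b by (intro ln_mono) auto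
    moreover have "ln (sqrt K * s / 2) = ln K / 2 + ln s - ln 2" using sK s1 by (simp add: ln_div ln_mult lnsK)
    ultimately show "ln s + ln K / 2 - 1 \<le> ln (norm z)" using ln2 by linarith
    have "ln (norm z) \<le> ln (4 * (sqrt K * s))" using nz b by (intro ln_mono) auto
    moreover have "ln (4 * (sqrt K * s)) = ln 4 + (ln K / 2 + ln s)" using sK s1 by (simp add: ln_mult lnsK)
    ultimately show "ln (norm z) \<le> ln s + ln K / 2 + 2" using ln2 by linarith
  qed
  have Q1W: "Q 1 \<subseteq> W"
  proof
    fix z assume z: "z \<in> Q 1"
    have "norm z = exp (ln (norm z))" using lnQ(3)[OF z] by simp
    moreover have "s < exp (ln (norm z)) \<and> exp (ln (norm z)) < K * s"
      using lnQ(1,2)[OF z] \<rho>19 by (intro exp_bounds) (auto simp: \<rho>_def)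
    ultimately show "z \<in> W" by (simp add: W_def)
  qed
  have yW: "y \<in> W" using y[of 1] Q1W by blast
  obtain \<tau> :: "nat \<Rightarrow> nat" where \<tau>: "strict_mono \<tau>"
    "\<And>u. u \<in> W \<Longrightarrow> \<exists>V. open V \<and> u \<in> V \<and> (\<forall>\<^sub>F n in sequentially. \<forall>v\<in>V. norm ((f ^^ \<tau> n) v) > 1)"
    using escape_spreads[OF hol U(2) W yW \<open>y \<in> escaping_set f\<close>] by blast
  define \<V> where "\<V> = {V. open V \<and> (\<forall>\<^sub>F n in sequentially. \<forall>v\<in>V. norm ((f ^^ \<tau> n) v) > 1)}"
  have "A \<subseteq> \<Union>\<V>" using \<tau>(2) AW unfolding \<V>_def by blast
  moreover have "\<And>V. V \<in> \<V> \<Longrightarrow> open V" by (simp add: \<V>_def)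
  ultimately obtain \<F> where \<F>: "\<F> \<subseteq> \<V>" "finite \<F>" "A \<subseteq> \<Union>\<F>" using compactE[OF Ac] by metis
  have "\<forall>\<^sub>F n in sequentially. \<forall>V\<in>\<F>. \<forall>v\<in>V. norm ((f ^^ \<tau> n) v) > 1"
    using \<F>(1,2) by (intro eventually_ball_finite) (auto simp: \<V>_def)
  hence "\<forall>\<^sub>F n in sequentially. (\<forall>V\<in>\<F>. \<forall>v\<in>V. norm ((f ^^ \<tau> n) v) > 1) \<and> n \<ge> 2"
    by (rule eventually_conj[OF _ eventually_ge_at_top])
  then obtain n where n: "\<forall>V\<in>\<F>. \<forall>v\<in>V. norm ((f ^^ \<tau> n) v) > 1" "n \<ge> 2"
    using eventually_happens by (metis (no_types, lifting) sequentially_bot)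
  have "\<tau> n \<ge> 2" using seq_suble[OF \<tau>(1), of n] n(2) by linarith
  then obtain m where m: "\<tau> n = Suc m" "m \<ge> 1" by (cases "\<tau> n") auto
  have big: "norm ((f ^^ Suc m) v) > 1" if "v \<in> A" for v using n(1) \<F>(3) that m(1) by fastforce
  define r where "r = t m"
  have r0: "radius0 \<le> r" "r \<ge> 1" using ti[of m] s S radius0(1) by (auto simp: r_def)
  obtain z1 where z1: "norm z1 = r" "norm (f z1) = exp (logM r)" using max_point[OF r0(1)] by blast
  obtain z2 where z2: "norm z2 = r" "norm (f z2) \<le> exp (c * logM r)" using min_point[OF r0(1)] by blast
  have inA: "z \<in> annulus K (t m)" if "norm z = r" for z
  proof -
    have "1 * r \<le> K * r" using K(2) r0 by (intro mult_right_mono) auto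
    thus ?thesis using that by (simp add: annulus_def r_def)
  qed
  have img: "(f ^^ m) ` Q m = annulus K (t m)" using cellQ[of m] by (simp add: cell_def)
  obtain q1 where q1: "q1 \<in> Q m" "(f ^^ m) q1 = z1" using inA[OF z1(1)] img by (metis imageE)
  obtain q2 where q2: "q2 \<in> Q m" "(f ^^ m) q2 = z2" using inA[OF z2(1)] img by (metis imageE)
  have "decseq Q" using Qdec by (rule decseq_SucI)
  hence Q1: "q1 \<in> Q 1" "q2 \<in> Q 1" using q1(1) q2(1) m(2) by (auto simp: decseq_def)
  have nz: "q1 \<noteq> 0" "q2 \<noteq> 0" using lnQ(3)[OF Q1(1)] lnQ(3)[OF Q1(2)] by auto
  define \<zeta>1 \<zeta>2 where "\<zeta>1 = Ln q1" and "\<zeta>2 = Ln q2"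
  have e: "exp \<zeta>1 = q1" "exp \<zeta>2 = q2" using nz by (auto simp: \<zeta>1_def \<zeta>2_def)
  have Re: "Re \<zeta>1 = ln (norm q1)" "Re \<zeta>2 = ln (norm q2)" using nz by (auto simp: \<zeta>1_def \<zeta>2_def)
  have d9: "dist \<zeta>1 \<zeta>2 \<le> 10"
  proof -
    have "\<bar>Re (\<zeta>1 - \<zeta>2)\<bar> \<le> 3" using lnQ[OF Q1(1)] lnQ[OF Q1(2)] Re by (simp add: abs_le_iff)
    moreover have "\<bar>Im (\<zeta>1 - \<zeta>2)\<bar> \<le> 2 * pi"
      using mpi_less_Im_Ln[OF nz(1)] Im_Ln_le_pi[OF nz(1)] mpi_less_Im_Ln[OF nz(2)] Im_Ln_le_pi[OF nz(2)]
      by (simp add: \<zeta>1_def \<zeta>2_def abs_le_iff)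
    ultimately show ?thesis using cmod_le[of "\<zeta>1 - \<zeta>2"] pi_less by (simp add: dist_norm)
  qed
  define g where "g = (\<lambda>z. (f ^^ Suc m) (exp z))"
  have holg: "g holomorphic_on ball \<zeta>1 \<rho>"
    unfolding g_def by (rule holomorphic_on_compose_gen[OF _ holomorphic_funpow[OF hol], unfolded o_def]) (auto intro!: holomorphic_intros)
  have gt: "norm (g w) > 1" if w: "w \<in> ball \<zeta>1 \<rho>" for w
  proof -
    have "\<bar>Re w - Re \<zeta>1\<bar> \<le> \<rho>" using abs_Re_le_cmod[of "w - \<zeta>1"] w by (simp add: dist_norm norm_minus_commute)
    hence "ln s + 1 \<le> Re w" "Re w \<le> ln K + ln s - 1"
      using lnQ(1,2)[OF Q1(1)] Re(1) by (auto simp: \<rho>_def abs_le_iff)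
    hence "exp w \<in> A" by (simp add: A_def)
    thus ?thesis unfolding g_def by (rule big)
  qed
  have in2: "\<zeta>2 \<in> ball \<zeta>1 \<rho>" using d9 \<rho>19 by simp
  define d where "d = dist \<zeta>1 \<zeta>2"
  have d: "0 \<le> d" "d \<le> 10" using d9 by (auto simp: d_def)
  have H: "(\<rho> - d) * ln (norm (g \<zeta>1)) \<le> (\<rho> + d) * ln (norm (g \<zeta>2))"
    using log_modulus_harnack(1)[OF holg gt in2] by (simp add: d_def)
  have g1: "norm (g \<zeta>1) = exp (logM r)" and g2: "norm (g \<zeta>2) \<le> exp (c * logM r)"
    using e q1(2) q2(2) z1(2) z2(2) by (auto simp: g_def)
  have "ln (norm (g \<zeta>2)) \<le> ln (exp (c * logM r))" using gt[OF in2] g2 by (intro ln_mono) auto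
  hence "(\<rho> + d) * ln (norm (g \<zeta>2)) \<le> (\<rho> + d) * (c * logM r)" using \<rho>19 d by (intro mult_left_mono) auto
  hence "(\<rho> - d) * logM r \<le> ((\<rho> + d) * c) * logM r" using H g1 by (simp add: mult.assoc)
  hence "\<rho> - d \<le> (\<rho> + d) * c" using logM_ge_1[OF r0(1)] by (simp add: mult_le_cancel_right)
  hence "\<rho> * (1 - c) \<le> d + d * c" by (simp add: algebra_simps)
  moreover have "d * c \<le> d * 1" using c d by (intro mult_left_mono) auto
  moreover have "21 / (1 - c) * (1 - c) \<le> \<rho> * (1 - c)" using \<rho> c by (intro mult_right_mono) auto
  moreover have "1 - c \<noteq> 0" using c by simp
  from nonzero_eq_divide_eq[THEN iffD1, OF this refl] have "21 / (1 - c) * (1 - c) = 21" .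
  ultimately show False using d by linarith
qed

end

section \<open>Covering numbers and dimensions\<close>

lemma covering_number_ge:
  fixes A :: "'a::euclidean_space set"
  assumes A: "bounded A" and d: "d > 0" and x: "\<And>i. i < n \<Longrightarrow> x i \<in> A"
    and sep: "\<And>i j. j < i \<Longrightarrow> i < n \<Longrightarrow> 2 * d < dist (x i) (x j)"
  shows "n \<le> covering_number d A"
proof -
  have "compact (closure A)" using A by (simp add: compact_closure)
  then obtain k where k: "finite k" "closure A \<subseteq> (\<Union>c\<in>k. ball c d)"
    using d compact_eq_totally_bounded by metis
  have "A \<subseteq> (\<Union>c\<in>k. cball c d)" using k(2) closure_subset[of A] ball_subset_cball by blast
  hence "\<exists>m C. finite C \<and> card C = m \<and> A \<subseteq> (\<Union>c\<in>C. cball c d)" using k(1) by blast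
  from LeastI_ex[OF this] obtain C where C: "finite C" "card C = covering_number d A" "A \<subseteq> (\<Union>c\<in>C. cball c d)"
    unfolding covering_number_def by blast
  have "\<forall>i. \<exists>c. i < n \<longrightarrow> c \<in> C \<and> x i \<in> cball c d" using C(3) x by blast
  then obtain c where c: "\<And>i. i < n \<Longrightarrow> c i \<in> C \<and> x i \<in> cball (c i) d" by metis
  have neq: "c i \<noteq> c j" if "j < i" "i < n" for i j
  proof
    assume eq: "c i = c j"
    have "dist (x i) (x j) \<le> dist (c i) (x i) + dist (c j) (x j)"
      using dist_triangle[of "x i" "x j" "c i"] eq by (simp add: dist_commute)
    also have "\<dots> \<le> d + d" using c[of i] c[of j] that by (intro add_mono) auto
    finally show False using sep[OF that] by linarith
  qed
  have "inj_on c {..<n}"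
  proof (rule inj_onI)
    fix i j assume "i \<in> {..<n}" "j \<in> {..<n}" "c i = c j"
    thus "i = j" using neq[of i j] neq[of j i] by (cases i j rule: linorder_cases) auto
  qed
  hence "n = card (c ` {..<n})" by (simp add: card_image)
  also have "\<dots> \<le> card C" using c C(1) by (intro card_mono) auto
  finally show ?thesis using C(2) by simp
qed

lemma covering_number_le_card:
  assumes "finite C" "A \<subseteq> (\<Union>c\<in>C. cball c d)"
  shows "covering_number d A \<le> card C"
  unfolding covering_number_def using assms by (intro Least_le) blast

text \<open>For small \<open>d\<close> the factor 3 is absorbed by giving up a second \<open>\<epsilon>\<close>.\<close>

lemma upper_box_dim_ge:
  fixes A :: "'a::euclidean_space set"
  assumes \<epsilon>: "0 < \<epsilon>" "\<epsilon> < 2"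
    and many: "\<And>d0. d0 > 0 \<Longrightarrow> \<exists>d. 0 < d \<and> d < d0 \<and> (1 / (3 * d)) powr (2 - \<epsilon>) \<le> real (covering_number d A)"
  shows "ereal (2 - 2 * \<epsilon>) \<le> upper_box_dim A"
proof (rule ccontr)
  assume "\<not> ereal (2 - 2 * \<epsilon>) \<le> upper_box_dim A"
  hence "Limsup (at_right 0) (\<lambda>d. ereal (ln (real (covering_number d A)) / ln (1 / d))) < ereal (2 - 2 * \<epsilon>)"
    by (simp add: upper_box_dim_def not_le)
  from Limsup_lessD[OF this] obtain b where b: "b > 0" "\<And>d. 0 < d \<Longrightarrow> d < b \<Longrightarrow> ln (real (covering_number d A)) / ln (1 / d) < 2 - 2 * \<epsilon>"
    unfolding eventually_at_right_field by auto
  define d0 where "d0 = min b (min (exp (- (2 * ln 3 / \<epsilon>))) (1/2))"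
  have "d0 > 0" using b(1) by (simp add: d0_def)
  then obtain d where d: "0 < d" "d < d0" "(1 / (3 * d)) powr (2 - \<epsilon>) \<le> real (covering_number d A)"
    using many by blast
  have db: "d < b" "d < exp (- (2 * ln 3 / \<epsilon>))" "d < 1" using d(2) by (auto simp: d0_def)
  define L where "L = ln (1 / d)"
  have "ln d < ln (exp (- (2 * ln 3 / \<epsilon>)))" using db(2) d(1) by (subst ln_less_cancel_iff) auto
  hence L: "L > 2 * ln 3 / \<epsilon>" using d(1) by (simp add: L_def ln_div)
  have L0: "L > 0" unfolding L_def using d(1) db(3) by simp
  have "ln ((1 / (3 * d)) powr (2 - \<epsilon>)) \<le> ln (real (covering_number d A))"
    using d by (intro ln_mono) auto
  moreover have "ln ((1 / (3 * d)) powr (2 - \<epsilon>)) = (2 - \<epsilon>) * (L - ln 3)"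
    using d(1) by (simp add: L_def ln_powr ln_div ln_mult)
  moreover have "ln (real (covering_number d A)) < (2 - 2 * \<epsilon>) * L"
    using b(2)[OF d(1) db(1)] L0 by (simp add: L_def divide_less_eq)
  ultimately have "(2 - \<epsilon>) * (L - ln 3) < (2 - 2 * \<epsilon>) * L" by linarith
  hence "\<epsilon> * L < (2 - \<epsilon>) * ln 3" by (simp add: algebra_simps)
  moreover have "2 * ln 3 < \<epsilon> * L" using L \<epsilon> by (simp add: divide_less_eq mult.commute)
  moreover have "(2 - \<epsilon>) * ln 3 \<le> 2 * ln (3::real)" using \<epsilon> by (intro mult_right_mono) auto
  ultimately show False by linarith
qed

text \<open>The centres of the covering discs form a square grid of side \<open>d\<close>.\<close>

lemma covering_number_cball_le:
  assumes d: "0 < d" "d < 1" and r: "r \<ge> 0"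
  shows "real (covering_number d (cball (0::complex) r)) \<le> ((2 * r + 3) / d)\<^sup>2"
proof -
  define m where "m = \<lceil>r / d\<rceil>"
  have "r / d \<ge> 0" using d r by simp
  hence m: "r / d \<le> m" "m \<le> r / d + 1" "m \<ge> 0" unfolding m_def by linarith+
  define C where "C = (\<lambda>(a, b). Complex (of_int a * d) (of_int b * d)) ` ({-m..m} \<times> {-m..m})"
  have finC: "finite C" by (simp add: C_def)
  have near: "\<exists>a\<in>{-m..m}. \<bar>t - of_int a * d\<bar> \<le> d / 2" if t: "\<bar>t\<bar> \<le> r" for t
  proof
    define a where "a = round (t / d)"
    have "\<bar>of_int a - t / d\<bar> \<le> 1/2" unfolding a_def by (rule of_int_round_abs_le)
    hence "\<bar>of_int a - t / d\<bar> * d \<le> 1/2 * d" using d by (intro mult_right_mono) auto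
    moreover have "\<bar>of_int a - t / d\<bar> * d = \<bar>t - of_int a * d\<bar>"
    proof -
      have "\<bar>of_int a - t / d\<bar> * d = \<bar>(of_int a - t / d) * d\<bar>" using d by (simp add: abs_mult)
      also have "(of_int a - t / d) * d = - (t - of_int a * d)" using d by (simp add: algebra_simps)
      finally show ?thesis by simp
    qed
    ultimately show "\<bar>t - of_int a * d\<bar> \<le> d / 2" by simp
    have "\<bar>t / d\<bar> \<le> m"
    proof -
      have "\<bar>t / d\<bar> \<le> r / d" using t d by (simp add: divide_right_mono)
      thus ?thesis using m(1) by linarith
    qed
    hence "\<bar>of_int a\<bar> \<le> of_int m + (1/2::real)" using \<open>\<bar>of_int a - t / d\<bar> \<le> 1/2\<close> by linarith
    hence "real_of_int a < real_of_int (m + 1)" "real_of_int (- a) < real_of_int (m + 1)"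
      unfolding of_int_add of_int_minus of_int_1 by linarith+
    hence "a < m + 1" "- a < m + 1" by (simp_all only: of_int_less_iff)
    thus "a \<in> {-m..m}" by simp
  qed
  have "cball (0::complex) r \<subseteq> (\<Union>c\<in>C. cball c d)"
  proof
    fix z :: complex assume z: "z \<in> cball 0 r"
    have "\<bar>Re z\<bar> \<le> r" "\<bar>Im z\<bar> \<le> r" using z abs_Re_le_cmod[of z] abs_Im_le_cmod[of z] by auto
    then obtain a b where ab: "a \<in> {-m..m}" "\<bar>Re z - of_int a * d\<bar> \<le> d / 2" "b \<in> {-m..m}" "\<bar>Im z - of_int b * d\<bar> \<le> d / 2"
      using near by blast
    define w where "w = Complex (of_int a * d) (of_int b * d)"
    have "w \<in> C" using ab unfolding C_def w_def by auto
    moreover have "dist w z \<le> d" using cmod_le[of "z - w"] ab by (simp add: dist_norm norm_minus_commute w_def)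
    ultimately show "z \<in> (\<Union>c\<in>C. cball c d)" by auto
  qed
  hence "covering_number d (cball (0::complex) r) \<le> card C" by (rule covering_number_le_card[OF finC])
  also have "card C \<le> card ({-m..m} \<times> {-m..m})" unfolding C_def by (rule card_image_le) simp
  also have "\<dots> = (nat (2 * m + 1))\<^sup>2" by (simp add: card_cartesian_product power2_eq_square)
  finally have "real (covering_number d (cball (0::complex) r)) \<le> (real (nat (2 * m + 1)))\<^sup>2"
    by (metis of_nat_le_iff of_nat_power)
  also have "\<dots> \<le> ((2 * r + 3) / d)\<^sup>2"
  proof (rule power_mono)
    have "real (nat (2 * m + 1)) = 2 * of_int m + 1" using m(3) by simp
    also have "\<dots> \<le> 2 * r / d + 3" using m(2) by simp
    also have "\<dots> \<le> 2 * r / d + 3 / d" using d by (simp add: le_divide_eq)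
    finally show "real (nat (2 * m + 1)) \<le> (2 * r + 3) / d" by (simp add: add_divide_distrib)
  qed simp
  finally show ?thesis .
qed

lemma upper_box_dim_cball_le:
  assumes r: "r \<ge> 0"
  shows "upper_box_dim (cball (0::complex) r) \<le> 2"
proof (rule ereal_le_epsilon2)
  fix e :: real assume e: "e > 0"
  define P where "P = ln (2 * r + 3)"
  have P: "P > 0" using r by (simp add: P_def)
  define b where "b = min (1/2) (exp (- (2 * P / e)))"
  have "b \<le> 1/2" unfolding b_def by (rule min.cobounded1)
  hence b: "b > 0" "b < 1" by (simp_all add: b_def)
  have "\<forall>\<^sub>F d in at_right 0. ereal (ln (real (covering_number d (cball (0::complex) r))) / ln (1 / d)) \<le> 2 + ereal e"
  proof (subst eventually_at_right_field, intro exI conjI allI impI)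
    show "0 < b" by (rule b(1))
    fix d assume d: "0 < d" "d < b"
    define L where "L = ln (1 / d)"
    have d1: "d < 1" using d b by linarith
    have L0: "L > 0" unfolding L_def using d d1 by simp
    have "d < exp (- (2 * P / e))" using d by (simp add: b_def)
    hence "ln d < ln (exp (- (2 * P / e)))" using d by (subst ln_less_cancel_iff) auto
    hence L: "2 * P / e < L" using d by (simp add: L_def ln_div)
    have "ln (real (covering_number d (cball (0::complex) r))) \<le> 2 * P + 2 * L"
    proof (cases "covering_number d (cball (0::complex) r) = 0")
      case True
      thus ?thesis using P L0 by simp
    next
      case False
      have "ln (real (covering_number d (cball (0::complex) r))) \<le> ln (((2 * r + 3) / d)\<^sup>2)"
        using False covering_number_cball_le[OF d(1) d1 r] by (intro ln_mono) auto
      also have "\<dots> = 2 * ln ((2 * r + 3) / d)" using ln_realpow[of "(2 * r + 3) / d" 2] d r by simp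
      also have "ln ((2 * r + 3) / d) = P + L" using d r by (simp add: P_def L_def ln_div)
      finally show ?thesis by simp
    qed
    also have "2 * P + 2 * L \<le> (2 + e) * L" using L e by (simp add: divide_less_eq algebra_simps)
    finally have "ln (real (covering_number d (cball (0::complex) r))) / ln (1 / d) \<le> 2 + e"
      unfolding L_def[symmetric] using L0 by (simp add: divide_le_eq)
    thus "ereal (ln (real (covering_number d (cball (0::complex) r))) / ln (1 / d)) \<le> 2 + ereal e"
      by (metis ereal_less_eq(3) numeral_eq_ereal plus_ereal.simps(1))
  qed
  thus "upper_box_dim (cball (0::complex) r) \<le> 2 + ereal e"
    unfolding upper_box_dim_def by (rule Limsup_bounded)
qed

lemma packing_dim_complex_le: "packing_dim (A :: complex set) \<le> 2"
proof -
  define B where "B = (\<lambda>i::nat. cball (0::complex) (real i))"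
  have "A \<subseteq> (\<Union>i. B i)"
  proof
    fix z :: complex
    obtain i :: nat where "norm z \<le> real i" using real_arch_simple by blast
    thus "z \<in> (\<Union>i. B i)" by (auto simp: B_def)
  qed
  hence "B \<in> {B :: nat \<Rightarrow> complex set. (\<forall>i. bounded (B i)) \<and> A \<subseteq> (\<Union>i. B i)}" by (simp add: B_def)
  hence "packing_dim A \<le> (SUP i. upper_box_dim (B i))" unfolding packing_dim_def by (rule INF_lower)
  also have "\<dots> \<le> 2" unfolding B_def by (intro SUP_least upper_box_dim_cball_le) simp
  finally show ?thesis .
qed

section \<open>Baire argument in the tree and the packing dimension\<close>

context small_minimum_modulus
begin

lemma quasi_julia_set_meets_cell:
  assumes Q: "cell \<nu> K Q k s" and meets: "quasi_julia_set f \<inter> annulus K s \<noteq> {}"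
  shows "quasi_julia_set f \<inter> Q \<noteq> {}"
proof -
  obtain w where w: "w \<in> quasi_julia_set f" "w \<in> annulus K s" using meets by blast
  then obtain x where x: "x \<in> Q" "w = (f ^^ k) x" using Q unfolding cell_def by blast
  have "x \<in> quasi_julia_set f" using quasi_julia_set_backward_invariant[OF hol nonconst] w x by blast
  thus ?thesis using x by blast
qed

text \<open>Baire's argument in the tree. If it failed, one could descend to a cell missed by \<open>B i\<close> for
  \<open>i = 0, 1, 2, ...\<close> in turn, passing to a child after each step so that the levels and the radii increase. The
  compact sets \<open>Q i \<inter> quasi_julia_set f\<close> are nested and nonempty, and a common point would be uncovered.\<close>

lemma some_piece_meets_all_descendants:
  fixes B :: "nat \<Rightarrow> complex set"
  assumes K: "K \<ge> 16" and \<nu>: "\<nu> > 0" and P: "\<And>s. s \<ge> S \<Longrightarrow> productive \<epsilon> \<nu> K s" and S: "S \<ge> 1"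
    and meets: "\<And>s. s \<ge> S \<Longrightarrow> quasi_julia_set f \<inter> annulus K s \<noteq> {}"
    and cov: "escaping_set f \<inter> quasi_julia_set f \<subseteq> (\<Union>i. B i)"
  obtains i Q k s where "cell \<nu> K Q k s" "s \<ge> S"
    "\<And>Q' k' s'. cell \<nu> K Q' k' s' \<Longrightarrow> descends (Q', k', s') (Q, k, s) \<Longrightarrow> B i \<inter> Q' \<noteq> {}"
proof (rule ccontr)
  note main = that
  assume no: "\<not> thesis"
  have bad: "\<exists>Q' k' s'. cell \<nu> K Q' k' s' \<and> descends (Q', k', s') (Q, k, s) \<and> B i \<inter> Q' = {}"
    if "cell \<nu> K Q k s" "s \<ge> S" for i Q k s
    using main[OF that] no by blast
  define good where "good = (\<lambda>(i::nat) (N :: complex set \<times> nat \<times> real). case N of (Q, k, s) \<Rightarrow> cell \<nu> K Q k s \<and> s \<ge> S)"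
  define step where "step = (\<lambda>(i::nat) (N :: complex set \<times> nat \<times> real) (N' :: complex set \<times> nat \<times> real).
     descends N' N \<and> fst (snd N) < fst (snd N') \<and> 2 * snd (snd N) \<le> snd (snd N') \<and> B i \<inter> fst N' = {})"
  have "\<exists>N. \<forall>i. good i (N i) \<and> step i (N i) (N (Suc i))"
  proof (rule dependent_nat_choice)
    show "\<exists>x. good 0 x" using root_cell[OF S \<nu>, of K] by (intro exI[of _ "(annulus K S, 0, S)"]) (simp add: good_def)
    fix N i assume "good i N"
    then obtain Q k s where N: "N = (Q, k, s)" "cell \<nu> K Q k s" "s \<ge> S" by (cases N) (auto simp: good_def)
    obtain Q1 k1 s1 where N1: "cell \<nu> K Q1 k1 s1" "descends (Q1, k1, s1) (Q, k, s)" "B i \<inter> Q1 = {}"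
      using bad[OF N(2,3)] by blast
    have s1: "s1 \<ge> S" "s1 \<ge> 1" "s \<le> s1" "k \<le> k1" using N1(2) N(3) S by (auto simp: descends_def)
    obtain Q2 s2 where N2: "cell \<nu> K Q2 (Suc k1) s2" "descends (Q2, Suc k1, s2) (Q1, k1, s1)" "2 * s1 \<le> s2"
      using productive_child[OF P[OF s1(1)] N1(1) K s1(2) \<nu>] by blast
    have "Q2 \<subseteq> Q1" using N2(2) by (simp add: descends_def)
    hence "step i N (Q2, Suc k1, s2)"
      using descends_trans[OF N2(2) N1(2)] N(1) N1(3) N2(3) s1 by (auto simp: step_def)
    moreover have "good (Suc i) (Q2, Suc k1, s2)" using N2 s1 by (simp add: good_def)
    ultimately show "\<exists>y. good (Suc i) y \<and> step i N y" by blast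
  qed
  then obtain N where N: "\<And>i. good i (N i)" "\<And>i. step i (N i) (N (Suc i))" by blast
  define Q k s where "Q = (\<lambda>i. fst (N i))" and "k = (\<lambda>i. fst (snd (N i)))" and "s = (\<lambda>i. snd (snd (N i)))"
  have Neq: "N i = (Q i, k i, s i)" for i by (simp add: Q_def k_def s_def)
  have cellQ: "cell \<nu> K (Q i) (k i) (s i)" "S \<le> s i" for i using N(1)[of i] by (auto simp: good_def Neq)
  have st: "descends (Q (Suc i), k (Suc i), s (Suc i)) (Q i, k i, s i)" "k i < k (Suc i)" "2 * s i \<le> s (Suc i)" "B i \<inter> Q (Suc i) = {}" for i
    using N(2)[of i] by (auto simp: step_def Neq)
  have "\<exists>y. \<forall>i. y \<in> Q i \<inter> quasi_julia_set f"
  proof -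
    have "compact (Q i \<inter> quasi_julia_set f)" for i using cellQ(1)[of i] closed_quasi_julia_set by (auto simp: cell_def intro: compact_Int_closed)
    moreover have "Q i \<inter> quasi_julia_set f \<noteq> {}" for i using quasi_julia_set_meets_cell[OF cellQ(1) meets[OF cellQ(2)]] by (metis inf_commute)
    moreover have "Q (Suc i) \<inter> quasi_julia_set f \<subseteq> Q i \<inter> quasi_julia_set f" for i using st(1)[of i] by (auto simp: descends_def)
    ultimately show ?thesis using nested_compact_point[of "\<lambda>i. Q i \<inter> quasi_julia_set f"] by metis
  qed
  then obtain y where y: "\<And>i. y \<in> Q i" "y \<in> quasi_julia_set f" by blast
  have "y \<in> escaping_set f"
    by (rule escaping_of_descending_cells[of Q k s, OF st(1-3) _ y(1)]) (use cellQ(2)[of 0] S in simp)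
  then obtain i where "y \<in> B i" using cov y(2) by blast
  thus False using st(4)[of i] y(1)[of "Suc i"] by blast
qed

text \<open>A set that meets all descendants of a cell meets all children of a descendant of arbitrarily
  large radius \<open>s'\<close>. These are \<open>n\<close> sets separated by \<open>\<delta> * s' powr - \<nu>\<close>, a scale that tends to 0 as \<open>s'\<close> grows.\<close>

lemma piece_has_large_dimension:
  fixes A :: "complex set"
  assumes K: "K \<ge> 16" and \<nu>: "\<nu> > 0" and P: "\<And>s. s \<ge> S \<Longrightarrow> productive \<epsilon> \<nu> K s" and S: "S \<ge> 1"
    and \<epsilon>: "0 < \<epsilon>" "\<epsilon> < 2" and A: "bounded A"
    and Q: "cell \<nu> K Q k s" "s \<ge> S"
    and hit: "\<And>Q' k' s'. cell \<nu> K Q' k' s' \<Longrightarrow> descends (Q', k', s') (Q, k, s) \<Longrightarrow> A \<inter> Q' \<noteq> {}"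
  shows "ereal (2 - 2 * \<epsilon>) \<le> upper_box_dim A"
proof (rule upper_box_dim_ge[OF \<epsilon>])
  fix d0 :: real assume d0: "d0 > 0"
  have deep: "\<exists>Q' k' s'. cell \<nu> K Q' k' s' \<and> 2 ^ m * s \<le> s' \<and> S \<le> s' \<and> (m = 0 \<and> (Q', k', s') = (Q, k, s) \<or> descends (Q', k', s') (Q, k, s))" for m
  proof (induction m)
    case 0
    show ?case using Q by auto
  next
    case (Suc m)
    then obtain Q' k' s' where I: "cell \<nu> K Q' k' s'" "2 ^ m * s \<le> s'" "S \<le> s'" "m = 0 \<and> (Q', k', s') = (Q, k, s) \<or> descends (Q', k', s') (Q, k, s)"
      by blast
    have s1: "s' \<ge> 1" using I(3) S by simp
    obtain Q2 s2 where N2: "cell \<nu> K Q2 (Suc k') s2" "descends (Q2, Suc k', s2) (Q', k', s')" "2 * s' \<le> s2"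
      using productive_child[OF P[OF I(3)] I(1) K s1 \<nu>] by blast
    have "descends (Q2, Suc k', s2) (Q, k, s)" using I(4) N2(2) descends_trans by blast
    moreover have "2 ^ Suc m * s \<le> s2" "S \<le> s2" using I(2,3) N2(3) S by auto
    ultimately show ?case using N2(1) by blast
  qed
  have "filterlim (\<lambda>s::real. s powr (2 * \<nu>)) at_top at_top" by (rule powr_at_top) (use \<nu> in simp)
  hence "\<forall>\<^sub>F s::real in at_top. 1 / d0 \<le> s powr (2 * \<nu>) \<and> 1 \<le> s"
    by (auto simp: filterlim_at_top intro: eventually_conj eventually_ge_at_top)
  then obtain s0 where s0: "\<And>s. s \<ge> s0 \<Longrightarrow> 1 / d0 \<le> s powr (2 * \<nu>)" unfolding eventually_at_top_linorder by blast
  obtain m0 where m0: "s0 < 2 ^ m0" using real_arch_pow[of 2 s0] by auto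
  have s1: "s \<ge> 1" using Q(2) S by simp
  obtain Q' k' s' where I: "cell \<nu> K Q' k' s'" "2 ^ Suc m0 * s \<le> s'" "S \<le> s'" "descends (Q', k', s') (Q, k, s)"
    using deep[of "Suc m0"] by auto
  have s'1: "s' \<ge> 1" using I(3) S by simp
  have "2 ^ m0 * 1 \<le> 2 ^ Suc m0 * s" using s1 by (intro mult_mono) auto
  hence "s0 \<le> s'" using m0 I(2) by linarith
  hence inv: "1 / d0 \<le> s' powr (2 * \<nu>)" by (rule s0)
  obtain \<delta> n Ds t where ch: "0 < \<delta>" "\<delta> \<le> s' powr - \<nu>" "(s' powr \<nu> / \<delta>) powr (2 - \<epsilon>) \<le> real n" "child_system \<nu> K s' \<delta> n Ds t"
    using P[OF I(3)] unfolding productive_def by blast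
  define R where "R = (\<lambda>i. Q' \<inter> (f ^^ k') -` Ds i \<inter> (f ^^ Suc k') -` annulus K (t i))"
  note c = child_cell[OF I(1) K s'1 \<nu> ch(4)]
  have "\<exists>x. x \<in> A \<inter> R i" if "i < n" for i
    using hit[OF c(1)[OF that] descends_trans[OF c(2)[OF that] I(4)]] unfolding R_def by blast
  then obtain x where x: "\<And>i. i < n \<Longrightarrow> x i \<in> A" "\<And>i. i < n \<Longrightarrow> x i \<in> R i" by (metis IntD1 IntD2)
  \<comment> \<open>Less than half of the separation, so that no disc of radius \<open>d\<close> contains two of the points.\<close>
  define d where "d = \<delta> * s' powr - \<nu> / 3"
  have d: "d > 0" using ch(1) s'1 by (simp add: d_def)
  have sep: "2 * d < dist (x i) (x j)" if "j < i" "i < n" for i j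
  proof -
    have "\<delta> * s' powr - \<nu> \<le> norm (x i - x j)" by (rule c(5)[OF that(2,1)]) (use x(2)[of i] x(2)[of j] that in \<open>simp_all add: R_def\<close>)
    thus ?thesis using d by (simp add: dist_norm d_def)
  qed
  have "real n \<le> real (covering_number d A)" using covering_number_ge[OF A d x(1) sep] by simp
  moreover have "1 / (3 * d) = s' powr \<nu> / \<delta>" using ch(1) s'1 by (simp add: d_def powr_minus field_simps)
  ultimately have cov: "(1 / (3 * d)) powr (2 - \<epsilon>) \<le> real (covering_number d A)" using ch(3) by simp
  have "d < d0"
  proof -
    have "\<delta> * s' powr - \<nu> \<le> s' powr - \<nu> * s' powr - \<nu>" using ch(2) by (intro mult_right_mono) auto
    also have "\<dots> = inverse (s' powr (2 * \<nu>))" by (simp add: powr_minus[symmetric] flip: powr_add)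
    also have "\<dots> \<le> inverse (1 / d0)" using inv d0 by (intro le_imp_inverse_le) auto
    also have "\<dots> = d0" by simp
    finally show ?thesis using d unfolding d_def by simp
  qed
  thus "\<exists>d>0. d < d0 \<and> (1 / (3 * d)) powr (2 - \<epsilon>) \<le> real (covering_number d A)" using d cov by blast
qed

lemma packing_dim_ge:
  assumes \<epsilon>: "0 < \<epsilon>" "\<epsilon> \<le> 1"
  shows "ereal (2 - 2 * \<epsilon>) \<le> packing_dim (escaping_set f \<inter> julia_set f)"
  unfolding packing_dim_def
proof (rule INF_greatest)
  fix B :: "nat \<Rightarrow> complex set"
  assume "B \<in> {B. (\<forall>i. bounded (B i)) \<and> escaping_set f \<inter> julia_set f \<subseteq> (\<Union>i. B i)}"
  hence B: "\<And>i. bounded (B i)" "escaping_set f \<inter> julia_set f \<subseteq> (\<Union>i. B i)" by auto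
  \<comment> \<open>The exponential is required by \<open>quasi_julia_set_meets_annulus\<close>; \<open>K \<ge> 16\<close> puts the discs of a \<open>child_system\<close> into the annulus.\<close>
  define K where "K = exp (2 * (21 / (1 - c) + 4)) + 16"
  have K: "K \<ge> 16" "K \<ge> 1" by (auto simp: K_def add_increasing)
  have lnK: "2 * (21 / (1 - c) + 4) \<le> ln K"
  proof -
    have "ln (exp (2 * (21 / (1 - c) + 4))) \<le> ln K" by (intro ln_mono) (auto simp: K_def)
    thus ?thesis by simp
  qed
  obtain \<nu> where \<nu>: "\<nu> > 0" "\<And>K. K \<ge> 1 \<Longrightarrow> \<forall>\<^sub>F s in at_top. productive \<epsilon> \<nu> K s"
    using children[OF \<epsilon>] by blast
  obtain S0 where S0: "\<And>s. s \<ge> S0 \<Longrightarrow> productive \<epsilon> \<nu> K s"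
    using \<nu>(2)[OF K(2)] unfolding eventually_at_top_linorder by blast
  define S where "S = max S0 radius0"
  have S: "S \<ge> radius0" "S \<ge> 1" and P: "\<And>s. s \<ge> S \<Longrightarrow> productive \<epsilon> \<nu> K s" using radius0(1) S0 by (auto simp: S_def)
  have meets: "quasi_julia_set f \<inter> annulus K s \<noteq> {}" if "s \<ge> S" for s
    by (rule quasi_julia_set_meets_annulus[OF lnK K(1) \<nu>(1) P S(1) that])
  have cov: "escaping_set f \<inter> quasi_julia_set f \<subseteq> (\<Union>i. B i)"
    using B(2) quasi_julia_set_subset_julia_set[OF cont] by blast
  obtain i Q k s where N: "cell \<nu> K Q k s" "s \<ge> S"
    "\<And>Q' k' s'. cell \<nu> K Q' k' s' \<Longrightarrow> descends (Q', k', s') (Q, k, s) \<Longrightarrow> B i \<inter> Q' \<noteq> {}"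
    using some_piece_meets_all_descendants[OF K(1) \<nu>(1) P S(2) meets cov] by metis
  have "\<epsilon> < 2" using \<epsilon> by simp
  have "ereal (2 - 2 * \<epsilon>) \<le> upper_box_dim (B i)"
    by (rule piece_has_large_dimension[OF K(1) \<nu>(1) P S(2) \<epsilon>(1) \<open>\<epsilon> < 2\<close> B(1) N])
  also have "\<dots> \<le> (SUP i. upper_box_dim (B i))" by (rule SUP_upper) simp
  finally show "ereal (2 - 2 * \<epsilon>) \<le> (SUP i. upper_box_dim (B i))" .
qed

lemma packing_dim_escaping_julia: "packing_dim (escaping_set f \<inter> julia_set f) = 2"
proof (rule antisym[OF packing_dim_complex_le])
  show "2 \<le> packing_dim (escaping_set f \<inter> julia_set f)"
  proof (rule ereal_le_epsilon2)
    fix e :: real assume e: "e > 0"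
    define \<epsilon> where "\<epsilon> = min 1 (e / 2)"
    have \<epsilon>: "0 < \<epsilon>" "\<epsilon> \<le> 1" "2 * \<epsilon> \<le> e" using e by (auto simp: \<epsilon>_def)
    have "(2::ereal) = ereal (2 - 2 * \<epsilon>) + ereal (2 * \<epsilon>)" by simp
    also have "\<dots> \<le> packing_dim (escaping_set f \<inter> julia_set f) + ereal e"
      using \<epsilon> by (intro add_mono packing_dim_ge) auto
    finally show "2 \<le> packing_dim (escaping_set f \<inter> julia_set f) + ereal e" .
  qed
qed

end

text \<open>Extracts a real constant from the hypothesis; circles through zeros of \<open>f\<close> satisfy the conclusion
  trivially.\<close>

lemma eventually_min_modulus_le:
  assumes hol: "f holomorphic_on UNIV"
    and large: "\<forall>\<^sub>F r in at_top. max_modulus r f > exp 1"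
    and lim: "Limsup at_top (\<lambda>r::real. log_ereal (min_modulus r f) / log_ereal (max_modulus r f)) < 1"
  obtains c where "0 < c" "c < 1" "\<forall>\<^sub>F r in at_top. min_modulus r f \<le> exp (c * ln (max_modulus r f))"
proof -
  obtain l where l: "Limsup at_top (\<lambda>r::real. log_ereal (min_modulus r f) / log_ereal (max_modulus r f)) < ereal l" "ereal l < 1"
    using ereal_dense2[OF lim] by blast
  define c where "c = max l (1/2)"
  have c: "0 < c" "c < 1" using l(2) by (auto simp: c_def)
  have "\<forall>\<^sub>F r in at_top. log_ereal (min_modulus r f) / log_ereal (max_modulus r f) < ereal l"
    by (rule Limsup_lessD[OF l(1)])
  hence "\<forall>\<^sub>F r in at_top. min_modulus r f \<le> exp (c * ln (max_modulus r f))"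
    using large eventually_ge_at_top[of 0]
  proof eventually_elim
    case (elim r)
    obtain z where z: "norm (f z) = min_modulus r f" using min_modulus_attained[OF hol elim(3)] by blast
    have m0: "min_modulus r f \<ge> 0" using z norm_ge_zero by metis
    have Mpos: "max_modulus r f > 0" using elim(2) exp_gt_zero[of "1::real"] by linarith
    have lnM: "ln (max_modulus r f) > 0"
    proof -
      have "ln (exp 1) < ln (max_modulus r f)" using elim(2) Mpos by (subst ln_less_cancel_iff) auto
      thus ?thesis by simp
    qed
    show ?case
    proof (cases "min_modulus r f = 0")
      case False
      hence mpos: "min_modulus r f > 0" using m0 by simp
      have "ereal (ln (min_modulus r f)) / ereal (ln (max_modulus r f)) < ereal l"
        using elim(1) False Mpos by (simp add: log_ereal_def)
      hence "ln (min_modulus r f) / ln (max_modulus r f) < l" using lnM by simp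
      hence "ln (min_modulus r f) \<le> l * ln (max_modulus r f)" using lnM by (simp add: divide_less_eq)
      also have "\<dots> \<le> c * ln (max_modulus r f)" using lnM by (intro mult_right_mono) (auto simp: c_def)
      finally have "exp (ln (min_modulus r f)) \<le> exp (c * ln (max_modulus r f))" by simp
      thus ?thesis using mpos by simp
    qed simp
  qed
  thus ?thesis using that c by blast
qed

theorem corollary1p2:
  fixes f :: "complex \<Rightarrow> complex"
  assumes "transcendental_entire f"
    and "Limsup at_top (\<lambda>r::real. log_ereal (min_modulus r f) / log_ereal (max_modulus r f)) < 1"
  shows "packing_dim (escaping_set f \<inter> julia_set f) = 2"
proof -
  have hol: "f holomorphic_on UNIV" using assms(1) by (simp add: transcendental_entire_def)
  have nc: "\<not> f constant_on UNIV"
  proof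
    assume "f constant_on UNIV"
    then obtain a where "\<And>z. f z = a" by (auto simp: constant_on_def)
    hence "\<forall>z. f z = poly [:a:] z" by simp
    thus False using assms(1) unfolding transcendental_entire_def by blast
  qed
  obtain c where c: "0 < c" "c < 1" "\<forall>\<^sub>F r in at_top. min_modulus r f \<le> exp (c * ln (max_modulus r f))"
    using eventually_min_modulus_le[OF hol max_modulus_unbounded[OF hol nc] assms(2)] .
  interpret small_minimum_modulus f c
    by unfold_locales (use hol nc c in auto)
  show ?thesis by (rule packing_dim_escaping_julia)
qed

end
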